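(* Let $A$ be a unital separable $C^*$-algebra and let $\alpha\colon G\to\mathrm{Aut}(A)$ be an action of a second countable compact group $G$. Then the following are equivalent: (1) the action $\alpha$ has the continuous Rokhlin property; (2) there exists a unital completely positive equivariant asymptotic morphism $\Upsilon\colon C(G)\otimes A\rightrightarrows A$ satisfying $\lim_{t\to\infty}\Upsilon_t(1\otimes a)=a$ for all $a\in A$. In particular, if $\alpha$ has the continuous Rokhlin property, then there exists an equivariant asymptotic morphism $\Psi\colon A\rightrightarrows A^\alpha$ satisfying $\lim_{t\to\infty}\Psi_t(a)=a$ for all $a\in A^\alpha$.
   Context: $\mathtt{Lt}\colon G\to\mathrm{Aut}(C(G))$ denotes the action induced by left translation. $C(G)\otimes A$ is endowed with the diagonal action $\mathtt{Lt}\otimes\alpha$, and $A$ with $\alpha$. $A^\alpha=\{a\in A:\alpha_g(a)=a\text{ for all }g\in G\}$ is the fixed point algebra, with the restriction of $\alpha$. Asymptotic morphisms. For $C^*$-algebras $C$ and $B$, an asymptotic morphism $\Phi\colon C\rightrightarrows B$ is a family $(\Phi_t)_{t\in[0,\infty)}$ of maps $C\to B$ such that $t\mapsto\Phi_t(c)$ is continuous for every $c\in C$, and, as $t\to\infty$, $\|\Phi_t(\lambda c+d)-\lambda\Phi_t(c)-\Phi_t(d)\|\to0$, $\|\Phi_t(cd)-\Phi_t(c)\Phi_t(d)\|\to0$ and $\|\Phi_t(c^* )-\Phi_t(c)^*\|\to0$ for all $\lambda\in\mathbb{C}$ and $c,d\in C$. It is unital (respectively, completely positive) if there is $t_0\in[0,\infty)$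 such that $\Phi_t$ is unital (respectively, completely positive) for all $t\ge t_0$. It is asymptotically central if $\lim_{t\to\infty}\|\Phi_t(c)b-b\Phi_t(c)\|=0$ for all $c\in C$ and $b\in B$. If $C$ and $B$ carry actions $\gamma$ and $\beta$ of a compact group $G$, it is equivariant if $\lim_{t\to\infty}\sup_{g\in G}\|\Phi_t(\gamma_g(c))-\beta_g(\Phi_t(c))\|=0$ for all $c\in C$. Continuous Rokhlin property. A continuous action $\alpha\colon G\to\mathrm{Aut}(A)$ of a second countable compact group $G$ on a separable unital $C^*$-algebra $A$ has the continuous Rokhlin property if there exists a unital completely positive, equivariant and asymptotically central asymptotic morphism $\Phi\colon C(G)\rightrightarrows A$, where $C(G)$ carries $\mathtt{Lt}$.
   Formalization: In the final clause, Ψ is equivariant for the trivial action on A instead of α (so equivariance is automatic); with α on A the clause fails, e.g. for G=Z/2 acting on A=C(G) by translation, where it would force Ψ_t(e)→1/2 for a projection e. *)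

theory Defs
  imports "HOL-Analysis.Analysis"
begin

section \<open>C*-algebras\<close>

text \<open>Completeness is split off into \<open>cstar_algebra\<close>: the library makes \<open>'g \<Rightarrow>\<^sub>C 'a\<close> an instance of
  \<^class>\<open>complete_space\<close> only for \<open>'g\<close> of class \<^class>\<open>metric_space\<close>, and a type constructor admits
  no second such instance. Over an arbitrary topological space completeness of \<open>'g \<Rightarrow>\<^sub>C 'a\<close> is
  therefore the lemma \<open>bcontfun_Cauchy_convergent\<close> below, and every algebra to which the definitions of
  this theory are applied in the theorem is complete. A unital algebra is one that is also of
  class \<^class>\<open>real_normed_algebra_1\<close>.\<close>

class pre_cstar_algebra = real_normed_algebra +
  fixes scaleC :: "complex \<Rightarrow> 'a \<Rightarrow> 'a" (infixr "*\<^sub>C" 75)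
    and adj :: "'a \<Rightarrow> 'a"
  assumes scaleC_add_right: "c *\<^sub>C (x + y) = c *\<^sub>C x + c *\<^sub>C y"
    and scaleC_add_left: "(c + d) *\<^sub>C x = c *\<^sub>C x + d *\<^sub>C x"
    and scaleC_scaleC: "c *\<^sub>C d *\<^sub>C x = (c * d) *\<^sub>C x"
    and scaleC_of_real: "complex_of_real r *\<^sub>C x = r *\<^sub>R x"
    and norm_scaleC: "norm (c *\<^sub>C x) = cmod c * norm x"
    and mult_scaleC_left: "(c *\<^sub>C x) * y = c *\<^sub>C (x * y)"
    and mult_scaleC_right: "x * (c *\<^sub>C y) = c *\<^sub>C (x * y)"
    and adj_add: "adj (x + y) = adj x + adj y"
    and adj_scaleC: "adj (c *\<^sub>C x) = cnj c *\<^sub>C adj x"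
    and adj_mult: "adj (x * y) = adj y * adj x"
    and adj_adj: "adj (adj x) = x"
    and cstar_identity: "norm (adj x * x) = (norm x)\<^sup>2"

class cstar_algebra = pre_cstar_algebra + banach

lemma norm_adj: "norm (adj x) = norm (x :: 'a::pre_cstar_algebra)"
proof -
  have le: "norm y \<le> norm (adj y)" for y :: 'a
  proof (cases "norm y = 0")
    case False
    have "norm y * norm y \<le> norm (adj y) * norm y"
      using norm_mult_ineq[of "adj y" y] by (simp add: cstar_identity power2_eq_square)
    then show ?thesis
      using False by simp
  qed simp
  show ?thesis
    using le[of x] le[of "adj x"] by (simp add: adj_adj)
qed

lemma bounded_linear_scaleC_right: "bounded_linear (\<lambda>x :: 'a::pre_cstar_algebra. c *\<^sub>C x)"
proof (rule bounded_linear_intro[where K = "cmod c"])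
  fix r and x :: 'a
  show "c *\<^sub>C (r *\<^sub>R x) = r *\<^sub>R (c *\<^sub>C x)"
    by (simp add: scaleC_of_real[symmetric] scaleC_scaleC mult.commute)
qed (simp_all add: scaleC_add_right norm_scaleC mult.commute)

lemma bounded_linear_scaleC_left: "bounded_linear (\<lambda>c. c *\<^sub>C (x :: 'a::pre_cstar_algebra))"
proof (rule bounded_linear_intro[where K = "norm x"])
  fix r and c :: complex
  show "(r *\<^sub>R c) *\<^sub>C x = r *\<^sub>R (c *\<^sub>C x)"
    by (simp add: scaleC_of_real[symmetric] scaleC_scaleC scaleR_conv_of_real)
qed (simp_all add: scaleC_add_left norm_scaleC)

lemma bounded_linear_adj: "bounded_linear (adj :: 'a::pre_cstar_algebra \<Rightarrow> 'a)"
proof (rule bounded_linear_intro[where K = 1])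
  fix r and x :: 'a
  show "adj (r *\<^sub>R x) = r *\<^sub>R adj x"
    by (simp add: scaleC_of_real[symmetric] adj_scaleC)
qed (simp_all add: adj_add norm_adj)

instantiation complex :: cstar_algebra
begin

definition scaleC_complex :: "complex \<Rightarrow> complex \<Rightarrow> complex"
  where "scaleC_complex = (*)"

definition adj_complex :: "complex \<Rightarrow> complex"
  where "adj_complex = cnj"

instance
  by standard
    (auto simp: scaleC_complex_def adj_complex_def algebra_simps norm_mult scaleR_conv_of_real
      power2_eq_square)

end


section \<open>Algebras of continuous functions\<close>

text \<open>On a compact space every continuous function is bounded, so for compact \<open>'g\<close> the type
  \<open>'g \<Rightarrow>\<^sub>C 'a\<close> is the C*-algebra of all continuous functions with values in \<open>'a\<close>, with
  pointwise operations and the supremum norm.\<close>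

setup_lifting type_definition_bcontfun

lemma bcontfun_bounded_linear:
  assumes T: "bounded_linear T" and f: "f \<in> bcontfun"
  shows "(\<lambda>x. T (f x)) \<in> bcontfun"
proof -
  have "continuous_on UNIV (\<lambda>x. T (f x))"
    using f by (intro bounded_linear.continuous_on[OF T]) (simp add: bcontfun_def)
  moreover have "bounded (T ` range f)"
    using f by (intro bounded_linear_image[OF _ T]) (simp add: bcontfun_def)
  ultimately show ?thesis
    by (simp add: bcontfun_def image_image)
qed

instantiation bcontfun :: (topological_space, real_normed_algebra) real_normed_algebra
begin

lift_definition times_bcontfun :: "('a \<Rightarrow>\<^sub>C 'b) \<Rightarrow> ('a \<Rightarrow>\<^sub>C 'b) \<Rightarrow> 'a \<Rightarrow>\<^sub>C 'b"
  is "\<lambda>f g x. f x * g x"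
proof -
  fix f g :: "'a \<Rightarrow> 'b"
  assume f: "f \<in> bcontfun" and g: "g \<in> bcontfun"
  from f have "bounded (range f)"
    by (simp add: bcontfun_def)
  then obtain B where B: "\<And>x. norm (f x) \<le> B"
    unfolding bounded_iff by blast
  from g have "bounded (range g)"
    by (simp add: bcontfun_def)
  then obtain C where C: "\<And>x. norm (g x) \<le> C"
    unfolding bounded_iff by blast
  show "(\<lambda>x. f x * g x) \<in> bcontfun"
  proof (rule bcontfun_normI)
    show "continuous_on UNIV (\<lambda>x. f x * g x)"
      using f g by (auto simp: bcontfun_def intro!: continuous_intros)
    show "norm (f x * g x) \<le> B * C" for x
      using norm_mult_ineq[of "f x" "g x"] mult_mono[OF B C, of x x]
        order_trans[OF norm_ge_zero B[of x]] by simp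
  qed
qed

lemmas [simp] = times_bcontfun.rep_eq

instance
proof
  fix f g :: "'a \<Rightarrow>\<^sub>C 'b"
  show "norm (f * g) \<le> norm f * norm g"
  proof (rule norm_bound)
    fix x
    have "norm (f x * g x) \<le> norm (f x) * norm (g x)"
      by (rule norm_mult_ineq)
    also have "\<dots> \<le> norm f * norm g"
      by (intro mult_mono norm_bounded) auto
    finally show "norm (apply_bcontfun (f * g) x) \<le> norm f * norm g"
      by simp
  qed
qed (auto intro!: bcontfun_eqI simp: algebra_simps)

end

instantiation bcontfun :: (topological_space, real_normed_algebra_1) real_normed_algebra_1
begin

lift_definition one_bcontfun :: "'a \<Rightarrow>\<^sub>C 'b" is "\<lambda>_. 1"
  by (rule const_bcontfun)

lemmas [simp] = one_bcontfun.rep_eq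

instance
proof
  show "(0 :: 'a \<Rightarrow>\<^sub>C 'b) \<noteq> 1"
    by (metis one_bcontfun.rep_eq zero_bcontfun.rep_eq zero_neq_one)
  show "norm (1 :: 'a \<Rightarrow>\<^sub>C 'b) = 1"
  proof (rule antisym)
    show "norm (1 :: 'a \<Rightarrow>\<^sub>C 'b) \<le> 1"
      by (rule norm_bound) simp
    show "1 \<le> norm (1 :: 'a \<Rightarrow>\<^sub>C 'b)"
      using norm_bounded[of "1 :: 'a \<Rightarrow>\<^sub>C 'b" undefined] by simp
  qed
qed (auto intro!: bcontfun_eqI)

end

instantiation bcontfun :: (topological_space, pre_cstar_algebra) pre_cstar_algebra
begin

lift_definition scaleC_bcontfun :: "complex \<Rightarrow> ('a \<Rightarrow>\<^sub>C 'b) \<Rightarrow> 'a \<Rightarrow>\<^sub>C 'b"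
  is "\<lambda>c f x. c *\<^sub>C f x"
  by (rule bcontfun_bounded_linear[OF bounded_linear_scaleC_right])

lift_definition adj_bcontfun :: "('a \<Rightarrow>\<^sub>C 'b) \<Rightarrow> 'a \<Rightarrow>\<^sub>C 'b"
  is "\<lambda>f x. adj (f x)"
  by (rule bcontfun_bounded_linear[OF bounded_linear_adj])

lemmas [simp] = scaleC_bcontfun.rep_eq adj_bcontfun.rep_eq

instance
proof
  fix f g h :: "'a \<Rightarrow>\<^sub>C 'b" and c d :: complex and r :: real
  have le: "norm (a *\<^sub>C k) \<le> cmod a * norm k" for a and k :: "'a \<Rightarrow>\<^sub>C 'b"
    by (rule norm_bound) (simp add: norm_scaleC mult_left_mono norm_bounded)
  have comp: "a *\<^sub>C b *\<^sub>C k = (a * b) *\<^sub>C k" for a b and k :: "'a \<Rightarrow>\<^sub>C 'b"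
    by (auto intro!: bcontfun_eqI simp: scaleC_scaleC)
  show "c *\<^sub>C d *\<^sub>C f = (c * d) *\<^sub>C f"
    by (rule comp)
  have real: "complex_of_real q *\<^sub>C k = q *\<^sub>R k" for q and k :: "'a \<Rightarrow>\<^sub>C 'b"
    by (auto intro!: bcontfun_eqI simp: scaleC_of_real)
  show "complex_of_real r *\<^sub>C f = r *\<^sub>R f"
    by (rule real)
  show "norm (c *\<^sub>C f) = cmod c * norm f"
  proof (cases "c = 0")
    case True
    then show ?thesis
      using le[of c f] by simp
  next
    case False
    have "f = inverse c *\<^sub>C c *\<^sub>C f"
      using False real[of 1 f] by (simp add: comp)
    then have "norm f \<le> inverse (cmod c) * norm (c *\<^sub>C f)"
      using le[of "inverse c" "c *\<^sub>C f"] by (simp add: norm_inverse)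
    then have "cmod c * norm f \<le> norm (c *\<^sub>C f)"
      using False by (simp add: field_simps)
    with le[of c f] show ?thesis
      by simp
  qed
  show "norm (adj f * f) = (norm f)\<^sup>2"
  proof (rule antisym)
    show "norm (adj f * f) \<le> (norm f)\<^sup>2"
      by (rule norm_bound) (simp add: cstar_identity power_mono norm_bounded)
    have "norm f \<le> sqrt (norm (adj f * f))"
    proof (rule norm_bound, rule real_le_rsqrt)
      fix x
      show "(norm (f x))\<^sup>2 \<le> norm (adj f * f)"
        using norm_bounded[of "adj f * f" x] by (simp add: cstar_identity)
    qed
    then have "(norm f)\<^sup>2 \<le> (sqrt (norm (adj f * f)))\<^sup>2"
      by (rule power_mono) simp
    then show "(norm f)\<^sup>2 \<le> norm (adj f * f)"
      by simp
  qed
  show "c *\<^sub>C (f + g) = c *\<^sub>C f + c *\<^sub>C g"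
    by (rule bcontfun_eqI) (simp add: scaleC_add_right)
  show "(c + d) *\<^sub>C f = c *\<^sub>C f + d *\<^sub>C f"
    by (rule bcontfun_eqI) (simp add: scaleC_add_left)
  show "(c *\<^sub>C f) * g = c *\<^sub>C (f * g)"
    by (rule bcontfun_eqI) (simp add: mult_scaleC_left)
  show "f * (c *\<^sub>C g) = c *\<^sub>C (f * g)"
    by (rule bcontfun_eqI) (simp add: mult_scaleC_right)
  show "adj (f + g) = adj f + adj g"
    by (rule bcontfun_eqI) (simp add: adj_add)
  show "adj (c *\<^sub>C f) = cnj c *\<^sub>C adj f"
    by (rule bcontfun_eqI) (simp add: adj_scaleC)
  show "adj (f * g) = adj g * adj f"
    by (rule bcontfun_eqI) (simp add: adj_mult)
  show "adj (adj f) = f"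
    by (rule bcontfun_eqI) (simp add: adj_adj)
qed

end

lemma bcontfun_Cauchy_convergent:
  fixes f :: "nat \<Rightarrow> 'g::topological_space \<Rightarrow>\<^sub>C 'a::cstar_algebra"
  assumes "Cauchy f"
  shows "convergent f"
proof -
  obtain g where "uniform_limit UNIV f g sequentially"
    using assms uniformly_convergent_eq_cauchy[of "\<lambda>_. True" f]
    unfolding Cauchy_def uniform_limit_sequentially_iff
    by (metis dist_fun_lt_imp_dist_val_lt)
  from uniform_limit_bcontfunE[OF this sequentially_bot] show ?thesis
    by (metis convergentI)
qed


section \<open>The tensor product of \<open>C(G)\<close> with a C*-algebra\<close>

text \<open>\<open>C(G) \<otimes> A\<close> is realised as \<open>C(G, A)\<close>, the elementary tensor \<open>f \<otimes> a\<close> being the function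
  \<open>x \<mapsto> f(x) a\<close>. The lemmas below show that \<open>C(G, A)\<close> is a C*-completion of the algebraic tensor
  product of \<open>C(G)\<close> and \<open>A\<close> (bilinear, multiplicative and adjoint-preserving, injective, with dense
  range); as \<open>C(G)\<close> is nuclear, there is only one such completion.\<close>

lift_definition elem_tensor ::
  "('g::topological_space \<Rightarrow>\<^sub>C complex) \<Rightarrow> 'a::pre_cstar_algebra \<Rightarrow> ('g \<Rightarrow>\<^sub>C 'a)"  (infixr "\<otimes>" 70)
  is "\<lambda>f a x. f x *\<^sub>C a"
  by (rule bcontfun_bounded_linear[OF bounded_linear_scaleC_left])

lemmas [simp] = elem_tensor.rep_eq

lemma elem_tensor_add_left: "(f + g) \<otimes> a = f \<otimes> a + g \<otimes> a"
  by (rule bcontfun_eqI) (simp add: scaleC_add_left)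

lemma elem_tensor_add_right: "f \<otimes> (a + b) = f \<otimes> a + f \<otimes> b"
  by (rule bcontfun_eqI) (simp add: scaleC_add_right)

lemma elem_tensor_scaleC_left: "(c *\<^sub>C f) \<otimes> a = c *\<^sub>C (f \<otimes> a)"
  by (rule bcontfun_eqI) (simp add: scaleC_scaleC scaleC_complex_def)

lemma elem_tensor_scaleC_right: "f \<otimes> (c *\<^sub>C a) = c *\<^sub>C (f \<otimes> a)"
  by (rule bcontfun_eqI) (simp add: scaleC_scaleC mult.commute)

lemma elem_tensor_mult: "(f \<otimes> a) * (g \<otimes> b) = (f * g) \<otimes> (a * b)"
  by (rule bcontfun_eqI) (simp add: mult_scaleC_left mult_scaleC_right scaleC_scaleC mult.commute)

lemma elem_tensor_adj: "adj (f \<otimes> a) = adj f \<otimes> adj a"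
  by (rule bcontfun_eqI) (simp add: adj_scaleC adj_complex_def)

lemma elem_tensor_one: "1 \<otimes> (1 :: 'a::{pre_cstar_algebra, real_normed_algebra_1}) = 1"
  using scaleC_of_real[of 1 "1 :: 'a"] by (auto intro!: bcontfun_eqI)

lemma norm_elem_tensor: "norm (f \<otimes> a) = norm f * norm a"
proof (rule antisym)
  show "norm (f \<otimes> a) \<le> norm f * norm a"
    by (rule norm_bound) (simp add: norm_scaleC mult_right_mono norm_bounded)
  show "norm f * norm a \<le> norm (f \<otimes> a)"
  proof (cases "a = 0")
    case False
    have "norm f \<le> norm (f \<otimes> a) / norm a"
    proof (rule norm_bound)
      fix x
      show "norm (f x) \<le> norm (f \<otimes> a) / norm a"
        using norm_bounded[of "f \<otimes> a" x] False by (simp add: norm_scaleC field_simps)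
    qed
    then show ?thesis
      using False by (simp add: field_simps)
  qed simp
qed

lemma apply_bcontfun_sum:
  "apply_bcontfun (\<Sum>i\<in>I. F i) x = (\<Sum>i\<in>I. apply_bcontfun (F i :: _ \<Rightarrow>\<^sub>C 'b::real_normed_vector) x)"
  by (induction I rule: infinite_finite_induct) auto

lemma elem_tensor_injective:
  assumes indep: "\<And>c. (\<Sum>i\<in>I. c i *\<^sub>C a i) = 0 \<Longrightarrow> \<forall>i\<in>I. c i = 0"
    and zero: "(\<Sum>i\<in>I. f i \<otimes> a i) = 0"
    and "i \<in> I"
  shows "f i = 0"
proof (rule bcontfun_eqI)
  fix x
  have "(\<Sum>i\<in>I. f i x *\<^sub>C a i) = 0"
    using arg_cong[OF zero, of "\<lambda>F. apply_bcontfun F x"] by (simp add: apply_bcontfun_sum)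
  with indep[of "\<lambda>i. f i x"] \<open>i \<in> I\<close> show "f i x = apply_bcontfun 0 x"
    by simp
qed

lemma elem_tensor_dense:
  fixes F :: "'g::topological_space \<Rightarrow>\<^sub>C 'a::pre_cstar_algebra"
  assumes compact: "compact (UNIV :: 'g set)" and "e > 0"
  shows "\<exists>I f a. finite (I :: 'g set) \<and> norm (F - (\<Sum>i\<in>I. f i \<otimes> a i)) < e"
proof -
  define d where "d = e / 2"
  have "d > 0"
    using \<open>e > 0\<close> by (simp add: d_def)
  define u where "u x y = max 0 (d - norm (F y - F x))" for x y
  have cont_u: "continuous_on UNIV (u x)" for x
    unfolding u_def by (intro continuous_intros) simp_all
  define U where "U x = {y. 0 < u x y}" for x
  have "open (U x)" for x
    unfolding U_def by (intro open_Collect_less continuous_intros cont_u)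
  moreover have "UNIV \<subseteq> (\<Union>x\<in>UNIV. U x)"
    using \<open>d > 0\<close> by (auto simp: U_def u_def)
  ultimately obtain I where I: "finite I" "UNIV \<subseteq> (\<Union>x\<in>I. U x)"
    using compactE_image[OF compact, of UNIV U] by (metis order_refl)
  define s where "s y = (\<Sum>x\<in>I. u x y)" for y
  have u_nonneg: "0 \<le> u x y" for x y
    by (simp add: u_def)
  have s_pos: "0 < s y" for y
  proof -
    obtain x where "x \<in> I" "0 < u x y"
      using I(2) by (auto simp: U_def)
    then show ?thesis
      unfolding s_def using I(1) u_nonneg by (meson sum_pos2)
  qed
  define p where "p x y = u x y / s y" for x y
  have p_nonneg: "0 \<le> p x y" for x y
    using s_pos[of y] u_nonneg by (simp add: p_def)
  have p_sum: "(\<Sum>x\<in>I. p x y) = 1" for y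
    using s_pos[of y] by (simp add: p_def s_def sum_divide_distrib[symmetric])
  have p_bcont: "(\<lambda>y. complex_of_real (p x y)) \<in> bcontfun" for x
  proof -
    have "continuous_on UNIV s"
      unfolding s_def by (intro continuous_on_sum cont_u)
    then have "continuous_on UNIV (p x)"
      unfolding p_def by (intro continuous_on_divide cont_u) (use s_pos in \<open>auto simp: less_le\<close>)
    then have c: "continuous_on UNIV (\<lambda>y. complex_of_real (p x y))"
      by (intro continuous_intros)
    then show ?thesis
      using compact_imp_bounded[OF compact_continuous_image[OF c compact]]
      by (simp add: bcontfun_def)
  qed
  define f where "f x = Bcontfun (\<lambda>y. complex_of_real (p x y))" for x
  have f: "f x y = complex_of_real (p x y)" for x y
    using p_bcont by (simp add: f_def Bcontfun_inverse)
  have "norm (F - (\<Sum>x\<in>I. f x \<otimes> F x)) \<le> d"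
  proof (rule norm_bound)
    fix y
    have "F y - (\<Sum>x\<in>I. p x y *\<^sub>R F x) = (\<Sum>x\<in>I. p x y *\<^sub>R (F y - F x))"
      by (simp add: scaleR_diff_right sum_subtractf scaleR_sum_left[symmetric] p_sum)
    also have "norm \<dots> \<le> (\<Sum>x\<in>I. p x y * d)"
    proof (rule sum_norm_le)
      fix x
      show "norm (p x y *\<^sub>R (F y - F x)) \<le> p x y * d"
      proof (cases "p x y = 0")
        case False
        then have "norm (F y - F x) \<le> d"
          by (auto simp: p_def u_def max_def split: if_splits)
        then show ?thesis
          using p_nonneg by (simp add: mult_left_mono)
      qed simp
    qed
    also have "\<dots> = d"
      by (simp add: sum_distrib_right[symmetric] p_sum)
    finally show "norm (apply_bcontfun (F - (\<Sum>x\<in>I. f x \<otimes> F x)) y) \<le> d"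
      by (simp add: apply_bcontfun_sum f scaleC_of_real)
  qed
  then have "norm (F - (\<Sum>x\<in>I. f x \<otimes> F x)) < e"
    using \<open>e > 0\<close> by (simp add: d_def)
  then show ?thesis
    using \<open>finite I\<close> by blast
qed


section \<open>Group actions\<close>

text \<open>The group is a type of class \<^class>\<open>topological_group_add\<close>: it is written additively, but it
  is not assumed to be commutative, and \<open>- g + h\<close> is the element usually written \<open>g\<^sup>-\<^sup>1h\<close>.\<close>

definition clinear_map :: "('c::pre_cstar_algebra \<Rightarrow> 'b::pre_cstar_algebra) \<Rightarrow> bool"
  where "clinear_map \<phi> \<longleftrightarrow>
    (\<forall>x y. \<phi> (x + y) = \<phi> x + \<phi> y) \<and> (\<forall>c x. \<phi> (c *\<^sub>C x) = c *\<^sub>C \<phi> x)"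

definition star_automorphism :: "('a::pre_cstar_algebra \<Rightarrow> 'a) \<Rightarrow> bool"
  where "star_automorphism \<phi> \<longleftrightarrow> clinear_map \<phi> \<and> (\<forall>x y. \<phi> (x * y) = \<phi> x * \<phi> y) \<and>
    (\<forall>x. \<phi> (adj x) = adj (\<phi> x)) \<and> bij \<phi>"

definition continuous_action ::
  "('g::topological_group_add \<Rightarrow> 'a::pre_cstar_algebra \<Rightarrow> 'a) \<Rightarrow> bool"
  where "continuous_action \<alpha> \<longleftrightarrow> (\<forall>g. star_automorphism (\<alpha> g)) \<and>
    (\<forall>g h a. \<alpha> (g + h) a = \<alpha> g (\<alpha> h a)) \<and> (\<forall>a. continuous_on UNIV (\<lambda>g. \<alpha> g a))"

definition fixed_points :: "('g \<Rightarrow> 'a \<Rightarrow> 'a) \<Rightarrow> 'a set"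
  where "fixed_points \<alpha> = {a. \<forall>g. \<alpha> g a = a}"

text \<open>A retraction \<open>A \<rightrightarrows> A\<^sup>\<alpha>\<close> takes its values in an algebra on which \<open>G\<close> acts trivially; its
  equivariance is meant for the trivial action on \<open>A\<close>, that is, \<open>A\<close> is regarded as the fixed point
  algebra of \<open>C(G) \<otimes> A\<close> by way of \<open>a \<mapsto> (g \<mapsto> \<alpha>\<^sub>g(a))\<close>, and is then automatic. For the action \<open>\<alpha>\<close> on \<open>A\<close> there is in general
  no such \<open>\<Psi>\<close>: if \<open>G\<close> has two elements, \<open>A = C(G)\<close> and \<open>\<alpha> = Lt\<close>, then \<open>\<alpha>\<close> has the continuous
  Rokhlin property (take \<open>\<Phi>\<^sub>t = id\<close>) and exchanges the minimal projections \<open>e\<close> and \<open>1 - e\<close>;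
  equivariance would give \<open>\<Psi>\<^sub>t(e) - \<Psi>\<^sub>t(1 - e) \<rightarrow> 0\<close>, hence \<open>\<Psi>\<^sub>t(e) \<rightarrow> 1/2\<close>, whereas
  \<open>\<Psi>\<^sub>t(e)\<^sup>2 - \<Psi>\<^sub>t(e) \<rightarrow> 0\<close>.\<close>

definition trivial_action :: "'g \<Rightarrow> 'a \<Rightarrow> 'a"
  where "trivial_action g a = a"

lift_definition Lt ::
  "'g::topological_group_add \<Rightarrow> ('g \<Rightarrow>\<^sub>C 'b::metric_space) \<Rightarrow> ('g \<Rightarrow>\<^sub>C 'b)"
  is "\<lambda>g f h. f (- g + h)"
proof -
  fix g :: 'g and f :: "'g \<Rightarrow> 'b"
  assume f: "f \<in> bcontfun"
  have "continuous_on UNIV (\<lambda>h. f (- g + h))"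
    by (rule continuous_on_compose2[of UNIV f])
      (use f in \<open>auto simp: bcontfun_def intro!: continuous_intros\<close>)
  moreover have "bounded (range (\<lambda>h. f (- g + h)))"
    by (rule bounded_subset[of "range f"]) (use f in \<open>auto simp: bcontfun_def\<close>)
  ultimately show "(\<lambda>h. f (- g + h)) \<in> bcontfun"
    by (simp add: bcontfun_def)
qed

lemmas [simp] = Lt.rep_eq

text \<open>The diagonal action \<open>Lt \<otimes> \<alpha>\<close> on \<open>C(G) \<otimes> A\<close>.\<close>

definition Lt_tensor ::
  "('g::topological_group_add \<Rightarrow> 'a::pre_cstar_algebra \<Rightarrow> 'a) \<Rightarrow> 'g \<Rightarrow> ('g \<Rightarrow>\<^sub>C 'a) \<Rightarrow> ('g \<Rightarrow>\<^sub>C 'a)"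
  where "Lt_tensor \<alpha> g F = Bcontfun (\<lambda>h. \<alpha> g (F (- g + h)))"

lemma Lt_tensor_elem_tensor:
  assumes "continuous_action \<alpha>"
  shows "Lt_tensor \<alpha> g (f \<otimes> a) = Lt g f \<otimes> \<alpha> g a"
proof -
  have "(\<lambda>h. \<alpha> g ((f \<otimes> a) (- g + h))) = apply_bcontfun (Lt g f \<otimes> \<alpha> g a)"
    using assms by (auto simp: continuous_action_def star_automorphism_def clinear_map_def)
  then show ?thesis
    by (metis Lt_tensor_def apply_bcontfun_inverse)
qed


section \<open>Completely positive maps\<close>

text \<open>An \<open>n \<times> n\<close> matrix over a C*-algebra is a function on \<open>nat \<times> nat\<close> restricted to indices below
  \<open>n\<close>. It is positive in the C*-algebra \<open>M\<^sub>n\<close> iff it has the form \<open>Y\<^sup>*Y\<close>.\<close>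

definition matrix_positive :: "nat \<Rightarrow> (nat \<Rightarrow> nat \<Rightarrow> 'c::pre_cstar_algebra) \<Rightarrow> bool"
  where "matrix_positive n X \<longleftrightarrow>
    (\<exists>Y. \<forall>i<n. \<forall>j<n. X i j = (\<Sum>k<n. adj (Y k i) * Y k j))"

definition completely_positive :: "('c::pre_cstar_algebra \<Rightarrow> 'b::pre_cstar_algebra) \<Rightarrow> bool"
  where "completely_positive \<phi> \<longleftrightarrow> clinear_map \<phi> \<and>
    (\<forall>n X. matrix_positive n X \<longrightarrow> matrix_positive n (\<lambda>i j. \<phi> (X i j)))"


section \<open>Asymptotic morphisms\<close>

text \<open>The target is given as a C*-subalgebra \<open>B\<close> of a type, so that fixed point algebras are
  covered; only the values of \<open>\<Phi>\<close> at parameters \<open>t \<ge> 0\<close> matter.\<close>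

definition asymptotic_morphism ::
  "'b::pre_cstar_algebra set \<Rightarrow> (real \<Rightarrow> 'c::pre_cstar_algebra \<Rightarrow> 'b) \<Rightarrow> bool"
  where "asymptotic_morphism B \<Phi> \<longleftrightarrow>
    (\<forall>t\<ge>0. \<forall>c. \<Phi> t c \<in> B) \<and>
    (\<forall>c. continuous_on {0..} (\<lambda>t. \<Phi> t c)) \<and>
    (\<forall>z c d. ((\<lambda>t. norm (\<Phi> t (z *\<^sub>C c + d) - z *\<^sub>C \<Phi> t c - \<Phi> t d)) \<longlongrightarrow> 0) at_top) \<and>
    (\<forall>c d. ((\<lambda>t. norm (\<Phi> t (c * d) - \<Phi> t c * \<Phi> t d)) \<longlongrightarrow> 0) at_top) \<and>
    (\<forall>c. ((\<lambda>t. norm (\<Phi> t (adj c) - adj (\<Phi> t c))) \<longlongrightarrow> 0) at_top)"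

definition asymp_unital ::
  "(real \<Rightarrow> 'c::{pre_cstar_algebra, real_normed_algebra_1} \<Rightarrow> 'b::{pre_cstar_algebra, real_normed_algebra_1}) \<Rightarrow> bool"
  where "asymp_unital \<Phi> \<longleftrightarrow> (\<exists>t0\<ge>0. \<forall>t\<ge>t0. \<Phi> t 1 = 1)"

definition asymp_completely_positive ::
  "(real \<Rightarrow> 'c::pre_cstar_algebra \<Rightarrow> 'b::pre_cstar_algebra) \<Rightarrow> bool"
  where "asymp_completely_positive \<Phi> \<longleftrightarrow> (\<exists>t0\<ge>0. \<forall>t\<ge>t0. completely_positive (\<Phi> t))"

definition asymp_central :: "(real \<Rightarrow> 'c::pre_cstar_algebra \<Rightarrow> 'b::pre_cstar_algebra) \<Rightarrow> bool"
  where "asymp_central \<Phi> \<longleftrightarrow> (\<forall>c b. ((\<lambda>t. norm (\<Phi> t c * b - b * \<Phi> t c)) \<longlongrightarrow> 0) at_top)"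

text \<open>The supremum is formed in the extended nonnegative reals, as it may be infinite.\<close>

definition asymp_equivariant ::
  "('g \<Rightarrow> 'c \<Rightarrow> 'c) \<Rightarrow> ('g \<Rightarrow> 'b \<Rightarrow> 'b) \<Rightarrow> (real \<Rightarrow> 'c::pre_cstar_algebra \<Rightarrow> 'b::pre_cstar_algebra) \<Rightarrow> bool"
  where "asymp_equivariant \<gamma> \<beta> \<Phi> \<longleftrightarrow>
    (\<forall>c. ((\<lambda>t. SUP g. ennreal (norm (\<Phi> t (\<gamma> g c) - \<beta> g (\<Phi> t c)))) \<longlongrightarrow> 0) at_top)"

definition continuous_Rokhlin_property ::
  "('g::topological_group_add \<Rightarrow> 'a::{pre_cstar_algebra, real_normed_algebra_1} \<Rightarrow> 'a) \<Rightarrow> bool"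
  where "continuous_Rokhlin_property \<alpha> \<longleftrightarrow>
    (\<exists>\<Phi> :: real \<Rightarrow> ('g \<Rightarrow>\<^sub>C complex) \<Rightarrow> 'a.
      asymptotic_morphism UNIV \<Phi> \<and> asymp_unital \<Phi> \<and> asymp_completely_positive \<Phi> \<and>
      asymp_equivariant Lt \<alpha> \<Phi> \<and> asymp_central \<Phi>)"

end

theory Submission
  imports Defs
begin

text \<open>Given \<open>\<Upsilon>\<close>, put \<open>\<Phi>\<^sub>t(f) = \<Upsilon>\<^sub>t(f \<otimes> 1)\<close>; it is asymptotically central because
  \<open>\<Upsilon>\<^sub>t(1 \<otimes> a) \<rightarrow> a\<close>. Conversely, given \<open>\<Phi>\<close>, choose finer and finer partitions of unity
  \<open>\<Sum>\<^sub>i q\<^sub>i\<^sup>2 = 1\<close> with \<open>q\<^sub>i\<close> supported near \<open>x\<^sub>i\<close>; for large \<open>t\<close> the completely positive map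
  \<open>F \<mapsto> \<Sum>\<^sub>i \<Phi>\<^sub>t(q\<^sub>i)\<^sup>* F(x\<^sub>i) \<Phi>\<^sub>t(q\<^sub>i)\<close> is almost unital and sends \<open>f \<otimes> a\<close> almost to \<open>\<Phi>\<^sub>t(f) a\<close>.
  These maps, made unital and interpolated in \<open>t\<close>, form \<open>\<Upsilon>\<close>; everything else follows by density of
  the algebraic tensor product and the uniform bound \<open>\<parallel>\<Upsilon>\<^sub>t\<parallel> \<le> 2\<close>. Finally
  \<open>\<Upsilon>\<^sub>t(g \<mapsto> \<alpha>\<^sub>g(a))\<close> is asymptotically \<open>\<alpha>\<close>-invariant, and almost invariant elements are close to
  invariant ones. Positivity in C*-algebras is handled by the norm criterion \<open>\<parallel>t - h\<parallel> \<le> t\<close> and the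
  power series of the square root, without spectral theory.\<close>

section \<open>The power series of the square root\<close>

text \<open>The obvious formula, f \<otimes> a going to \<open>\<Phi> t f * a\<close>, cannot serve
  as \<Upsilon>: \<open>\<Phi> t f\<close> and a commute only in the limit, so at a fixed t it is in
  general not positive. A sandwich of F(x) between two copies of \<open>\<Phi> t q\<close> is
  completely positive at every t, and this is why the squares of the q form the partition of unity.
  The price is that the threshold for t depends on the partition and on a. Each stage therefore
  handles finitely many a only; separability of A supplies a dense sequence of them, second
  countability of G a shrinking sequence of neighbourhoods of 0, and convex combinations with
  weights depending on t join the stages without losing unitality, complete positivity or the norm
  bound. For \<Psi>, an almost invariant element must be replaced by an invariant one continuously
  in t: the minimal displacement gives existence for each t, and a partition of unity on the time
  axis, averaging inside the convex set of fixed points, gives continuity.\<close>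

definition sqrt_coeff :: "nat \<Rightarrow> real"
  where "sqrt_coeff n = (-1) ^ n * ((1/2) gchoose n)"

text \<open>\<open>sqrt_coeff\<close> lists the coefficients of (1 - y)^(1/2). Squaring the series
  is the Vandermonde convolution for 1/2 + 1/2 = 1 and leaves the coefficients of 1 - y.\<close>

lemma sqrt_coeff_convolution:
  "(\<Sum>i\<le>n. sqrt_coeff i * sqrt_coeff (n - i)) = (if n = 0 then 1 else if n = 1 then -1 else 0)"
proof -
  have "(\<Sum>i\<le>n. sqrt_coeff i * sqrt_coeff (n - i))
      = (-1) ^ n * (\<Sum>i\<le>n. (1/2 gchoose i) * (1/2 gchoose (n - i)))"
    unfolding sum_distrib_left
  proof (rule sum.cong)
    fix i assume "i \<in> {..n}"
    then have "(-1 :: real) ^ n = (-1) ^ i * (-1) ^ (n - i)"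
      by (simp flip: power_add)
    then show "sqrt_coeff i * sqrt_coeff (n - i)
        = (-1) ^ n * ((1/2 gchoose i) * (1/2 gchoose (n - i)))"
      by (simp add: sqrt_coeff_def)
  qed simp
  also have "(\<Sum>i\<le>n. (1/2 gchoose i) * (1/2 gchoose (n - i))) = ((1::real) gchoose n)"
    using gbinomial_Vandermonde[of "1/2 :: real" "1/2" n] by (simp add: atLeast0AtMost)
  also have "(1::real) gchoose n = of_nat (1 choose n)"
    using binomial_gbinomial[of 1 n, where ?'a = real] by simp
  also have "(-1) ^ n * \<dots> = (if n = 0 then 1 else if n = 1 then -1 else 0)"
    by (cases "n > 1") (auto simp: binomial_eq_0 not_less le_Suc_eq)
  finally show ?thesis .
qed

text \<open>The ratio of consecutive coefficients, (n - 1/2) / (n + 1), is positive from n = 1 on.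
  The constant sign lets sums of absolute values be evaluated in closed form.\<close>

lemma sqrt_coeff_Suc_nonpos: "sqrt_coeff (Suc n) \<le> 0"
proof (induction n)
  case (Suc n)
  have "sqrt_coeff (Suc (Suc n)) = sqrt_coeff (Suc n) * ((of_nat (Suc n) - 1/2) / of_nat (Suc (Suc n)))"
    by (simp add: sqrt_coeff_def gbinomial_absorption' gbinomial_Suc_rec field_simps)
  then show ?case
    using Suc by (simp add: mult_nonpos_nonneg divide_nonpos_pos)
qed (simp add: sqrt_coeff_def)

text \<open>By the constant sign the sum is 1 minus a partial sum of all coefficients. These partial
  sums are the coefficients of (1 - y)^(1/2) / (1 - y) = (1 - y)^(-1/2), which are
  nonnegative.\<close>

lemma sqrt_coeff_partial_sum: "(\<Sum>n\<in>{1..N}. \<bar>sqrt_coeff n\<bar>) \<le> 1"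
proof -
  have pos: "0 \<le> (-1) ^ n * ((-1/2 :: real) gchoose n)" for n
  proof -
    have "(-1) ^ n * ((-1/2 :: real) gchoose n) = (of_nat n - 1/2 gchoose n)"
      by (subst gbinomial_negated_upper) (simp flip: power_add power_mult_distrib mult.assoc)
    also have "\<dots> \<ge> 0"
      by (auto simp: gbinomial_prod_rev intro!: divide_nonneg_pos prod_nonneg)
    finally show ?thesis .
  qed
  have "(\<Sum>n\<in>{1..N}. \<bar>sqrt_coeff n\<bar>) = - (\<Sum>n\<in>{1..N}. sqrt_coeff n)"
    unfolding sum_negf[symmetric]
  proof (rule sum.cong)
    fix n assume "n \<in> {1..N}"
    then show "\<bar>sqrt_coeff n\<bar> = - sqrt_coeff n"
      using sqrt_coeff_Suc_nonpos[of "n - 1"] by simp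
  qed simp
  also have "\<dots> = 1 - (\<Sum>n\<le>N. sqrt_coeff n)"
  proof -
    have "{..N} = insert 0 {1..N}" by auto
    then show ?thesis by (simp add: sqrt_coeff_def)
  qed
  also have "(\<Sum>n\<le>N. sqrt_coeff n) = (-1) ^ N * ((-1/2) gchoose N)"
    using gbinomial_sum_lower_neg[of "1/2 :: real" N] by (simp add: sqrt_coeff_def mult.commute)
  finally show ?thesis
    using pos[of N] by simp
qed

lemma summable_abs_sqrt_coeff: "summable (\<lambda>n. \<bar>sqrt_coeff n\<bar>)"
proof (rule bounded_imp_summable)
  fix n :: nat
  have "{..n} = insert 0 {1..n}" by auto
  then show "(\<Sum>k\<le>n. \<bar>sqrt_coeff k\<bar>) \<le> 2"
    using sqrt_coeff_partial_sum[of n] by (simp add: sqrt_coeff_def)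
qed simp

definition sqrt_series :: "'a::{banach, real_normed_algebra_1} \<Rightarrow> 'a"
  where "sqrt_series y = (\<Sum>n. sqrt_coeff n *\<^sub>R y ^ n)"

context
  fixes y :: "'a::{banach, real_normed_algebra_1}"
  assumes y: "norm y \<le> 1"
begin

lemma norm_sqrt_series_term: "norm (sqrt_coeff n *\<^sub>R y ^ n) \<le> \<bar>sqrt_coeff n\<bar>"
  using norm_power_ineq[of y n] power_le_one[OF norm_ge_zero y, of n]
  by (simp add: mult_left_le)

lemma summable_norm_sqrt_series: "summable (\<lambda>n. norm (sqrt_coeff n *\<^sub>R y ^ n))"
  by (rule summable_comparison_test'[OF summable_abs_sqrt_coeff])
    (use norm_sqrt_series_term in auto)

lemma summable_sqrt_series: "summable (\<lambda>n. sqrt_coeff n *\<^sub>R y ^ n)"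
  by (rule summable_norm_cancel[OF summable_norm_sqrt_series])

lemma sqrt_series_mult_self: "sqrt_series y * sqrt_series y = 1 - y"
proof -
  have "sqrt_series y * sqrt_series y
      = (\<Sum>n. \<Sum>i\<le>n. (sqrt_coeff i *\<^sub>R y ^ i) * (sqrt_coeff (n - i) *\<^sub>R y ^ (n - i)))"
    unfolding sqrt_series_def
    by (rule Cauchy_product[OF summable_norm_sqrt_series summable_norm_sqrt_series])
  also have "(\<lambda>n. \<Sum>i\<le>n. (sqrt_coeff i *\<^sub>R y ^ i) * (sqrt_coeff (n - i) *\<^sub>R y ^ (n - i)))
      = (\<lambda>n. (\<Sum>i\<le>n. sqrt_coeff i * sqrt_coeff (n - i)) *\<^sub>R y ^ n)"
    unfolding scaleR_sum_left by (intro ext sum.cong) (simp_all flip: power_add)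
  also have "\<dots> = (\<lambda>n. (if n = 0 then 1 else if n = 1 then -1 else 0) *\<^sub>R y ^ n)"
    by (simp add: sqrt_coeff_convolution)
  also have "(\<Sum>n. \<dots> n) = (\<Sum>n\<in>{0,1}. (if n = 0 then 1 else if n = 1 then -1 else 0) *\<^sub>R y ^ n)"
    by (rule suminf_finite) auto
  finally show ?thesis by simp
qed

text \<open>This is the norm criterion for positivity of the root, with t = 1: the constant
  coefficient is 1 and the others have absolute sum at most 1.\<close>

lemma norm_one_minus_sqrt_series: "norm (1 - sqrt_series y) \<le> 1"
proof -
  have sm: "summable (\<lambda>n. norm (sqrt_coeff (Suc n) *\<^sub>R y ^ Suc n))"
    using summable_norm_sqrt_series by (subst summable_Suc_iff)
  have "sqrt_series y = 1 + (\<Sum>n. sqrt_coeff (Suc n) *\<^sub>R y ^ Suc n)"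
    using suminf_split_head[OF summable_sqrt_series] by (simp add: sqrt_series_def sqrt_coeff_def)
  then have "norm (1 - sqrt_series y) = norm (\<Sum>n. sqrt_coeff (Suc n) *\<^sub>R y ^ Suc n)"
    by simp
  also have "\<dots> \<le> (\<Sum>n. norm (sqrt_coeff (Suc n) *\<^sub>R y ^ Suc n))"
    by (rule summable_norm[OF sm])
  also have "\<dots> \<le> 1"
  proof (rule suminf_le_const[OF sm])
    fix N
    have "(\<Sum>n<N. norm (sqrt_coeff (Suc n) *\<^sub>R y ^ Suc n)) \<le> (\<Sum>n<N. \<bar>sqrt_coeff (Suc n)\<bar>)"
      by (rule sum_mono) (rule norm_sqrt_series_term)
    also have "\<dots> = (\<Sum>n\<in>{1..N}. \<bar>sqrt_coeff n\<bar>)"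
      by (rule sum.reindex_bij_witness[of _ "\<lambda>n. n - 1" Suc]) auto
    finally show "(\<Sum>n<N. norm (sqrt_coeff (Suc n) *\<^sub>R y ^ Suc n)) \<le> 1"
      using sqrt_coeff_partial_sum[of N] by simp
  qed
  finally show ?thesis .
qed

lemma sqrt_series_commute:
  assumes "z * y = y * z"
  shows "z * sqrt_series y = sqrt_series y * z"
proof -
  have "z * y ^ n = y ^ n * z" for n
    using assms by (induction n) (auto simp: mult.assoc, metis mult.assoc)
  then have "(\<Sum>n. z * (sqrt_coeff n *\<^sub>R y ^ n)) = (\<Sum>n. (sqrt_coeff n *\<^sub>R y ^ n) * z)"
    by simp
  then show ?thesis
    unfolding sqrt_series_def suminf_mult[OF summable_sqrt_series, symmetric]
      suminf_mult2[OF summable_sqrt_series] .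
qed

end

text \<open>Serves to make the correction term of \<Upsilon>, a square root, continuous in
  t.\<close>

lemma continuous_on_sqrt_series: "continuous_on (cball 0 1) (sqrt_series :: 'a::{banach, real_normed_algebra_1} \<Rightarrow> 'a)"
proof (rule uniform_limit_theorem)
  show "uniform_limit (cball 0 1) (\<lambda>N y. \<Sum>n<N. sqrt_coeff n *\<^sub>R y ^ n)
      (sqrt_series :: 'a \<Rightarrow> 'a) sequentially"
    unfolding sqrt_series_def
    by (rule Weierstrass_m_test[OF _ summable_abs_sqrt_coeff])
      (use norm_sqrt_series_term in auto)
qed (auto intro!: always_eventually continuous_intros)

section \<open>Positive elements\<close>

lemma adj_simps [simp]:
  fixes x y :: "'a::pre_cstar_algebra"
  shows "adj (x + y) = adj x + adj y" "adj (x * y) = adj y * adj x" "adj (adj x) = x"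
    "adj (0 :: 'a) = 0" "adj (- x) = - adj x" "adj (x - y) = adj x - adj y"
    "adj (r *\<^sub>R x) = r *\<^sub>R adj x"
proof -
  interpret bounded_linear "adj :: 'a \<Rightarrow> 'a" by (rule bounded_linear_adj)
  show "adj (0 :: 'a) = 0" "adj (- x) = - adj x" "adj (x - y) = adj x - adj y"
    "adj (r *\<^sub>R x) = r *\<^sub>R adj x"
    by (rule zero neg diff scaleR)+
qed (simp_all add: adj_add adj_mult adj_adj)

lemma adj_one [simp]: "adj (1 :: 'a::{pre_cstar_algebra, real_normed_algebra_1}) = 1"
  by (metis adj_adj adj_mult mult_1_left mult_1_right)

lemma adj_power [simp]: "adj (x ^ n) = adj (x :: 'a::{pre_cstar_algebra, real_normed_algebra_1}) ^ n"
  by (induction n) (auto simp: power_commutes)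

lemma adj_sum [simp]: "adj (\<Sum>i\<in>I. f i) = (\<Sum>i\<in>I. adj (f i :: 'a::pre_cstar_algebra))"
  by (induction I rule: infinite_finite_induct) auto

lemma scaleC_one [simp]: "1 *\<^sub>C x = (x :: 'a::pre_cstar_algebra)"
  using scaleC_of_real[of 1 x] by simp

lemma clinear_map_scaleR: "clinear_map \<phi> \<Longrightarrow> \<phi> (r *\<^sub>R x) = r *\<^sub>R \<phi> x"
  by (simp add: clinear_map_def flip: scaleC_of_real)

lemma clinear_map_diff: "clinear_map \<phi> \<Longrightarrow> \<phi> (x - y) = \<phi> x - \<phi> y"
  using clinear_map_scaleR[of \<phi> "-1" y] by (simp add: clinear_map_def diff_conv_add_uminus del: add_uminus_conv_diff)

lemma clinear_map_zero: "clinear_map \<phi> \<Longrightarrow> \<phi> 0 = 0"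
  using clinear_map_diff[of \<phi> 0 0] by simp

lemma clinear_map_sum: "clinear_map \<phi> \<Longrightarrow> \<phi> (\<Sum>i\<in>I. f i) = (\<Sum>i\<in>I. \<phi> (f i))"
  by (induction I rule: infinite_finite_induct) (auto simp: clinear_map_zero clinear_map_def)

lemma norm_square_selfadjoint:
  assumes "adj x = (x :: 'a::pre_cstar_algebra)"
  shows "norm (x * x) = (norm x)\<^sup>2"
  using cstar_identity[of x] assms by simp

lemma adj_sqrt_series:
  fixes y :: "'a::{cstar_algebra, real_normed_algebra_1}"
  assumes "norm y \<le> 1" "adj y = y"
  shows "adj (sqrt_series y) = sqrt_series y"
proof -
  have "adj (sqrt_series y) = (\<Sum>n. adj (sqrt_coeff n *\<^sub>R y ^ n))"
    unfolding sqrt_series_def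
    by (rule bounded_linear.suminf[OF bounded_linear_adj summable_sqrt_series[OF assms(1)]])
  then show ?thesis
    by (simp add: assms(2) sqrt_series_def)
qed

text \<open>For a unitary \<open>u = a + ic\<close> both \<open>a\<close> and \<open>c\<close> are averages of two unitaries.\<close>

lemma norm_le_one_of_squares_sum_one:
  fixes a c :: "'a::{cstar_algebra, real_normed_algebra_1}"
  assumes sa: "adj a = a" "adj c = c" and comm: "a * c = c * a" and one: "a * a + c * c = 1"
  shows "norm a \<le> 1"
proof -
  define b where "b = \<i> *\<^sub>C c"
  define u where "u = a + b"
  have scaleC_minus_one: "(- 1) *\<^sub>C x = - x" for x :: 'a
    using scaleC_of_real[of "-1" x] by simp
  have "adj b = (- 1) *\<^sub>C b"
    by (simp add: b_def adj_scaleC sa scaleC_scaleC)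
  then have adj_u: "adj u = a - b"
    by (simp add: u_def sa scaleC_minus_one)
  have "b * b = (- 1) *\<^sub>C (c * c)"
    by (simp add: b_def mult_scaleC_left mult_scaleC_right scaleC_scaleC)
  moreover have "a * b = b * a"
    by (simp add: b_def mult_scaleC_left mult_scaleC_right comm)
  ultimately have "adj u * u = a * a + c * c"
    unfolding adj_u unfolding u_def by (simp add: algebra_simps scaleC_minus_one)
  then have "(norm u)\<^sup>2 = 1"
    using cstar_identity[of u] by (simp add: one)
  then have u: "norm u = 1"
    by (auto simp: power2_eq_1_iff) (use norm_ge_zero[of u] in linarith)
  have "2 *\<^sub>R a = u + adj u"
    unfolding adj_u unfolding u_def by (simp add: scaleR_2)
  then have "2 * norm a = norm (u + adj u)"
    by (metis norm_scaleR abs_numeral)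
  also have "\<dots> \<le> 2"
    using norm_triangle_ineq[of u "adj u"] by (simp add: norm_adj u)
  finally show ?thesis by simp
qed

text \<open>For self-adjoint h the inequality says that the spectrum lies in [0, 2t]; it persists
  when t grows. In this form the triangle inequality alone shows that positive elements form a
  cone.\<close>

definition positive_elt :: "'a::{cstar_algebra, real_normed_algebra_1} \<Rightarrow> bool"
  where "positive_elt h \<longleftrightarrow> adj h = h \<and> (\<exists>t\<ge>0. norm (t *\<^sub>R 1 - h) \<le> t)"

section \<open>The positive cone and square roots\<close>

lemma positive_selfadjoint: "positive_elt h \<Longrightarrow> adj h = h"
  by (simp add: positive_elt_def)

lemma positive_of_real: "0 \<le> r \<Longrightarrow> positive_elt (r *\<^sub>R 1)"
  unfolding positive_elt_def by (intro conjI exI[of _ r]) auto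

lemma positive_zero: "positive_elt 0"
  using positive_of_real[of 0] by simp

lemma positive_add:
  assumes "positive_elt a" "positive_elt b" shows "positive_elt (a + b)"
proof -
  obtain s t where "s \<ge> 0" "norm (s *\<^sub>R 1 - a) \<le> s" "t \<ge> 0" "norm (t *\<^sub>R 1 - b) \<le> t"
    using assms by (auto simp: positive_elt_def)
  then have "norm ((s + t) *\<^sub>R 1 - (a + b)) \<le> s + t"
    using norm_triangle_ineq[of "s *\<^sub>R 1 - a" "t *\<^sub>R 1 - b"] by (simp add: algebra_simps)
  then show ?thesis
    using assms \<open>s \<ge> 0\<close> \<open>t \<ge> 0\<close> unfolding positive_elt_def by (intro conjI exI[of _ "s + t"]) auto
qed

lemma positive_scaleR:
  assumes "positive_elt a" "0 \<le> r" shows "positive_elt (r *\<^sub>R a)"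
proof -
  obtain t where t: "t \<ge> 0" "norm (t *\<^sub>R 1 - a) \<le> t"
    using assms by (auto simp: positive_elt_def)
  have "norm ((r * t) *\<^sub>R 1 - r *\<^sub>R a) = r * norm (t *\<^sub>R 1 - a)"
    using assms(2) by (simp flip: scaleR_scaleR scaleR_diff_right)
  also have "\<dots> \<le> r * t"
    using t assms(2) by (intro mult_left_mono)
  finally show ?thesis
    using assms t unfolding positive_elt_def by (intro conjI exI[of _ "r * t"]) auto
qed

lemma positive_sum: "(\<And>i. i \<in> I \<Longrightarrow> positive_elt (f i)) \<Longrightarrow> positive_elt (\<Sum>i\<in>I. f i)"
  by (induction I rule: infinite_finite_induct) (auto intro: positive_add positive_zero)

lemma positive_norm_bound:
  assumes "adj h = h" "norm h \<le> r"
  shows "positive_elt (r *\<^sub>R 1 - h)" "positive_elt (r *\<^sub>R 1 + h)"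
  unfolding positive_elt_def using assms order_trans[OF norm_ge_zero assms(2)]
  by (auto intro!: exI[of _ r])

text \<open>With \<open>y = 1 - (1 / t) *\<^sub>R h\<close> the criterion becomes
  \<open>norm y \<le> 1\<close>, and the root is sqrt t times the series at y. That it commutes with
  whatever commutes with h replaces functional calculus later on.\<close>

lemma positive_sqrt:
  assumes "positive_elt h"
  obtains s where "positive_elt s" "s * s = h" "\<And>z. z * h = h * z \<Longrightarrow> z * s = s * z"
proof -
  obtain t where t: "t \<ge> 0" "norm (t *\<^sub>R 1 - h) \<le> t"
    using assms by (auto simp: positive_elt_def)
  show ?thesis
  proof (cases "t = 0")
    case True
    then have "h = 0" using t by simp
    then show ?thesis using that[of 0] positive_zero by simp
  next
    case False
    define y where "y = 1 - (1 / t) *\<^sub>R h"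
    have ty: "t *\<^sub>R y = t *\<^sub>R 1 - h"
      using False by (simp add: y_def scaleR_diff_right)
    have "t * norm y \<le> t"
      using t by (simp flip: ty)
    then have y: "norm y \<le> 1"
      using False t(1) by (simp add: mult_le_cancel_left2)
    have sa: "adj y = y"
      using assms by (simp add: y_def positive_elt_def)
    show ?thesis
    proof (rule that[of "sqrt t *\<^sub>R sqrt_series y"])
      have "positive_elt (sqrt_series y)"
        unfolding positive_elt_def using adj_sqrt_series[OF y sa] norm_one_minus_sqrt_series[OF y]
        by (intro conjI exI[of _ 1]) auto
      then show "positive_elt (sqrt t *\<^sub>R sqrt_series y)"
        using t(1) by (intro positive_scaleR) auto
      show "(sqrt t *\<^sub>R sqrt_series y) * (sqrt t *\<^sub>R sqrt_series y) = h"
        using False t(1) by (simp add: sqrt_series_mult_self[OF y]) (simp add: y_def)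
      fix z assume z: "z * h = h * z"
      then have "z * y = y * z"
        by (simp add: y_def algebra_simps)
      then show "z * (sqrt t *\<^sub>R sqrt_series y) = (sqrt t *\<^sub>R sqrt_series y) * z"
        by (simp add: sqrt_series_commute[OF y])
    qed
  qed
qed

text \<open>After scaling to \<open>norm x \<le> 1\<close>, the element
  \<open>c = sqrt_series (x * x)\<close> satisfies c^2 + x^2 = 1. So c has norm at most 1, and
  \<open>norm (1 - x * x) = (norm c)\<^sup>2\<close> verifies the criterion with t = 1.\<close>

lemma positive_square:
  assumes sa: "adj s = s" shows "positive_elt (s * s)"
proof (cases "s = 0")
  case False
  define n where "n = norm s"
  have "n > 0" using False by (simp add: n_def)
  define x where "x = (1 / n) *\<^sub>R s"
  have x_sa: "adj x = x" by (simp add: x_def sa)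
  have "norm x \<le> 1" using False by (simp add: x_def n_def)
  then have xx: "norm (x * x) \<le> 1"
    using norm_square_selfadjoint[OF x_sa] by (simp add: power_le_one)
  define c where "c = sqrt_series (x * x)"
  have c_sa: "adj c = c"
    using adj_sqrt_series[OF xx] by (simp add: c_def x_sa)
  have cx: "c * x = x * c"
    unfolding c_def by (rule sqrt_series_commute[OF xx, symmetric]) (simp add: mult.assoc)
  have cc: "c * c = 1 - x * x"
    unfolding c_def by (rule sqrt_series_mult_self[OF xx])
  have "norm c \<le> 1"
    by (rule norm_le_one_of_squares_sum_one[OF c_sa x_sa cx]) (simp add: cc)
  then have "norm (1 - x * x) \<le> 1"
    using norm_square_selfadjoint[OF c_sa] by (simp add: cc power_le_one)
  then have "positive_elt (x * x)"
    unfolding positive_elt_def by (intro conjI exI[of _ 1]) (auto simp: x_sa)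
  then have "positive_elt ((n * n) *\<^sub>R (x * x))"
    by (rule positive_scaleR) simp
  then show ?thesis
    using \<open>n > 0\<close> by (simp add: x_def)
qed (simp add: positive_zero)

text \<open>The roots of a and b commute, so their product is self-adjoint with square
  \<open>a * b\<close>.\<close>

lemma positive_mult_commuting:
  assumes "positive_elt a" "positive_elt b" "a * b = b * a"
  shows "positive_elt (a * b)"
proof -
  obtain s where s: "positive_elt s" "s * s = a" "\<And>z. z * a = a * z \<Longrightarrow> z * s = s * z"
    using positive_sqrt[OF assms(1)] by blast
  obtain r where r: "positive_elt r" "r * r = b" "\<And>z. z * b = b * z \<Longrightarrow> z * r = r * z"
    using positive_sqrt[OF assms(2)] by blast
  have "b * s = s * b"
    using s(3)[of b] assms(3) by simp
  then have sr: "s * r = r * s"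
    using r(3)[of s] by simp
  have "positive_elt ((s * r) * (s * r))"
    using s(1) r(1) sr by (intro positive_square) (simp add: positive_elt_def)
  also have "(s * r) * (s * r) = a * b"
    by (metis mult.assoc s(2) r(2) sr)
  finally show ?thesis .
qed

text \<open>A root c of \<open>(1 + h) * (1 - h)\<close> completes h to h^2 + c^2 = 1, which brings
  back the argument with unitaries.\<close>

lemma norm_le_of_positive_one:
  assumes "positive_elt (1 + h)" "positive_elt (1 - h)"
  shows "norm h \<le> 1"
proof -
  have h: "adj h = h"
    using positive_selfadjoint[OF assms(1)] by simp
  have "positive_elt ((1 + h) * (1 - h))"
    by (rule positive_mult_commuting[OF assms]) (simp add: algebra_simps)
  then obtain c where c: "positive_elt c" "c * c = (1 + h) * (1 - h)"
    "\<And>z. z * ((1 + h) * (1 - h)) = ((1 + h) * (1 - h)) * z \<Longrightarrow> z * c = c * z"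
    using positive_sqrt by blast
  show ?thesis
  proof (rule norm_le_one_of_squares_sum_one[OF h])
    show "adj c = c" using c(1) by (rule positive_selfadjoint)
    show "h * c = c * h" by (rule c(3)) (simp add: algebra_simps)
    show "h * h + c * c = 1" by (simp add: c(2) algebra_simps)
  qed
qed

lemma norm_le_of_positive:
  assumes "positive_elt (r *\<^sub>R 1 + h)" "positive_elt (r *\<^sub>R 1 - h)" "0 \<le> r"
  shows "norm h \<le> r"
proof (rule field_le_epsilon)
  fix e :: real assume "e > 0"
  \<comment> \<open>The reduction to radius 1 divides by the radius, and r may be 0; hence r +
    e.\<close>
  define k where "k = (1 / (r + e)) *\<^sub>R h"
  have re: "r + e > 0" using \<open>e > 0\<close> assms(3) by simp
  have "positive_elt ((1 / (r + e)) *\<^sub>R ((r *\<^sub>R 1 + h) + e *\<^sub>R 1))"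
    "positive_elt ((1 / (r + e)) *\<^sub>R ((r *\<^sub>R 1 - h) + e *\<^sub>R 1))"
    using assms(1,2) re \<open>e > 0\<close> by (auto intro!: positive_scaleR positive_add positive_of_real)
  moreover have "(1 / (r + e)) *\<^sub>R ((r *\<^sub>R 1 + h) + e *\<^sub>R 1) = 1 + k"
    "(1 / (r + e)) *\<^sub>R ((r *\<^sub>R 1 - h) + e *\<^sub>R 1) = 1 - k"
    using re by (simp_all add: k_def algebra_simps flip: scaleR_add_left add_divide_distrib)
  ultimately have "norm k \<le> 1"
    using norm_le_of_positive_one by simp
  then show "norm h \<le> r + e"
    using re by (simp add: k_def field_simps)
qed

lemma norm_mono_positive:
  assumes "positive_elt a" "positive_elt (b - a)"
  shows "norm a \<le> norm b"
proof (rule norm_le_of_positive)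
  have "adj b = b"
    using positive_selfadjoint[OF positive_add[OF assms]] by simp
  then have "positive_elt ((norm b *\<^sub>R 1 - b) + (b - a))"
    by (intro positive_add assms positive_norm_bound) auto
  then show "positive_elt (norm b *\<^sub>R 1 - a)"
    by (simp add: algebra_simps)
  show "positive_elt (norm b *\<^sub>R 1 + a)"
    by (intro positive_add positive_of_real assms) simp
qed simp

section \<open>Positivity of \<open>adj x * x\<close>\<close>

lemma scaleC_minus_one: "(- 1) *\<^sub>C x = - (x :: 'a::pre_cstar_algebra)"
  using scaleC_of_real[of "-1" x] by simp

lemma scaleC_minus_right: "c *\<^sub>C (- x) = - (c *\<^sub>C (x :: 'a::pre_cstar_algebra))"
  by (rule linear_neg[OF bounded_linear.linear[OF bounded_linear_scaleC_right]])

text \<open>The self-adjoint elements \<open>y + adj y\<close> and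
  \<open>\<i> *\<^sub>C (y - adj y)\<close> have squares adding up to twice this sum. Consequently,
  if \<open>- (adj y * y)\<close> is positive, then so is \<open>y * adj y\<close>.\<close>

lemma positive_mult_adj_plus_adj_mult:
  fixes y :: "'a::{cstar_algebra, real_normed_algebra_1}"
  shows "positive_elt (y * adj y + adj y * y)"
proof -
  define b where "b = \<i> *\<^sub>C (y - adj y)"
  have "adj b = (- 1) *\<^sub>C \<i> *\<^sub>C (adj y - y)"
    by (simp add: b_def adj_scaleC scaleC_scaleC)
  also have "\<dots> = b"
    by (simp add: b_def scaleC_minus_one flip: scaleC_minus_right)
  finally have "adj b = b" .
  have "b * b = (- 1) *\<^sub>C ((y - adj y) * (y - adj y))"
    by (simp add: b_def mult_scaleC_left mult_scaleC_right scaleC_scaleC)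
  then have "(y + adj y) * (y + adj y) + b * b = 2 *\<^sub>R (y * adj y + adj y * y)"
    by (simp add: scaleC_minus_one algebra_simps scaleR_2)
  then have eq: "(1/2) *\<^sub>R ((y + adj y) * (y + adj y) + b * b) = y * adj y + adj y * y"
    by simp
  have "positive_elt ((1/2) *\<^sub>R ((y + adj y) * (y + adj y) + b * b))"
    using \<open>adj b = b\<close> by (intro positive_scaleR positive_add positive_square) (auto simp: add.commute)
  then show ?thesis
    by (simp add: eq)
qed

text \<open>Put \<open>p = yy\<^sup>*\<close> and \<open>q = - y\<^sup>*y\<close>. Both are positive of norm one, and \<open>z = (1 - p)y = y(1 + q)\<close>
  satisfies \<open>\<parallel>z\<parallel>\<^sup>2 = \<parallel>(1 - p)p(1 - p)\<parallel> \<le> 1\<close> as well as \<open>\<parallel>z\<parallel>\<^sup>2 = \<parallel>(1 + q)q(1 + q)\<parallel> \<ge> 3/2\<close>.\<close>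

lemma norm_one_imp_not_positive_uminus:
  fixes y :: "'a::{cstar_algebra, real_normed_algebra_1}"
  assumes "norm y = 1" shows "\<not> positive_elt (- (adj y * y))"
proof
  define p where "p = y * adj y"
  define q where "q = - (adj y * y)"
  assume "positive_elt (- (adj y * y))"
  then have q: "positive_elt q" by (simp add: q_def)
  have "positive_elt ((y * adj y + adj y * y) + q)"
    by (intro positive_add positive_mult_adj_plus_adj_mult q)
  then have p: "positive_elt p" by (simp add: p_def q_def)
  have norm_p: "norm p = 1"
    using cstar_identity[of "adj y"] by (simp add: p_def norm_adj assms)
  have norm_q: "norm q = 1"
    by (simp add: q_def cstar_identity assms)
  have "norm (1 - p) \<le> 1"
  proof (rule norm_le_of_positive_one)
    have "positive_elt (1 *\<^sub>R 1 + (1 *\<^sub>R 1 - p))"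
      using norm_p by (intro positive_add positive_of_real positive_norm_bound positive_selfadjoint p) auto
    then show "positive_elt (1 + (1 - p))" by simp
  qed (use p in simp)
  define z where "z = y - p * y"
  have z1: "z = (1 - p) * y" and z2: "z = y * (1 + q)"
    by (simp_all add: z_def p_def q_def algebra_simps)
  have "norm (z * adj z) = norm ((1 - p) * p * (1 - p))"
    using positive_selfadjoint[OF p] by (simp add: z1 mult.assoc p_def)
  also have "\<dots> \<le> norm (1 - p) * norm p * norm (1 - p)"
    by (intro order_trans[OF norm_mult_ineq] mult_right_mono norm_mult_ineq norm_ge_zero)
  also have "\<dots> \<le> 1"
    using \<open>norm (1 - p) \<le> 1\<close> by (simp add: norm_p mult_le_one)
  finally have le: "(norm z)\<^sup>2 \<le> 1"
    using cstar_identity[of "adj z"] by (simp add: norm_adj)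
  have qq: "positive_elt (q * q)"
    using q by (intro positive_square positive_selfadjoint)
  \<comment> \<open>The sum equals (1 + q) q (1 + q) - (3/2) q^2. Any constant above 1 and at most 2
    would do in place of 3/2.\<close>
  have "positive_elt (q + (q * q) * ((1/2) *\<^sub>R 1 + q))"
    by (intro positive_add[OF q] positive_mult_commuting positive_add positive_of_real q qq)
      (auto simp: algebra_simps)
  also have "q + (q * q) * ((1/2) *\<^sub>R 1 + q) = (1 + q) * q * (1 + q) - (3/2) *\<^sub>R (q * q)"
    using scaleR_add_left[of "1/2" "3/2" "q * q"] by (simp add: algebra_simps scaleR_2)
  finally have "norm ((3/2) *\<^sub>R (q * q)) \<le> norm ((1 + q) * q * (1 + q))"
    by (intro norm_mono_positive positive_scaleR qq) auto
  also have "\<dots> = norm (adj z * z)"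
    using positive_selfadjoint[OF q] by (simp add: z2 mult.assoc q_def)
  also have "\<dots> \<le> 1"
    using le by (simp add: cstar_identity)
  finally show False
    using norm_square_selfadjoint[OF positive_selfadjoint[OF q]] by (simp add: norm_q)
qed

lemma eq_zero_of_positive_uminus:
  fixes x :: "'a::{cstar_algebra, real_normed_algebra_1}"
  assumes "positive_elt (- (adj x * x))" shows "x = 0"
proof (rule ccontr)
  assume "x \<noteq> 0"
  define y where "y = (1 / norm x) *\<^sub>R x"
  have "positive_elt (((1 / norm x) * (1 / norm x)) *\<^sub>R (- (adj x * x)))"
    using assms by (intro positive_scaleR) auto
  then have "positive_elt (- (adj y * y))"
    by (simp add: y_def)
  moreover have "norm y = 1"
    using \<open>x \<noteq> 0\<close> by (simp add: y_def)
  ultimately show False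
    using norm_one_imp_not_positive_uminus by blast
qed

text \<open>With \<open>h = x\<^sup>*x\<close> and \<open>k = \<bar>h\<bar>\<close> the element \<open>b = k - h\<close> is twice the negative part of \<open>h\<close>, and
  \<open>(xb)\<^sup>*(xb) = - b\<^sup>2k\<close>.\<close>

lemma positive_adj_mult_self:
  fixes x :: "'a::{cstar_algebra, real_normed_algebra_1}"
  shows "positive_elt (adj x * x)"
proof -
  define h where "h = adj x * x"
  have h: "adj h = h" by (simp add: h_def)
  obtain k where k: "positive_elt k" "k * k = h * h" and comm: "\<And>z. z * (h * h) = (h * h) * z \<Longrightarrow> z * k = k * z"
    using positive_sqrt[OF positive_square[OF h]] by blast
  have hk: "h * k = k * h"
    by (rule comm) (simp add: mult.assoc)
  define b where "b = k - h"
  have b: "adj b = b"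
    using positive_selfadjoint[OF k(1)] by (simp add: b_def h)
  have hb: "b * h = h * b" and kb: "b * k = k * b"
    by (simp_all add: b_def algebra_simps hk)
  have bb: "b * b = 2 *\<^sub>R (h * h) - 2 *\<^sub>R (h * k)"
    by (simp add: b_def algebra_simps k(2) hk scaleR_2)
  have "b * h * b = h * (b * b)"
    by (simp add: hb mult.assoc)
  then have neg: "b * h * b = - (b * b * k)"
    by (simp add: bb left_diff_distrib right_diff_distrib mult.assoc k(2))
  have bk: "b * b * k = k * (b * b)"
    by (metis kb mult.assoc)
  have bbk: "positive_elt (b * b * k)"
    by (rule positive_mult_commuting[OF positive_square[OF b] k(1) bk])
  have "adj (x * b) * (x * b) = b * h * b"
    by (simp add: b h_def mult.assoc)
  then have "positive_elt (- (adj (x * b) * (x * b)))"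
    using bbk by (simp add: neg)
  then have "x * b = 0"
    by (rule eq_zero_of_positive_uminus)
  then have "h * b = 0"
    by (simp add: h_def mult.assoc)
  then have "b * b * k = 0"
    using neg by (simp add: mult.assoc)
  moreover have "b * b * h = 0"
    using \<open>h * b = 0\<close> by (simp add: hb mult.assoc)
  moreover have "b * b * b = b * b * k - b * b * h"
    by (simp add: b_def right_diff_distrib)
  ultimately have "b * b * b = 0"
    by simp
  \<comment> \<open>Passing from b^3 to b^4 gives a power to which the norm identity for squares of
    self-adjoint elements applies twice.\<close>
  then have "(b * b) * (b * b) = 0"
    by (metis mult.assoc mult_zero_left)
  then have "b = 0"
    using norm_square_selfadjoint[of "b * b"] norm_square_selfadjoint[of b] b by simp
  then show ?thesis
    using k(1) by (simp add: b_def h_def)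
qed

section \<open>Norm bounds derived from positivity\<close>

lemma positive_conjugate:
  fixes z :: "'a::{cstar_algebra, real_normed_algebra_1}"
  assumes "positive_elt b" shows "positive_elt (adj z * b * z)"
proof -
  obtain s where "positive_elt s" "s * s = b"
    using positive_sqrt[OF assms] by blast
  then have "adj z * b * z = adj (s * z) * (s * z)"
    using positive_selfadjoint[of s] by (simp add: mult.assoc flip: \<open>s * s = b\<close>)
  then show ?thesis
    by (simp only: positive_adj_mult_self)
qed

text \<open>Conjugation preserves the order, so -M \<le> e i \<le> M bounds the sum by M S and -M S,
  where S is the sum of the \<open>adj (y i) * y i\<close>, itself at most \<open>norm S\<close>.
  The estimate is independent of the number of summands, which may grow as the partitions get
  finer.\<close>

lemma norm_sum_conjugate_selfadjoint:
  fixes y e :: "'i \<Rightarrow> 'a::{cstar_algebra, real_normed_algebra_1}"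
  assumes e: "\<And>i. i \<in> I \<Longrightarrow> adj (e i) = e i" "\<And>i. i \<in> I \<Longrightarrow> norm (e i) \<le> M" and "0 \<le> M"
  shows "norm (\<Sum>i\<in>I. adj (y i) * e i * y i) \<le> M * norm (\<Sum>i\<in>I. adj (y i) * y i)"
proof (rule norm_le_of_positive)
  define S where "S = (\<Sum>i\<in>I. adj (y i) * y i)"
  have S: "positive_elt (M *\<^sub>R (norm S *\<^sub>R 1 - S))"
    by (intro positive_scaleR positive_norm_bound \<open>0 \<le> M\<close>) (auto simp: S_def)
  have "positive_elt (\<Sum>i\<in>I. adj (y i) * (M *\<^sub>R 1 + e i) * y i)"
    "positive_elt (\<Sum>i\<in>I. adj (y i) * (M *\<^sub>R 1 - e i) * y i)"
    using e by (auto intro!: positive_sum positive_conjugate positive_norm_bound)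
  from this[THEN positive_add[OF S]]
  show "positive_elt ((M * norm (\<Sum>i\<in>I. adj (y i) * y i)) *\<^sub>R 1 + (\<Sum>i\<in>I. adj (y i) * e i * y i))"
    "positive_elt ((M * norm (\<Sum>i\<in>I. adj (y i) * y i)) *\<^sub>R 1 - (\<Sum>i\<in>I. adj (y i) * e i * y i))"
    by (simp_all add: S_def algebra_simps sum.distrib sum_subtractf scaleR_sum_right)
qed (simp add: \<open>0 \<le> M\<close>)

text \<open>The real and imaginary parts contribute at most \<open>K * norm x\<close> each; this is
  the origin of the factor 2 in the norm bounds for \<Phi> and \<Upsilon>.\<close>

lemma norm_le_twice_of_selfadjoint:
  fixes \<phi> :: "'c::pre_cstar_algebra \<Rightarrow> 'b::pre_cstar_algebra"
  assumes lin: "clinear_map \<phi>"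
    and le: "\<And>x r. adj x = x \<Longrightarrow> norm x \<le> r \<Longrightarrow> norm (\<phi> x) \<le> K * r"
  shows "norm (\<phi> x) \<le> 2 * K * norm x"
proof -
  define a where "a = (1/2) *\<^sub>R (x + adj x)"
  define b where "b = (- \<i> / 2) *\<^sub>C (x - adj x)"
  have a: "adj a = a"
    by (simp add: a_def add.commute)
  have "adj b = (- 1) *\<^sub>C (- \<i> / 2) *\<^sub>C (adj x - x)"
    by (simp add: b_def adj_scaleC scaleC_scaleC)
  also have "\<dots> = b"
    by (simp add: b_def scaleC_minus_one flip: scaleC_minus_right)
  finally have b: "adj b = b" .
  have x: "x = a + \<i> *\<^sub>C b"
  proof -
    have "\<i> *\<^sub>C b = (1/2) *\<^sub>R (x - adj x)"
      by (simp add: b_def scaleC_scaleC flip: scaleC_of_real)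
    then have "a + \<i> *\<^sub>C b = (1/2) *\<^sub>R ((x + adj x) + (x - adj x))"
      by (simp only: scaleR_add_right a_def)
    then show ?thesis
      by (simp flip: scaleR_2)
  qed
  have na: "norm a \<le> norm x" and nb: "norm b \<le> norm x"
    using norm_triangle_ineq[of x "adj x"] norm_triangle_ineq4[of x "adj x"]
    by (simp_all add: a_def b_def norm_scaleC norm_adj)
  have "norm (\<phi> x) = norm (\<phi> a + \<i> *\<^sub>C \<phi> b)"
    using lin by (subst x) (simp add: clinear_map_def)
  also have "\<dots> \<le> norm (\<phi> a) + norm (\<phi> b)"
    using norm_triangle_ineq[of "\<phi> a" "\<i> *\<^sub>C \<phi> b"] by (simp add: norm_scaleC)
  also have "\<dots> \<le> K * norm x + K * norm x"
    by (intro add_mono le a b na nb)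
  finally show ?thesis by simp
qed

text \<open>The C*-identity reduces the claim to self-adjoint h. There norm h + h and norm h - h are
  squares of self-adjoint elements, and \<phi> preserves such squares.\<close>

lemma norm_star_hom_le:
  fixes \<phi> :: "'a::{cstar_algebra, real_normed_algebra_1} \<Rightarrow> 'b::{cstar_algebra, real_normed_algebra_1}"
  assumes lin: "clinear_map \<phi>" and mult: "\<And>x y. \<phi> (x * y) = \<phi> x * \<phi> y"
    and adj: "\<And>x. \<phi> (adj x) = adj (\<phi> x)" and one: "\<phi> 1 = 1"
  shows "norm (\<phi> x) \<le> norm x"
proof -
  have pos: "positive_elt (\<phi> h)" if "positive_elt h" for h
  proof -
    obtain s where s: "positive_elt s" "s * s = h"
      using \<open>positive_elt h\<close> positive_sqrt by blast
    have "adj (\<phi> s) = \<phi> s"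
      using adj[of s] positive_selfadjoint[OF s(1)] by simp
    then show ?thesis
      using positive_square[of "\<phi> s"] mult[of s s] s(2) by simp
  qed
  have sa: "norm (\<phi> h) \<le> norm h" if h: "adj h = h" for h
  proof (rule norm_le_of_positive)
    have "\<phi> (norm h *\<^sub>R 1 + h) = norm h *\<^sub>R 1 + \<phi> h"
      "\<phi> (norm h *\<^sub>R 1 + (- 1) *\<^sub>R h) = norm h *\<^sub>R 1 + (- 1) *\<^sub>R \<phi> h"
      using lin by (simp_all only: clinear_map_def clinear_map_scaleR[OF lin] one)
    then show "positive_elt (norm h *\<^sub>R 1 + \<phi> h)" "positive_elt (norm h *\<^sub>R 1 - \<phi> h)"
      using positive_norm_bound[OF h order_refl, THEN pos] by simp_all
  qed simp
  have "(norm (\<phi> x))\<^sup>2 = norm (\<phi> (adj x * x))"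
    by (simp add: mult adj cstar_identity)
  also have "\<dots> \<le> (norm x)\<^sup>2"
    using sa[of "adj x * x"] by (simp add: cstar_identity)
  finally show ?thesis
    by (rule power2_le_imp_le) simp
qed

section \<open>Completely positive maps\<close>

text \<open>A Cauchy-Schwarz inequality: the difference is half the sum of
  \<open>adj (v k - v l) * (v k - v l)\<close> over all pairs k, l.\<close>

lemma positive_sum_squares_minus_square_sum:
  fixes v :: "'k \<Rightarrow> 'a::{cstar_algebra, real_normed_algebra_1}"
  assumes "finite J"
  shows "positive_elt (real (card J) *\<^sub>R (\<Sum>k\<in>J. adj (v k) * v k) - adj (\<Sum>k\<in>J. v k) * (\<Sum>k\<in>J. v k))"
proof -
  define S where "S = (\<Sum>k\<in>J. adj (v k) * v k)"
  define D where "D = (\<Sum>k\<in>J. \<Sum>l\<in>J. adj (v k - v l) * (v k - v l))"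
  have "D = (\<Sum>k\<in>J. \<Sum>l\<in>J. adj (v k) * v k) - (\<Sum>k\<in>J. \<Sum>l\<in>J. adj (v k) * v l)
        - (\<Sum>k\<in>J. \<Sum>l\<in>J. adj (v l) * v k) + (\<Sum>k\<in>J. \<Sum>l\<in>J. adj (v l) * v l)"
    by (simp add: D_def left_diff_distrib right_diff_distrib sum_subtractf sum.distrib)
  also have "(\<Sum>k\<in>J. \<Sum>l\<in>J. adj (v k) * v k) = real (card J) *\<^sub>R S"
    by (simp add: S_def sum_distrib_left scaleR_conv_of_real)
  also have "(\<Sum>k\<in>J. \<Sum>l\<in>J. adj (v l) * v l) = real (card J) *\<^sub>R S"
    by (simp add: S_def scaleR_conv_of_real)
  also have "(\<Sum>k\<in>J. \<Sum>l\<in>J. adj (v l) * v k) = (\<Sum>k\<in>J. \<Sum>l\<in>J. adj (v k) * v l)"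
    by (rule sum.swap)
  also have "(\<Sum>k\<in>J. \<Sum>l\<in>J. adj (v k) * v l) = adj (\<Sum>k\<in>J. v k) * (\<Sum>k\<in>J. v k)"
    by (simp add: sum_product)
  finally have "D = 2 *\<^sub>R (real (card J) *\<^sub>R S - adj (\<Sum>k\<in>J. v k) * (\<Sum>k\<in>J. v k))"
    by (simp add: scaleR_2)
  moreover have "positive_elt ((1/2) *\<^sub>R D)"
    unfolding D_def by (intro positive_scaleR positive_sum positive_adj_mult_self) simp
  ultimately show ?thesis
    by (simp add: S_def)
qed

lemma positive_norm_square_minus:
  fixes a z :: "'a::{cstar_algebra, real_normed_algebra_1}"
  shows "positive_elt ((norm a)\<^sup>2 *\<^sub>R (adj z * z) - adj (a * z) * (a * z))"
proof -
  have "positive_elt (adj z * ((norm a)\<^sup>2 *\<^sub>R 1 - adj a * a) * z)"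
    by (intro positive_conjugate positive_norm_bound) (auto simp: cstar_identity)
  then show ?thesis
    by (simp add: algebra_simps)
qed

text \<open>\<open>Y\<^sup>*Y\<close> is again the square of a self-adjoint matrix: for large \<open>t\<close> the matrix \<open>T = 1 - Y\<^sup>*Y/t\<close>
  contracts the Hilbert module \<open>A\<^sup>n\<close>, so the entries of its powers are bounded and the series for
  \<open>\<surd>t \<surd>(1 - T)\<close> converges entrywise.\<close>

lemma matrix_positive_gram:
  fixes Y :: "'k \<Rightarrow> nat \<Rightarrow> 'a::{cstar_algebra, real_normed_algebra_1}"
  assumes "finite J"
  shows "matrix_positive n (\<lambda>i j. \<Sum>k\<in>J. adj (Y k i) * Y k j)"
proof -
  define X where "X i j = (\<Sum>k\<in>J. adj (Y k i) * Y k j)" for i j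
  \<comment> \<open>Chosen so that Q \<zeta> \<le> t N below; the factor \<open>card J\<close> is
    lost to Cauchy-Schwarz, and t = C + 1 is moreover positive.\<close>
  define C where "C = real (card J) * (\<Sum>k\<in>J. \<Sum>i<n. (norm (Y k i))\<^sup>2)"
  define t where "t = C + 1"
  have "C \<ge> 0" by (simp add: C_def sum_nonneg)
  then have "t > 0" "C \<le> t" by (auto simp: t_def)
  define T where "T i j = (if i = j then 1 else 0) - (1/t) *\<^sub>R X i j" for i j
  have adj_X: "adj (X i j) = X j i" for i j
    by (simp add: X_def)
  have adj_T: "adj (T i j) = T j i" for i j
    by (simp add: T_def adj_X)
  define Q where "Q \<xi> = (\<Sum>i<n. adj (\<xi> i) * \<xi> i)" for \<xi> :: "nat \<Rightarrow> 'a"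

  have contract: "norm (Q (\<lambda>i. \<Sum>j<n. T i j * \<xi> j)) \<le> norm (Q \<xi>)" for \<xi>
  proof (rule norm_mono_positive)
    show "positive_elt (Q (\<lambda>i. \<Sum>j<n. T i j * \<xi> j))"
      unfolding Q_def by (intro positive_sum positive_adj_mult_self)
    define \<eta> where "\<eta> k = (\<Sum>j<n. Y k j * \<xi> j)" for k
    define \<zeta> where "\<zeta> i = (\<Sum>k\<in>J. adj (Y k i) * \<eta> k)" for i
    define N where "N = (\<Sum>k\<in>J. adj (\<eta> k) * \<eta> k)"
    have N: "positive_elt N"
      unfolding N_def by (intro positive_sum positive_adj_mult_self)
    have X\<xi>: "(\<Sum>j<n. X i j * \<xi> j) = \<zeta> i" for i
      unfolding X_def \<zeta>_def \<eta>_def sum_distrib_right sum_distrib_left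
      by (subst sum.swap) (simp add: mult.assoc)
    have T\<xi>: "(\<Sum>j<n. T i j * \<xi> j) = \<xi> i - (1/t) *\<^sub>R \<zeta> i" if "i < n" for i
    proof -
      have "(\<Sum>j<n. T i j * \<xi> j) = (\<Sum>j<n. (if i = j then 1 else 0) * \<xi> j) - (1/t) *\<^sub>R (\<Sum>j<n. X i j * \<xi> j)"
        by (simp add: T_def left_diff_distrib sum_subtractf scaleR_sum_right)
      also have "(\<Sum>j<n. (if i = j then 1 else 0) * \<xi> j) = (\<Sum>j<n. if j = i then \<xi> j else 0)"
        by (rule sum.cong) auto
      finally show ?thesis
        using that by (simp add: X\<xi>)
    qed
    have \<zeta>\<xi>: "(\<Sum>i<n. adj (\<zeta> i) * \<xi> i) = N"
      unfolding \<zeta>_def N_def \<eta>_def adj_sum adj_mult sum_distrib_right sum_distrib_left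
      by (subst sum.swap) (simp add: mult.assoc sum_distrib_left sum_distrib_right)
    have "(\<Sum>i<n. adj (\<xi> i) * \<zeta> i) = adj (\<Sum>i<n. adj (\<zeta> i) * \<xi> i)"
      by simp
    then have \<xi>\<zeta>: "(\<Sum>i<n. adj (\<xi> i) * \<zeta> i) = N"
      using positive_selfadjoint[OF N] by (simp only: \<zeta>\<xi>)
    have "Q (\<lambda>i. \<Sum>j<n. T i j * \<xi> j) = (\<Sum>i<n. adj (\<xi> i - (1/t) *\<^sub>R \<zeta> i) * (\<xi> i - (1/t) *\<^sub>R \<zeta> i))"
      unfolding Q_def by (rule sum.cong) (simp_all add: T\<xi>)
    also have "\<dots> = Q \<xi> - (1/t) *\<^sub>R (\<Sum>i<n. adj (\<xi> i) * \<zeta> i) - (1/t) *\<^sub>R (\<Sum>i<n. adj (\<zeta> i) * \<xi> i)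
        + (1/t) *\<^sub>R (1/t) *\<^sub>R Q \<zeta>"
      unfolding Q_def by (simp add: sum_subtractf sum.distrib scaleR_sum_right algebra_simps)
    finally have "Q (\<lambda>i. \<Sum>j<n. T i j * \<xi> j)
        = Q \<xi> - (1/t) *\<^sub>R N - (1/t) *\<^sub>R N + (1/t) *\<^sub>R (1/t) *\<^sub>R Q \<zeta>"
      unfolding \<xi>\<zeta> \<zeta>\<xi> .
    \<comment> \<open>Here \<eta> = Y \<xi>, and \<zeta> arises from \<eta> by the adjoint matrix,
      so the loss is (2/t) N - (1/t^2) Q \<zeta>; it is written so that t N - Q \<zeta> remains to
      be shown positive.\<close>
    then have eq: "Q \<xi> - Q (\<lambda>i. \<Sum>j<n. T i j * \<xi> j)
        = (1/t) *\<^sub>R (1/t) *\<^sub>R ((t *\<^sub>R N - Q \<zeta>) + t *\<^sub>R N)"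
      using \<open>t > 0\<close> by (simp add: scaleR_add_right scaleR_diff_right)
    \<comment> \<open>t N - Q \<zeta> telescopes into three positive sums: Cauchy-Schwarz for every
      i, the bound of each entry of Y by its norm, and the slack left by the choice of t.\<close>
    have "positive_elt ((\<Sum>i<n. real (card J) *\<^sub>R (\<Sum>k\<in>J. adj (adj (Y k i) * \<eta> k) * (adj (Y k i) * \<eta> k))
          - adj (\<zeta> i) * \<zeta> i)
        + real (card J) *\<^sub>R (\<Sum>k\<in>J. \<Sum>i<n. (norm (adj (Y k i)))\<^sup>2 *\<^sub>R (adj (\<eta> k) * \<eta> k)
            - adj (adj (Y k i) * \<eta> k) * (adj (Y k i) * \<eta> k))
        + (\<Sum>k\<in>J. (t - real (card J) * (\<Sum>i<n. (norm (Y k i))\<^sup>2)) *\<^sub>R (adj (\<eta> k) * \<eta> k)))"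
    proof (intro positive_add positive_sum positive_scaleR positive_adj_mult_self positive_norm_square_minus)
      fix i show "positive_elt (real (card J) *\<^sub>R (\<Sum>k\<in>J. adj (adj (Y k i) * \<eta> k) * (adj (Y k i) * \<eta> k))
          - adj (\<zeta> i) * \<zeta> i)"
        unfolding \<zeta>_def by (rule positive_sum_squares_minus_square_sum[OF \<open>finite J\<close>])
    next
      fix k assume "k \<in> J"
      then have "(\<Sum>i<n. (norm (Y k i))\<^sup>2) \<le> (\<Sum>k\<in>J. \<Sum>i<n. (norm (Y k i))\<^sup>2)"
        using \<open>finite J\<close> by (intro member_le_sum sum_nonneg) auto
      then have "real (card J) * (\<Sum>i<n. (norm (Y k i))\<^sup>2) \<le> C"
        unfolding C_def by (intro mult_left_mono) auto
      then show "0 \<le> t - real (card J) * (\<Sum>i<n. (norm (Y k i))\<^sup>2)"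
        using \<open>C \<le> t\<close> by simp
    qed (rule of_nat_0_le_iff)
    also have "\<dots> = t *\<^sub>R N - Q \<zeta>"
    proof -
      define G where "G k i = adj (adj (Y k i) * \<eta> k) * (adj (Y k i) * \<eta> k)" for k i
      define c where "c = real (card J)"
      have "(\<Sum>i<n. c *\<^sub>R (\<Sum>k\<in>J. G k i) - adj (\<zeta> i) * \<zeta> i) = c *\<^sub>R (\<Sum>k\<in>J. \<Sum>i<n. G k i) - Q \<zeta>"
        unfolding Q_def sum_subtractf scaleR_sum_right[symmetric] by (subst sum.swap) (rule refl)
      moreover have "c *\<^sub>R (\<Sum>k\<in>J. \<Sum>i<n. (norm (adj (Y k i)))\<^sup>2 *\<^sub>R (adj (\<eta> k) * \<eta> k) - G k i)
          = (\<Sum>k\<in>J. (c * (\<Sum>i<n. (norm (Y k i))\<^sup>2)) *\<^sub>R (adj (\<eta> k) * \<eta> k)) - c *\<^sub>R (\<Sum>k\<in>J. \<Sum>i<n. G k i)"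
        by (simp only: sum_subtractf scaleR_diff_right norm_adj scaleR_sum_right scaleR_sum_left
            sum_distrib_left scaleR_scaleR)
      moreover have "(\<Sum>k\<in>J. (t - c * (\<Sum>i<n. (norm (Y k i))\<^sup>2)) *\<^sub>R (adj (\<eta> k) * \<eta> k))
          = t *\<^sub>R N - (\<Sum>k\<in>J. (c * (\<Sum>i<n. (norm (Y k i))\<^sup>2)) *\<^sub>R (adj (\<eta> k) * \<eta> k))"
        by (simp add: N_def scaleR_diff_left sum_subtractf scaleR_sum_right)
      ultimately show ?thesis
        unfolding G_def[symmetric] c_def[symmetric] by simp
    qed
    finally show "positive_elt (Q \<xi> - Q (\<lambda>i. \<Sum>j<n. T i j * \<xi> j))"
      unfolding eq using \<open>t > 0\<close> by (intro positive_scaleR positive_add N) auto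
  qed

  \<comment> \<open>P k is the k-th matrix power of T, meaningful at indices below n.\<close>
  define P where "P = rec_nat (\<lambda>i j. if i = j then 1 else 0) (\<lambda>_ p i j. \<Sum>l<n. T i l * p l j)"
  have P_0: "P 0 i j = (if i = j then 1 else 0)" and P_Suc: "P (Suc k) i j = (\<Sum>l<n. T i l * P k l j)"
    for i j k
    by (simp_all add: P_def)
  have P_1: "P 1 i j = T i j" if "j < n" for i j
  proof -
    have "P 1 i j = (\<Sum>l<n. if l = j then T i l else 0)"
      unfolding One_nat_def P_Suc P_0 by (rule sum.cong) auto
    then show ?thesis using that by simp
  qed
  have P_le: "norm (P k i j) \<le> 1" if "i < n" "j < n" for i j k
  proof -
    \<comment> \<open>Column j arises from a unit vector by k contractions; each entry is then
      dominated by its column.\<close>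
    have "norm (Q (\<lambda>i. P k i j)) \<le> 1"
    proof (induction k)
      case 0
      have "Q (\<lambda>i. P 0 i j) = (\<Sum>i<n. if i = j then 1 else 0)"
        unfolding Q_def P_0 by (rule sum.cong) auto
      then show ?case using that by simp
    next
      case (Suc k)
      then show ?case
        using contract[of "\<lambda>i. P k i j"] by (simp add: P_Suc)
    qed
    moreover have "norm (adj (P k i j) * P k i j) \<le> norm (Q (\<lambda>i. P k i j))"
    proof (rule norm_mono_positive[OF positive_adj_mult_self])
      have "Q (\<lambda>i. P k i j) - adj (P k i j) * P k i j = (\<Sum>l\<in>{..<n} - {i}. adj (P k l j) * P k l j)"
        using that by (simp add: Q_def sum.remove[of "{..<n}" i])
      then show "positive_elt (Q (\<lambda>i. P k i j) - adj (P k i j) * P k i j)"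
        by (simp add: positive_sum positive_adj_mult_self)
    qed
    ultimately have "(norm (P k i j))\<^sup>2 \<le> 1"
      by (simp add: cstar_identity)
    then show ?thesis
      using power2_le_imp_le[of "norm (P k i j)" 1] by simp
  qed
  have P_add: "(\<Sum>l<n. P a i l * P b l j) = P (a + b) i j" if "i < n" for a b i j
    using that
  proof (induction a arbitrary: i)
    case 0
    have "(\<Sum>l<n. P 0 i l * P b l j) = (\<Sum>l<n. if l = i then P b l j else 0)"
      unfolding P_0 by (rule sum.cong) auto
    then show ?case using 0 by simp
  next
    case (Suc a)
    have "(\<Sum>l<n. P (Suc a) i l * P b l j) = (\<Sum>l<n. \<Sum>m<n. T i m * P a m l * P b l j)"
      by (simp add: P_Suc sum_distrib_right)
    also have "\<dots> = (\<Sum>m<n. T i m * (\<Sum>l<n. P a m l * P b l j))"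
      by (subst sum.swap) (simp add: sum_distrib_left mult.assoc)
    also have "\<dots> = (\<Sum>m<n. T i m * P (a + b) m j)"
      using Suc.IH by (intro sum.cong) auto
    finally show ?case by (simp add: P_Suc)
  qed
  have adj_P: "adj (P k i j) = P k j i" if "i < n" "j < n" for i j k
    using that
  proof (induction k arbitrary: i j)
    case (Suc k)
    have "adj (P (Suc k) i j) = (\<Sum>l<n. P k j l * P 1 l i)"
      unfolding P_Suc adj_sum adj_mult by (rule sum.cong) (use Suc P_1 adj_T in auto)
    then show ?case
      using P_add[OF \<open>j < n\<close>, of k 1 i] by simp
  qed (simp add: P_0)

  define p where "p i j k = sqrt_coeff k *\<^sub>R P k i j" for i j k
  have summable_norm_p: "summable (\<lambda>k. norm (p i j k))" if "i < n" "j < n" for i j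
    by (rule summable_comparison_test'[OF summable_abs_sqrt_coeff])
      (use P_le[OF that] in \<open>auto simp: p_def mult_left_le\<close>)
  have summable_p: "summable (p i j)" if "i < n" "j < n" for i j
    by (rule summable_norm_cancel[OF summable_norm_p[OF that]])
  define Z where "Z i j = sqrt t *\<^sub>R (\<Sum>k. p i j k)" for i j
  have adj_Z: "adj (Z i j) = Z j i" if "i < n" "j < n" for i j
  proof -
    have "adj (\<Sum>k. p i j k) = (\<Sum>k. adj (p i j k))"
      by (rule bounded_linear.suminf[OF bounded_linear_adj summable_p[OF that]])
    then show ?thesis
      by (simp add: Z_def p_def adj_P[OF that])
  qed
  have "X i j = (\<Sum>l<n. adj (Z l i) * Z l j)" if ij: "i < n" "j < n" for i j
  proof -
    have "(\<Sum>l<n. adj (Z l i) * Z l j) = (\<Sum>l<n. Z i l * Z l j)"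
      using ij adj_Z by (intro sum.cong) auto
    also have "\<dots> = t *\<^sub>R (\<Sum>l<n. (\<Sum>k. p i l k) * (\<Sum>k. p l j k))"
      using \<open>t > 0\<close> by (simp add: Z_def scaleR_sum_right)
    also have "(\<Sum>l<n. (\<Sum>k. p i l k) * (\<Sum>k. p l j k))
        = (\<Sum>l<n. \<Sum>m. \<Sum>a\<le>m. p i l a * p l j (m - a))"
      using ij by (intro sum.cong Cauchy_product summable_norm_p) auto
    also have "\<dots> = (\<Sum>m. \<Sum>l<n. \<Sum>a\<le>m. p i l a * p l j (m - a))"
      using ij by (intro suminf_sum[symmetric] summable_Cauchy_product summable_norm_p) auto
    also have "\<dots> = (\<Sum>m. (if m = 0 then 1 else if m = 1 then -1 else 0) *\<^sub>R P m i j)"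
    proof (rule arg_cong[of _ _ suminf], rule ext)
      fix m
      have "(\<Sum>l<n. \<Sum>a\<le>m. p i l a * p l j (m - a))
          = (\<Sum>a\<le>m. (sqrt_coeff (m - a) * sqrt_coeff a) *\<^sub>R (\<Sum>l<n. P a i l * P (m - a) l j))"
        by (subst sum.swap) (simp add: p_def scaleR_sum_right)
      also have "\<dots> = (\<Sum>a\<le>m. sqrt_coeff a * sqrt_coeff (m - a)) *\<^sub>R P m i j"
        unfolding scaleR_sum_left using P_add[OF ij(1)] by (intro sum.cong) (auto simp: mult.commute)
      finally show "(\<Sum>l<n. \<Sum>a\<le>m. p i l a * p l j (m - a))
          = (if m = 0 then 1 else if m = 1 then -1 else 0) *\<^sub>R P m i j"
        by (simp add: sqrt_coeff_convolution)
    qed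
    also have "\<dots> = (\<Sum>m\<in>{0, 1}. (if m = 0 then 1 else if m = 1 then -1 else 0) *\<^sub>R P m i j)"
      by (rule suminf_finite) auto
    also have "\<dots> = P 0 i j - P 1 i j"
      by simp
    also have "\<dots> = (1/t) *\<^sub>R X i j"
      unfolding P_1[OF ij(2)] by (simp add: P_0 T_def)
    finally show ?thesis
      using \<open>t > 0\<close> by simp
  qed
  then show ?thesis
    unfolding matrix_positive_def X_def by blast
qed

text \<open>Stacking the factors of the summands gives a Gram matrix with one row for every pair in
  \<open>I \<times> {..<n}\<close>, whereas \<open>matrix_positive\<close> admits exactly n rows;
  \<open>matrix_positive_gram\<close> closes the gap.\<close>

lemma completely_positive_sum:
  fixes \<phi> :: "'i \<Rightarrow> 'c::pre_cstar_algebra \<Rightarrow> 'b::{cstar_algebra, real_normed_algebra_1}"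
  assumes "finite I" "\<And>i. i \<in> I \<Longrightarrow> completely_positive (\<phi> i)"
  shows "completely_positive (\<lambda>x. \<Sum>i\<in>I. \<phi> i x)"
  unfolding completely_positive_def
proof (intro conjI allI impI)
  interpret scaleC: bounded_linear "\<lambda>x :: 'b. c *\<^sub>C x" for c
    by (rule bounded_linear_scaleC_right)
  show "clinear_map (\<lambda>x. \<Sum>i\<in>I. \<phi> i x)"
    using assms(2) by (simp add: completely_positive_def clinear_map_def sum.distrib scaleC.sum)
  fix n and X :: "nat \<Rightarrow> nat \<Rightarrow> 'c"
  assume "matrix_positive n X"
  have "\<forall>i\<in>I. \<exists>Y. \<forall>a<n. \<forall>b<n. \<phi> i (X a b) = (\<Sum>k<n. adj (Y k a) * Y k b)"
  proof
    fix i assume "i \<in> I"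
    then have "matrix_positive n (\<lambda>a b. \<phi> i (X a b))"
      using assms(2) \<open>matrix_positive n X\<close> by (auto simp: completely_positive_def)
    then show "\<exists>Y. \<forall>a<n. \<forall>b<n. \<phi> i (X a b) = (\<Sum>k<n. adj (Y k a) * Y k b)"
      by (simp add: matrix_positive_def)
  qed
  then obtain Y where Y: "\<And>i a b. i \<in> I \<Longrightarrow> a < n \<Longrightarrow> b < n \<Longrightarrow> \<phi> i (X a b) = (\<Sum>k<n. adj (Y i k a) * Y i k b)"
    by metis
  have "matrix_positive n (\<lambda>a b. \<Sum>p\<in>I \<times> {..<n}. adj (case p of (i, k) \<Rightarrow> Y i k a) * (case p of (i, k) \<Rightarrow> Y i k b))"
    by (rule matrix_positive_gram[of _ n "\<lambda>p a. case p of (i, k) \<Rightarrow> Y i k a"]) (simp add: assms(1))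
  then show "matrix_positive n (\<lambda>a b. \<Sum>i\<in>I. \<phi> i (X a b))"
    by (simp add: matrix_positive_def Y sum.cartesian_product case_prod_unfold)
qed

lemma completely_positive_scaleR:
  assumes "completely_positive \<phi>" "0 \<le> r"
  shows "completely_positive (\<lambda>x. r *\<^sub>R \<phi> x)"
  unfolding completely_positive_def
proof (intro conjI allI impI)
  show "clinear_map (\<lambda>x. r *\<^sub>R \<phi> x)"
    using assms(1) by (simp add: completely_positive_def clinear_map_def scaleC_add_right
        scaleC_scaleC mult.commute flip: scaleC_of_real)
  fix n and X :: "nat \<Rightarrow> nat \<Rightarrow> 'a"
  assume "matrix_positive n X"
  then obtain Y where Y: "\<forall>i<n. \<forall>j<n. \<phi> (X i j) = (\<Sum>k<n. adj (Y k i) * Y k j)"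
    using assms(1) unfolding completely_positive_def matrix_positive_def by blast
  have "r *\<^sub>R \<phi> (X i j) = (\<Sum>k<n. adj (sqrt r *\<^sub>R Y k i) * (sqrt r *\<^sub>R Y k j))"
    if "i < n" "j < n" for i j
    using Y that assms(2) by (simp add: scaleR_sum_right)
  then show "matrix_positive n (\<lambda>i j. r *\<^sub>R \<phi> (X i j))"
    unfolding matrix_positive_def by (intro exI[of _ "\<lambda>k i. sqrt r *\<^sub>R Y k i"] allI impI)
qed

lemma completely_positive_star_hom:
  assumes "clinear_map \<phi>" "\<And>x y. \<phi> (x * y) = \<phi> x * \<phi> y" "\<And>x. \<phi> (adj x) = adj (\<phi> x)"
  shows "completely_positive \<phi>"
  unfolding completely_positive_def
proof (intro conjI allI impI assms)
  have "\<phi> 0 = 0"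
    using assms(1) by (metis clinear_map_def add_cancel_right_right)
  then have sum: "\<phi> (\<Sum>k\<in>K. f k) = (\<Sum>k\<in>K. \<phi> (f k))" for K :: "nat set" and f
    using assms(1) by (induction K rule: infinite_finite_induct) (auto simp: clinear_map_def)
  fix n and X :: "nat \<Rightarrow> nat \<Rightarrow> 'a"
  assume "matrix_positive n X"
  then obtain Y where "\<And>i j. i < n \<Longrightarrow> j < n \<Longrightarrow> X i j = (\<Sum>k<n. adj (Y k i) * Y k j)"
    unfolding matrix_positive_def by metis
  then show "matrix_positive n (\<lambda>i j. \<phi> (X i j))"
    unfolding matrix_positive_def
    by (intro exI[of _ "\<lambda>k i. \<phi> (Y k i)"]) (simp add: sum assms(2,3))
qed

lemma completely_positive_conjugate:
  fixes z :: "'a::pre_cstar_algebra"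
  shows "completely_positive (\<lambda>x. adj z * x * z)"
  unfolding completely_positive_def
proof (intro conjI allI impI)
  show "clinear_map (\<lambda>x. adj z * x * z)"
    by (simp add: clinear_map_def algebra_simps mult_scaleC_left mult_scaleC_right)
  fix n and X :: "nat \<Rightarrow> nat \<Rightarrow> 'a"
  assume "matrix_positive n X"
  then obtain Y where "\<And>i j. i < n \<Longrightarrow> j < n \<Longrightarrow> X i j = (\<Sum>k<n. adj (Y k i) * Y k j)"
    unfolding matrix_positive_def by metis
  then show "matrix_positive n (\<lambda>i j. adj z * X i j * z)"
    unfolding matrix_positive_def
    by (intro exI[of _ "\<lambda>k i. Y k i * z"]) (simp add: sum_distrib_left sum_distrib_right mult.assoc)
qed

lemma completely_positive_comp:
  "completely_positive \<phi> \<Longrightarrow> completely_positive \<psi> \<Longrightarrow> completely_positive (\<lambda>x. \<phi> (\<psi> x))"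
  unfolding completely_positive_def clinear_map_def by auto

section \<open>Functions on compact spaces\<close>

lemma apply_Bcontfun:
  fixes f :: "'g::topological_space \<Rightarrow> 'b::metric_space"
  assumes "compact (UNIV :: 'g set)" "continuous_on UNIV f"
  shows "apply_bcontfun (Bcontfun f) = f"
  using compact_imp_bounded[OF compact_continuous_image[OF assms(2,1)]] assms(2)
  by (intro Bcontfun_inverse) (simp add: bcontfun_def)

text \<open>A nonnegative function is \<open>adj s * s\<close> for its pointwise root s, hence
  positive as a 1 by 1 matrix, and so is its image. Applied to r + f and r - f with \<phi> 1 = 1,
  this bounds \<phi> on self-adjoint f.\<close>

lemma norm_unital_completely_positive_le:
  fixes \<phi> :: "('g::topological_space \<Rightarrow>\<^sub>C complex) \<Rightarrow> 'b::{cstar_algebra, real_normed_algebra_1}"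
  assumes cp: "completely_positive \<phi>" and one: "\<phi> 1 = 1"
  shows "norm (\<phi> f) \<le> 2 * norm f"
proof -
  have lin: "clinear_map \<phi>"
    using cp by (simp add: completely_positive_def)
  have pos: "positive_elt (\<phi> f)" if f: "adj f = f" and nonneg: "\<And>x. 0 \<le> Re (f x)"
    for f :: "'g \<Rightarrow>\<^sub>C complex"
  proof -
    define s where "s x = complex_of_real (sqrt (Re (f x)))" for x
    have "s \<in> bcontfun"
    proof (rule bcontfun_normI)
      show "continuous_on UNIV s"
        unfolding s_def by (intro continuous_intros) simp
      show "norm (s x) \<le> sqrt (norm f)" for x
        using nonneg[of x] abs_Re_le_cmod[of "f x"] norm_bounded[of f x] by (simp add: s_def)
    qed
    then have s: "Bcontfun s x = s x" for x
      by (simp add: Bcontfun_inverse)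
    have "f x = complex_of_real (Re (f x))" for x
      using arg_cong[OF f, of "\<lambda>f. f x"] by (simp add: adj_complex_def complex_eq_iff)
    then have "f = adj (Bcontfun s) * Bcontfun s"
      using nonneg by (intro bcontfun_eqI) (simp add: s s_def adj_complex_def flip: of_real_mult)
    then have "matrix_positive 1 (\<lambda>_ _. f)"
      by (auto simp: matrix_positive_def intro!: exI[of _ "\<lambda>_ _. Bcontfun s"])
    then have "matrix_positive 1 (\<lambda>_ _. \<phi> f)"
      using cp by (auto simp: completely_positive_def)
    then show ?thesis
      using positive_adj_mult_self by (auto simp: matrix_positive_def)
  qed
  have "norm (\<phi> f) \<le> 1 * r" if f: "adj f = f" and r: "norm f \<le> r"
    for f :: "'g \<Rightarrow>\<^sub>C complex" and r
  proof -
    have Re: "\<bar>Re (f x)\<bar> \<le> r" for x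
      using abs_Re_le_cmod[of "f x"] norm_bounded[of f x] r by linarith
    have "positive_elt (\<phi> (r *\<^sub>R 1 + f))" "positive_elt (\<phi> (r *\<^sub>R 1 - f))"
      using Re by (auto intro!: pos simp: f abs_le_iff) (metis add.commute neg_le_iff_le add_nonneg_nonneg diff_ge_0_iff_ge diff_minus_eq_add)
    then have "norm (\<phi> f) \<le> r"
      using lin order_trans[OF norm_ge_zero r]
      by (intro norm_le_of_positive) (simp_all add: clinear_map_diff clinear_map_scaleR one clinear_map_def[of \<phi>])
    then show ?thesis by simp
  qed
  then show ?thesis
    using norm_le_twice_of_selfadjoint[OF lin, of 1] by simp
qed

text \<open>A finite e/3-net k of S puts \<open>convex hull S\<close> within e/3 of the compact set
  \<open>convex hull k\<close>. A finite e/3-net of the latter, and a last e/3 for the closure, give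
  balls of radius e.\<close>

lemma compact_closure_convex_hull:
  fixes S :: "'a::banach set"
  assumes "compact S"
  shows "compact (closure (convex hull S))"
  unfolding compact_eq_totally_bounded
proof (intro conjI allI impI)
  show "complete (closure (convex hull S))"
    by (simp add: complete_eq_closed)
  fix e :: real assume "e > 0"
  obtain k where k: "finite k" "k \<subseteq> S" "S \<subseteq> (\<Union>x\<in>k. ball x (e/3))"
    using seq_compact_imp_totally_bounded[of S, rule_format, of "e/3"] assms \<open>e > 0\<close>
    by (auto simp: compact_eq_seq_compact_metric)
  have "seq_compact (convex hull k)"
    using finite_imp_compact_convex_hull[OF k(1)] by (simp add: compact_eq_seq_compact_metric)
  then obtain l where l: "finite l" "convex hull k \<subseteq> (\<Union>x\<in>l. ball x (e/3))"
    using seq_compact_imp_totally_bounded[of "convex hull k", rule_format, of "e/3"] \<open>e > 0\<close> by auto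
  have hull: "convex hull S \<subseteq> (\<Union>x\<in>convex hull k. \<Union>y\<in>ball 0 (e/3). {x + y})"
  proof (rule hull_minimal)
    show "S \<subseteq> (\<Union>x\<in>convex hull k. \<Union>y\<in>ball 0 (e/3). {x + y})"
    proof
      fix s assume "s \<in> S"
      then obtain x where "x \<in> k" "dist x s < e/3"
        using k(3) by auto
      then have "x \<in> convex hull k" "s - x \<in> ball 0 (e/3)" "s = x + (s - x)"
        by (auto simp: hull_inc dist_norm norm_minus_commute)
      then show "s \<in> (\<Union>x\<in>convex hull k. \<Union>y\<in>ball 0 (e/3). {x + y})"
        by blast
    qed
    show "convex (\<Union>x\<in>convex hull k. \<Union>y\<in>ball 0 (e/3). {x + y})"
      by (intro convex_sums convex_convex_hull convex_ball)
  qed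
  have "closure (convex hull S) \<subseteq> (\<Union>x\<in>l. ball x e)"
  proof
    fix z assume "z \<in> closure (convex hull S)"
    then obtain y where "y \<in> convex hull S" "dist y z < e/3"
      using \<open>e > 0\<close> by (meson closure_approachable divide_pos_pos zero_less_numeral)
    then obtain x u where "x \<in> convex hull k" "norm u < e/3" "y = x + u"
      using hull by auto
    then obtain p where "p \<in> l" "dist p x < e/3"
      using l(2) by auto
    moreover have "dist x y < e/3"
      using \<open>norm u < e/3\<close> \<open>y = x + u\<close> by (simp add: dist_norm)
    ultimately have "dist p z < e"
      using \<open>dist y z < e/3\<close> dist_triangle[of p z x] dist_triangle[of x z y] by linarith
    then show "z \<in> (\<Union>x\<in>l. ball x e)"
      using \<open>p \<in> l\<close> by auto
  qed
  then show "\<exists>k. finite k \<and> closure (convex hull S) \<subseteq> (\<Union>x\<in>k. ball x e)"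
    using l(1) by blast
qed

text \<open>A selection argument: the times at which a given v is near enough form an open set, and
  a partition of unity subordinate to these sets averages the v inside V. The margin 1 / (1 + t)
  makes the admissible radius exceed the distance strictly, so that the sets cover the line, and it
  fades as t grows.\<close>

lemma continuous_near_best_approximation:
  fixes x :: "real \<Rightarrow> 'a::real_normed_vector"
  assumes x: "continuous_on {0..} x" and V: "convex V" "V \<noteq> {}"
  obtains y where "continuous_on {0..} y" "\<And>t. y t \<in> V"
    "\<And>t. 0 \<le> t \<Longrightarrow> norm (y t - x t) \<le> infdist (x t) V + 1 / (1 + t)"
proof -
  \<comment> \<open>Extends x to negative times by its value at 0, so that the partition of unity
    can live on the whole line.\<close>
  define z where "z t = x (max 0 t)" for t
  define r where "r t = infdist (z t) V + 1 / (1 + max 0 t)" for t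
  have z: "continuous_on UNIV z"
    unfolding z_def by (intro continuous_on_compose2[OF x] continuous_intros) auto
  have r: "continuous_on UNIV r"
    unfolding r_def by (intro continuous_intros z) (auto simp: max_def)
  define U where "U v = {t. dist (z t) v < r t}" for v
  have opU: "open (U v)" for v
    unfolding U_def by (intro open_Collect_less continuous_intros z r)
  have cover: "UNIV \<subseteq> \<Union>(U ` V)"
  proof
    fix t :: real
    have "infdist (z t) V < r t"
      by (simp add: r_def add_pos_nonneg)
    then obtain v where "v \<in> V" "dist (z t) v < r t"
      using V(2) by (auto simp: infdist_def cINF_less_iff)
    then show "t \<in> \<Union>(U ` V)"
      by (auto simp: U_def)
  qed
  obtain C where C: "UNIV \<subseteq> \<Union>C" "\<And>W. W \<in> C \<Longrightarrow> open W \<and> (\<exists>T. T \<in> U ` V \<and> W \<subseteq> T)"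
    "\<And>t. t \<in> UNIV \<Longrightarrow> \<exists>N. open N \<and> t \<in> N \<and> finite {W. W \<in> C \<and> W \<inter> N \<noteq> {}}"
    using paracompact[OF cover] opU by blast
  have opC: "open W" if "W \<in> C" for W
    using C(2)[OF that] by blast
  obtain F :: "real set \<Rightarrow> real \<Rightarrow> real" where F: "\<And>W. W \<in> C \<Longrightarrow> continuous_on UNIV (F W) \<and> (\<forall>t\<in>UNIV. 0 \<le> F W t)"
    "\<And>t W. W \<in> C \<Longrightarrow> t \<in> UNIV \<Longrightarrow> t \<notin> W \<Longrightarrow> F W t = 0"
    "\<And>t. t \<in> UNIV \<Longrightarrow> supp_sum (\<lambda>W. F W t) C = 1"
    "\<And>t. t \<in> UNIV \<Longrightarrow> \<exists>N. open N \<and> t \<in> N \<and> finite {W \<in> C. \<exists>s\<in>N. F W s \<noteq> 0}"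
    by (rule subordinate_partition_of_unity[OF C(1) opC C(3)]) blast+
  have "\<forall>W\<in>C. \<exists>v. v \<in> V \<and> W \<subseteq> U v"
    using C(2) by blast
  then obtain v where v: "\<And>W. W \<in> C \<Longrightarrow> v W \<in> V" "\<And>W. W \<in> C \<Longrightarrow> W \<subseteq> U (v W)"
    by metis
  define Ct where "Ct t = {W \<in> C. F W t \<noteq> 0}" for t
  have fin: "finite (Ct t)" for t
  proof -
    obtain N where N: "t \<in> N" "finite {W \<in> C. \<exists>s\<in>N. F W s \<noteq> 0}"
      using F(4)[of t] by blast
    show ?thesis
      by (rule finite_subset[OF _ N(2)]) (use N(1) in \<open>auto simp: Ct_def\<close>)
  qed
  have sum1: "(\<Sum>W\<in>Ct t. F W t) = 1" for t
    using F(3)[of t] by (simp add: supp_sum_def support_on_def Ct_def)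
  define y where "y t = (\<Sum>W\<in>Ct t. F W t *\<^sub>R v W)" for t
  show ?thesis
  proof
    show "y t \<in> V" for t
      unfolding y_def using F(1) v by (intro convex_sum fin V sum1) (auto simp: Ct_def)
    fix t :: real assume "t \<ge> 0"
    have "y t - x t = (\<Sum>W\<in>Ct t. F W t *\<^sub>R (v W - x t))"
      by (simp add: y_def scaleR_diff_right sum_subtractf scaleR_sum_left[symmetric] sum1)
    also have "norm \<dots> \<le> (\<Sum>W\<in>Ct t. F W t * r t)"
    proof (rule sum_norm_le)
      fix W assume W: "W \<in> Ct t"
      then have "t \<in> U (v W)"
        using F(2)[of W t] v(2)[of W] by (auto simp: Ct_def)
      then have "norm (v W - x t) \<le> r t"
        using \<open>t \<ge> 0\<close> by (simp add: U_def z_def dist_norm norm_minus_commute)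
      moreover have "0 \<le> F W t"
        using W F(1) by (auto simp: Ct_def)
      ultimately show "norm (F W t *\<^sub>R (v W - x t)) \<le> F W t * r t"
        by (simp add: mult_left_mono)
    qed
    also have "\<dots> = r t"
      by (simp add: sum_distrib_right[symmetric] sum1)
    finally show "norm (y t - x t) \<le> infdist (x t) V + 1 / (1 + t)"
      using \<open>t \<ge> 0\<close> by (simp add: r_def z_def)
  next
    have "isCont y t" for t
    proof -
      \<comment> \<open>\<open>Ct s\<close> varies with s, but near t all of these sets lie in one
        finite set of indices.\<close>
      obtain N where N: "open N" "t \<in> N" and fN: "finite {W \<in> C. \<exists>s\<in>N. F W s \<noteq> 0}"
        using F(4)[of t] by blast
      have "continuous_on N (\<lambda>s. \<Sum>W\<in>{W \<in> C. \<exists>s\<in>N. F W s \<noteq> 0}. F W s *\<^sub>R v W)"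
        using F(1) by (intro continuous_intros) (auto intro: continuous_on_subset)
      also have "?this \<longleftrightarrow> continuous_on N y"
      proof (rule continuous_on_cong[OF refl])
        fix s assume "s \<in> N"
        then show "(\<Sum>W\<in>{W \<in> C. \<exists>s\<in>N. F W s \<noteq> 0}. F W s *\<^sub>R v W) = y s"
          unfolding y_def by (intro sum.mono_neutral_right fN) (auto simp: Ct_def)
      qed
      finally show ?thesis
        using N continuous_on_eq_continuous_at by blast
    qed
    then show "continuous_on {0..} y"
      by (simp add: continuous_at_imp_continuous_on)
  qed
qed

section \<open>Actions of compact groups\<close>

context
  fixes \<alpha> :: "'g::topological_group_add \<Rightarrow> 'a::{cstar_algebra, real_normed_algebra_1} \<Rightarrow> 'a"
  assumes action: "continuous_action \<alpha>"
begin

lemma clinear_map_action: "clinear_map (\<alpha> g)"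
  using action by (simp add: continuous_action_def star_automorphism_def)

lemma action_mult: "\<alpha> g (x * y) = \<alpha> g x * \<alpha> g y"
  using action by (simp add: continuous_action_def star_automorphism_def)

lemma action_adj: "\<alpha> g (adj x) = adj (\<alpha> g x)"
  using action by (simp add: continuous_action_def star_automorphism_def)

lemma action_plus: "\<alpha> (g + h) x = \<alpha> g (\<alpha> h x)"
  using action by (simp add: continuous_action_def)

lemma continuous_on_action: "continuous_on S (\<lambda>g. \<alpha> g x)"
proof -
  have "continuous_on UNIV (\<lambda>g. \<alpha> g x)"
    using action by (simp add: continuous_action_def)
  then show ?thesis
    by (rule continuous_on_subset) simp
qed

lemma bij_action: "bij (\<alpha> g)"
  using action by (simp add: continuous_action_def star_automorphism_def)

lemma action_one: "\<alpha> g 1 = 1"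
proof -
  obtain e where "\<alpha> g e = 1"
    using bij_action[of g] by (metis bij_pointE)
  then show ?thesis
    using action_mult[of g e 1] by simp
qed

lemma action_zero: "\<alpha> 0 x = x"
  using action_plus[of 0 0 x] bij_action[of 0] by (simp add: bij_def inj_eq)

lemma norm_action: "norm (\<alpha> g x) = norm x"
proof (rule antisym)
  have le: "norm (\<alpha> h y) \<le> norm y" for h y
    by (rule norm_star_hom_le[OF clinear_map_action action_mult action_adj action_one])
  show "norm (\<alpha> g x) \<le> norm x" by (rule le)
  show "norm x \<le> norm (\<alpha> g x)"
    using le[of "- g" "\<alpha> g x"] by (simp add: action_zero flip: action_plus)
qed

lemma bounded_linear_action: "bounded_linear (\<alpha> g)"
  by (rule bounded_linear_intro[where K = 1])
    (use clinear_map_action[of g] in \<open>auto simp: clinear_map_def clinear_map_scaleR norm_action\<close>)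

lemma convex_fixed_points: "convex (fixed_points \<alpha>)"
  using clinear_map_action by (auto simp: fixed_points_def convex_def clinear_map_scaleR clinear_map_def)

text \<open>On the compact convex hull of the orbit of \<open>x\<close> the displacement \<open>y \<mapsto> sup\<^sub>g \<parallel>\<alpha>\<^sub>g(y) - y\<parallel>\<close> attains
  its minimum. Averaging \<open>y\<close> over a finite net of its orbit strictly decreases a positive displacement,
  so the minimiser is a fixed point. This replaces integration over the group.\<close>

lemma fixed_point_near:
  assumes G: "compact (UNIV :: 'g set)" and D: "\<And>g. norm (\<alpha> g x - x) \<le> D"
  obtains p where "p \<in> fixed_points \<alpha>" "norm (p - x) \<le> D"
proof -
  define K where "K = closure (convex hull (range (\<lambda>g. \<alpha> g x)))"
  have orbit: "compact (range (\<lambda>g. \<alpha> g y))" for y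
    by (rule compact_continuous_image[OF continuous_on_action G])
  have "compact K"
    unfolding K_def by (rule compact_closure_convex_hull[OF orbit])
  have "convex K" "closed K"
    by (auto simp: K_def convex_closure)
  have orbit_K: "\<alpha> g x \<in> K" for g
    unfolding K_def by (meson closure_subset hull_subset range_eqI subsetD)
  then have "x \<in> K"
    by (metis action_zero)
  have invariant: "\<alpha> g y \<in> K" if "y \<in> K" for g y
  proof -
    have "K \<subseteq> \<alpha> g -` K"
      unfolding K_def
    proof (intro closure_minimal hull_minimal)
      show "range (\<lambda>g. \<alpha> g x) \<subseteq> \<alpha> g -` closure (convex hull range (\<lambda>g. \<alpha> g x))"
        using orbit_K by (auto simp: K_def simp flip: action_plus)
      show "convex (\<alpha> g -` closure (convex hull range (\<lambda>g. \<alpha> g x)))"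
        by (intro convex_linear_vimage bounded_linear.linear[OF bounded_linear_action] convex_closure
            convex_convex_hull)
      show "closed (\<alpha> g -` closure (convex hull range (\<lambda>g. \<alpha> g x)))"
        by (intro closed_vimage closed_closure linear_continuous_on bounded_linear_action)
    qed
    then show ?thesis using that by auto
  qed
  \<comment> \<open>The orbit of x lies in this ball, which is closed and convex; so any fixed point
    found in K is close enough to x.\<close>
  have near: "K \<subseteq> cball x D"
    unfolding K_def using D
    by (intro closure_minimal hull_minimal) (auto simp: dist_norm norm_minus_commute)
  define d where "d y = (SUP g. norm (\<alpha> g y - y))" for y
  have bdd: "bdd_above (range (\<lambda>g. norm (\<alpha> g y - y)))" for y
    by (rule bdd_aboveI2[where M = "norm y + norm y"])
      (metis norm_action norm_triangle_ineq4)
  have d_upper: "norm (\<alpha> g y - y) \<le> d y" for g y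
    unfolding d_def by (rule cSUP_upper[OF UNIV_I bdd])
  have d_lip: "d y \<le> d z + 2 * norm (y - z)" for y z
    unfolding d_def
  proof (rule cSUP_least)
    fix g
    have "\<alpha> g y - y = (\<alpha> g z - z) + (\<alpha> g (y - z) - (y - z))"
      by (simp add: clinear_map_diff[OF clinear_map_action])
    then have "norm (\<alpha> g y - y) \<le> norm (\<alpha> g z - z) + norm (\<alpha> g (y - z) - (y - z))"
      by (simp only: norm_triangle_ineq)
    also have "norm (\<alpha> g (y - z) - (y - z)) \<le> 2 * norm (y - z)"
      using norm_triangle_ineq4[of "\<alpha> g (y - z)" "y - z"] by (simp add: norm_action)
    finally show "norm (\<alpha> g y - y) \<le> (SUP g. norm (\<alpha> g z - z)) + 2 * norm (y - z)"
      using d_upper[of g z] by (simp add: d_def)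
  qed simp
  have "2-lipschitz_on K d"
  proof (rule lipschitz_onI)
    show "dist (d y) (d z) \<le> 2 * dist y z" for y z
      using d_lip[of y z] d_lip[of z y] by (simp add: dist_norm norm_minus_commute abs_le_iff)
  qed simp
  then have "continuous_on K d"
    by (rule lipschitz_on_continuous_on)
  then obtain y where y: "y \<in> K" and min: "\<And>z. z \<in> K \<Longrightarrow> d y \<le> d z"
    using continuous_attains_inf[OF \<open>compact K\<close>] \<open>x \<in> K\<close> by blast
  have "d y \<le> 0"
  proof (rule ccontr)
    assume "\<not> d y \<le> 0"
    \<comment> \<open>Every point of the orbit is within e of some net point. In the average over
      the net that summand is at most e = d y - e instead of d y, which lowers the bound by e /
      n.\<close>
    define e where "e = d y / 2"
    have "e > 0"
      using \<open>\<not> d y \<le> 0\<close> by (simp add: e_def)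
    obtain k where k: "finite k" "k \<subseteq> range (\<lambda>g. \<alpha> g y)" "range (\<lambda>g. \<alpha> g y) \<subseteq> (\<Union>x\<in>k. ball x e)"
      using seq_compact_imp_totally_bounded[of "range (\<lambda>g. \<alpha> g y)", rule_format, of e] orbit[of y] \<open>e > 0\<close>
      by (auto simp: compact_eq_seq_compact_metric)
    obtain I where I: "finite I" "k = (\<lambda>g. \<alpha> g y) ` I"
      using finite_subset_image[OF k(1,2)] by auto
    have "I \<noteq> {}"
      using k(3) I(2) by auto
    define n where "n = real (card I)"
    have "n > 0"
      using I(1) \<open>I \<noteq> {}\<close> by (simp add: n_def card_gt_0_iff)
    have avg: "(\<Sum>i\<in>I. (1 / n) *\<^sub>R w) = w" for w :: 'a
      unfolding scaleR_sum_left[symmetric] using \<open>n > 0\<close> by (simp add: n_def)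
    define z where "z = (\<Sum>i\<in>I. (1 / n) *\<^sub>R \<alpha> i y)"
    have "z \<in> K"
      unfolding z_def using \<open>n > 0\<close>
      by (intro convex_sum I(1) \<open>convex K\<close> invariant y) (auto simp: n_def)
    have z: "norm (\<alpha> h y - z) \<le> d y - e / n" for h
    proof -
      obtain j where "j \<in> I" "dist (\<alpha> j y) (\<alpha> h y) < e"
        using subsetD[OF k(3) rangeI[of _ h]] by (auto simp: I(2))
      then have j: "j \<in> I" "norm (\<alpha> h y - \<alpha> j y) < e"
        by (simp_all add: dist_norm norm_minus_commute)
      have le: "norm (\<alpha> h y - \<alpha> i y) \<le> d y" for i
      proof -
        have "\<alpha> h y - \<alpha> i y = \<alpha> i (\<alpha> (- i + h) y - y)"
          by (simp add: clinear_map_diff[OF clinear_map_action] flip: action_plus)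
        then show ?thesis
          using d_upper[of "- i + h" y] by (simp add: norm_action)
      qed
      have "\<alpha> h y - z = (\<Sum>i\<in>I. (1 / n) *\<^sub>R (\<alpha> h y - \<alpha> i y))"
        by (simp only: z_def scaleR_diff_right sum_subtractf avg)
      also have "norm \<dots> \<le> (\<Sum>i\<in>I. (1 / n) * norm (\<alpha> h y - \<alpha> i y))"
        using \<open>n > 0\<close> by (intro sum_norm_le) simp
      also have "\<dots> = (1 / n) * (norm (\<alpha> h y - \<alpha> j y) + (\<Sum>i\<in>I - {j}. norm (\<alpha> h y - \<alpha> i y)))"
        unfolding sum_distrib_left[symmetric] sum.remove[OF I(1) j(1)] ..
      also have "\<dots> \<le> (1 / n) * (e + (\<Sum>i\<in>I - {j}. d y))"
        using \<open>n > 0\<close> j(2) le by (intro mult_left_mono add_mono sum_mono) auto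
      also have "(\<Sum>i\<in>I - {j}. d y) = (n - 1) * d y"
        using I(1) j(1) \<open>I \<noteq> {}\<close> by (simp add: n_def of_nat_diff Suc_leI card_gt_0_iff)
      also have "(1 / n) * (e + (n - 1) * d y) = d y - e / n"
      proof -
        have "d y = 2 * e" by (simp add: e_def)
        then show ?thesis
          using \<open>n > 0\<close> by (simp add: field_simps)
      qed
      finally show ?thesis .
    qed
    have "d z \<le> d y - e / n"
      unfolding d_def[of z]
    proof (rule cSUP_least)
      fix g
      \<comment> \<open>\<alpha> g z is again an average of points of the orbit, and each of them is
        within d y - e / n of z.\<close>
      have "\<alpha> g z - z = (\<Sum>i\<in>I. (1 / n) *\<^sub>R (\<alpha> (g + i) y - z))"
        unfolding scaleR_diff_right sum_subtractf avg
        by (simp only: z_def clinear_map_sum[OF clinear_map_action]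
            clinear_map_scaleR[OF clinear_map_action] action_plus)
      also have "norm \<dots> \<le> (\<Sum>i\<in>I. (1 / n) * (d y - e / n))"
        using \<open>n > 0\<close> z by (intro sum_norm_le) (simp add: divide_right_mono)
      also have "\<dots> = d y - e / n"
        using \<open>n > 0\<close> by (simp add: n_def)
      finally show "norm (\<alpha> g z - z) \<le> d y - e / n" .
    qed simp
    moreover have "e / n > 0"
      using \<open>n > 0\<close> \<open>e > 0\<close> by simp
    ultimately show False
      using min[OF \<open>z \<in> K\<close>] by linarith
  qed
  then have "norm (\<alpha> g y - y) \<le> 0" for g
    using d_upper[of g y] by linarith
  then have "y \<in> fixed_points \<alpha>"
    by (simp add: fixed_points_def)
  moreover have "norm (y - x) \<le> D"
    using near y by (auto simp: dist_norm norm_minus_commute)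
  ultimately show ?thesis
    using that by blast
qed

end

section \<open>Uniformity over a compact group\<close>

lemma uniform_neighbourhood:
  fixes f :: "'g::topological_group_add \<Rightarrow>\<^sub>C 'b::real_normed_vector"
  assumes G: "compact (UNIV :: 'g set)" and "e > 0"
  obtains V where "open V" "0 \<in> V" "\<And>x y. - x + y \<in> V \<Longrightarrow> norm (f x - f y) \<le> e"
proof -
  \<comment> \<open>The tube lemma near v = 0 for the function f (x + v) of v and x gives uniform
    continuity with a neighbourhood of 0 in place of a metric on the group.\<close>
  have "continuous_on (UNIV \<times> UNIV) (\<lambda>p. f (snd p + fst p))"
    by (rule continuous_on_compose2[of UNIV f]) (auto intro!: continuous_intros)
  then obtain V where V: "0 \<in> V" "open V"
    "\<And>v x. v \<in> V \<Longrightarrow> dist (f (x + v)) (f (x + 0)) \<le> e"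
    by (rule continuous_on_prod_compactE[OF _ G UNIV_I \<open>e > 0\<close>, where ?x0.0 = 0]) auto
  show ?thesis
  proof (rule that[OF V(2,1)])
    fix x y assume "- x + y \<in> V"
    from V(3)[OF this, of x] show "norm (f x - f y) \<le> e"
      by (simp add: dist_norm norm_minus_commute flip: add.assoc)
  qed
qed

lemma continuous_on_Lt:
  fixes f :: "'g::topological_group_add \<Rightarrow>\<^sub>C 'b::metric_space"
  assumes G: "compact (UNIV :: 'g set)"
  shows "continuous_on UNIV (\<lambda>g. Lt g f)"
  unfolding continuous_on_def
proof (intro ballI tendstoI)
  fix g :: 'g and e :: real assume "e > 0"
  then have "e / 2 > 0" by simp
  have "continuous_on (UNIV \<times> UNIV) (\<lambda>p. f (- fst p + snd p))"
    by (rule continuous_on_compose2[of UNIV f]) (auto intro!: continuous_intros)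
  then obtain V where V: "g \<in> V" "open V"
    "\<And>v h. v \<in> V \<Longrightarrow> dist (f (- v + h)) (f (- g + h)) \<le> e / 2"
    by (rule continuous_on_prod_compactE[OF _ G UNIV_I \<open>e / 2 > 0\<close>, where ?x0.0 = g]) auto
  have "dist (Lt v f) (Lt g f) < e" if "v \<in> V" for v
  proof -
    have "dist (Lt v f) (Lt g f) \<le> e / 2"
      using V(3)[OF that] by (intro dist_bound) simp
    then show ?thesis using \<open>e > 0\<close> by simp
  qed
  then show "\<forall>\<^sub>F v in at g. dist (Lt v f) (Lt g f) < e"
    using V(1,2) by (auto simp: eventually_at_topological)
qed

text \<open>The pair of f and a has a compact orbit, so one finite net serves both. It reduces
  estimates uniform in g to finitely many i.\<close>

lemma orbit_net:
  fixes \<alpha> :: "'g::topological_group_add \<Rightarrow> 'a::{cstar_algebra, real_normed_algebra_1} \<Rightarrow> 'a"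
    and f :: "'g \<Rightarrow>\<^sub>C complex"
  assumes G: "compact (UNIV :: 'g set)" and action: "continuous_action \<alpha>" and "e > 0"
  obtains I where "finite I"
    "\<And>g. \<exists>i\<in>I. norm (Lt g f - Lt i f) \<le> e \<and> norm (\<alpha> g a - \<alpha> i a) \<le> e"
proof -
  define p where "p g = (Lt g f, \<alpha> g a)" for g
  have "continuous_on UNIV p"
    unfolding p_def by (intro continuous_intros continuous_on_Lt[OF G] continuous_on_action[OF action])
  then have "seq_compact (range p)"
    using compact_continuous_image G compact_eq_seq_compact_metric by blast
  then obtain k where k: "finite k" "k \<subseteq> range p" "range p \<subseteq> (\<Union>x\<in>k. ball x e)"
    using seq_compact_imp_totally_bounded[of "range p", rule_format, OF _ \<open>e > 0\<close>] by auto
  obtain I where I: "finite I" "k = p ` I"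
    using finite_subset_image[OF k(1,2)] by auto
  show ?thesis
  proof (rule that[OF I(1)])
    fix g
    obtain i where "i \<in> I" "dist (p i) (p g) < e"
      using subsetD[OF k(3) rangeI[of p g]] by (auto simp: I(2))
    moreover have "dist (Lt i f) (Lt g f) \<le> dist (p i) (p g)" "dist (\<alpha> i a) (\<alpha> g a) \<le> dist (p i) (p g)"
      using dist_fst_le[of "p i" "p g"] dist_snd_le[of "p i" "p g"] unfolding p_def by simp_all
    ultimately have "dist (Lt g f) (Lt i f) \<le> e \<and> dist (\<alpha> g a) (\<alpha> i a) \<le> e"
      unfolding dist_commute[of "Lt g f"] dist_commute[of "\<alpha> g a"] by linarith
    then show "\<exists>i\<in>I. norm (Lt g f - Lt i f) \<le> e \<and> norm (\<alpha> g a - \<alpha> i a) \<le> e"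
      using \<open>i \<in> I\<close> unfolding dist_norm by blast
  qed
qed

text \<open>Translates of one Urysohn function, equal to 1 at 0 and vanishing off V, are divided by
  their sum. The square roots are taken because q x is to stand on both sides of F(x).\<close>

lemma square_partition_of_unity:
  fixes V :: "'g::{topological_group_add, t2_space} set"
  assumes G: "compact (UNIV :: 'g set)" and V: "open V" "0 \<in> V"
  obtains I and q :: "'g \<Rightarrow> 'g \<Rightarrow>\<^sub>C complex"
  where "finite I" "\<And>x. adj (q x) = q x" "(\<Sum>x\<in>I. q x * q x) = 1"
    "\<And>x y. q x y \<noteq> 0 \<Longrightarrow> - x + y \<in> V"
proof -
  have "Hausdorff_space (euclidean :: 'g topology)"
    using hausdorff by (fastforce simp: Hausdorff_space_def disjnt_def)
  then have "normal_space (euclidean :: 'g topology)"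
    using G by (intro compact_Hausdorff_or_regular_imp_normal_space) (auto simp: compact_space_def)
  then obtain u :: "'g \<Rightarrow> real" where u: "continuous_map euclidean (top_of_set {0..1}) u"
    "u ` (- V) \<subseteq> {0}" "u ` {0} \<subseteq> {1}"
    by (rule Urysohn_lemma[where S = "- V" and T = "{0}" and a = 0 and b = 1])
      (use V in \<open>auto simp: disjnt_def\<close>)
  have cont_u: "continuous_on UNIV u" and u_nonneg: "0 \<le> u y" for y
    using u(1) by (auto simp: continuous_map_in_subtopology image_subset_iff)
  have cont: "continuous_on UNIV (\<lambda>y. u (- x + y))" for x
    by (rule continuous_on_compose2[OF cont_u]) (auto intro!: continuous_intros)
  have "open {y. 0 < u (- x + y)}" for x
    by (intro open_Collect_less continuous_intros cont)
  moreover have "UNIV \<subseteq> (\<Union>x\<in>UNIV. {y. 0 < u (- x + y)})"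
  proof
    fix y :: 'g
    have "0 < u (- y + y)" using u(3) by simp
    then show "y \<in> (\<Union>x\<in>UNIV. {y. 0 < u (- x + y)})" by blast
  qed
  ultimately obtain I where I: "finite I" "UNIV \<subseteq> (\<Union>x\<in>I. {y. 0 < u (- x + y)})"
    using compactE_image[OF G, of UNIV "\<lambda>x. {y. 0 < u (- x + y)}"] by (metis (no_types, lifting))
  define s where "s y = (\<Sum>x\<in>I. u (- x + y))" for y
  have s_pos: "0 < s y" for y
  proof -
    obtain x where "x \<in> I" "0 < u (- x + y)"
      using I(2) by auto
    then show ?thesis
      unfolding s_def using I(1) u_nonneg by (meson sum_pos2)
  qed
  have cont_s: "continuous_on UNIV s"
    unfolding s_def by (intro continuous_on_sum cont)
  define r where "r x y = complex_of_real (sqrt (u (- x + y) / s y))" for x y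
  define q where "q x = Bcontfun (r x)" for x
  have q: "q x y = r x y" for x y
  proof -
    have "continuous_on UNIV (r x)"
      unfolding r_def by (intro continuous_on_of_real continuous_on_real_sqrt continuous_on_divide cont cont_s)
        (use s_pos in \<open>auto simp: less_le\<close>)
    then show ?thesis
      by (simp add: q_def apply_Bcontfun[OF G])
  qed
  show ?thesis
  proof (rule that[OF I(1), of q])
    show "adj (q x) = q x" for x
      by (rule bcontfun_eqI) (simp add: q r_def adj_complex_def)
    show "(\<Sum>x\<in>I. q x * q x) = 1"
    proof (rule bcontfun_eqI)
      fix y
      have "r x y * r x y = complex_of_real (u (- x + y) / s y)" for x
        using u_nonneg s_pos[of y] by (simp add: r_def less_imp_le flip: of_real_mult)
      then have "(\<Sum>x\<in>I. r x y * r x y) = complex_of_real ((\<Sum>x\<in>I. u (- x + y)) / s y)"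
        by (simp add: sum_divide_distrib)
      then show "apply_bcontfun (\<Sum>x\<in>I. q x * q x) y = apply_bcontfun 1 y"
        using s_pos[of y] by (simp add: apply_bcontfun_sum q flip: s_def)
    qed
    show "- x + y \<in> V" if "q x y \<noteq> 0" for x y
      using that u(2) by (auto simp: q r_def)
  qed
qed

section \<open>Extending completely positive maps from \<open>C(G)\<close> to \<open>C(G) \<otimes> A\<close>\<close>

lemma completely_positive_evaluation:
  "completely_positive (\<lambda>F :: 'g::topological_space \<Rightarrow>\<^sub>C 'a::pre_cstar_algebra. F x)"
  by (rule completely_positive_star_hom) (auto simp: clinear_map_def)

text \<open>At each y the squares are nonnegative weights of total 1, and only values c i within
  \<delta> of f y receive a nonzero weight.\<close>

lemma norm_sum_square_partition:
  fixes f :: "'g::topological_space \<Rightarrow>\<^sub>C complex" and q :: "'i \<Rightarrow> 'g \<Rightarrow>\<^sub>C complex"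
  assumes q: "\<And>i. adj (q i) = q i" "(\<Sum>i\<in>I. q i * q i) = 1"
    and near: "\<And>i y. i \<in> I \<Longrightarrow> q i y \<noteq> 0 \<Longrightarrow> norm (c i - f y) \<le> \<delta>"
  shows "norm ((\<Sum>i\<in>I. c i *\<^sub>C (q i * q i)) - f) \<le> \<delta>"
proof (rule norm_bound)
  fix y
  have real: "q i y = complex_of_real (Re (q i y))" for i
    using arg_cong[OF q(1), of "\<lambda>f. apply_bcontfun f y"] by (simp add: adj_complex_def complex_eq_iff)
  have sq: "norm (q i y * q i y) = Re (q i y * q i y)" for i
    by (subst (1 2 3 4) real) (simp add: norm_mult)
  have one: "(\<Sum>i\<in>I. q i y * q i y) = 1"
    using arg_cong[OF q(2), of "\<lambda>f. apply_bcontfun f y"] by (simp add: apply_bcontfun_sum)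
  have "apply_bcontfun ((\<Sum>i\<in>I. c i *\<^sub>C (q i * q i)) - f) y
      = (\<Sum>i\<in>I. c i * (q i y * q i y)) - f y * (\<Sum>i\<in>I. q i y * q i y)"
    unfolding one by (simp add: apply_bcontfun_sum scaleC_complex_def)
  also have "\<dots> = (\<Sum>i\<in>I. (c i - f y) * (q i y * q i y))"
    by (simp add: sum_distrib_left left_diff_distrib sum_subtractf)
  also have "norm \<dots> \<le> (\<Sum>i\<in>I. \<delta> * norm (q i y * q i y))"
  proof (rule sum_norm_le)
    fix i assume "i \<in> I"
    show "norm ((c i - f y) * (q i y * q i y)) \<le> \<delta> * norm (q i y * q i y)"
      using near[OF \<open>i \<in> I\<close>, of y]
      by (cases "q i y = 0") (auto simp: norm_mult intro!: mult_right_mono)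
  qed
  also have "\<dots> = \<delta> * Re (\<Sum>i\<in>I. q i y * q i y)"
    by (simp add: sq sum_distrib_left)
  finally show "norm (apply_bcontfun ((\<Sum>i\<in>I. c i *\<^sub>C (q i * q i)) - f) y) \<le> \<delta>"
    by (simp add: one)
qed

lemma asymptotically_unital_completely_positive:
  assumes "asymp_unital \<Phi>" "asymp_completely_positive \<Phi>"
  obtains t0 where "t0 \<ge> 0" "\<And>t. t \<ge> t0 \<Longrightarrow> completely_positive (\<Phi> t)" "\<And>t. t \<ge> t0 \<Longrightarrow> \<Phi> t 1 = 1"
proof -
  obtain r s where "r \<ge> 0" "\<forall>t\<ge>r. \<Phi> t 1 = 1" "s \<ge> 0" "\<forall>t\<ge>s. completely_positive (\<Phi> t)"
    using assms by (auto simp: asymp_unital_def asymp_completely_positive_def)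
  then show ?thesis
    using that[of "max r s"] by auto
qed

text \<open>The candidate \<open>F \<mapsto> \<Sum>\<^sub>i \<Phi>\<^sub>t(q\<^sub>i)\<^sup>* F(x\<^sub>i) \<Phi>\<^sub>t(q\<^sub>i)\<close> is completely positive but maps \<open>1\<close> only to some
  \<open>S\<close> close to \<open>1\<close>; rescaling to \<open>\<parallel>S\<parallel> = 1\<close> and adding \<open>F \<mapsto> w F(0) w\<close> with \<open>w\<^sup>2 = 1 - S\<close> makes it
  unital.\<close>

lemma local_unital_completely_positive_extension:
  fixes \<Phi> :: "real \<Rightarrow> ('g::{topological_group_add, t2_space} \<Rightarrow>\<^sub>C complex) \<Rightarrow>
    'a::{cstar_algebra, real_normed_algebra_1}"
  assumes G: "compact (UNIV :: 'g set)"
    and \<Phi>: "asymptotic_morphism UNIV \<Phi>" "asymp_unital \<Phi>" "asymp_completely_positive \<Phi>" "asymp_central \<Phi>"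
    and V: "open V" "0 \<in> V" and K: "finite K" and "\<eta> > 0"
  obtains U T where "0 \<le> T" "\<And>F. continuous_on {T..} (\<lambda>t. U t F)"
    "\<And>t. T \<le> t \<Longrightarrow> completely_positive (U t)" "\<And>t. T \<le> t \<Longrightarrow> U t 1 = 1"
    "\<And>t F. T \<le> t \<Longrightarrow> norm (U t F) \<le> 2 * norm F"
    "\<And>t a f \<delta>. T \<le> t \<Longrightarrow> a \<in> K \<Longrightarrow>
      (\<And>x y. - x + y \<in> V \<Longrightarrow> norm (apply_bcontfun f x - apply_bcontfun f y) \<le> \<delta>) \<Longrightarrow>
      norm (U t (f \<otimes> a) - \<Phi> t f * a) \<le> 2 * \<delta> * norm a + \<eta> * norm f"
proof -
  obtain t0 where t0: "t0 \<ge> 0" and cp\<Phi>: "\<And>t. t \<ge> t0 \<Longrightarrow> completely_positive (\<Phi> t)"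
    and one\<Phi>: "\<And>t. t \<ge> t0 \<Longrightarrow> \<Phi> t 1 = 1"
    using asymptotically_unital_completely_positive[OF \<Phi>(2,3)] by blast
  have lin\<Phi>: "clinear_map (\<Phi> t)" if "t \<ge> t0" for t
    using cp\<Phi>[OF that] by (simp add: completely_positive_def)
  have norm\<Phi>: "norm (\<Phi> t f) \<le> 2 * norm f" if "t \<ge> t0" for t f
    by (rule norm_unital_completely_positive_le[OF cp\<Phi>[OF that] one\<Phi>[OF that]])
  obtain I and q :: "'g \<Rightarrow> 'g \<Rightarrow>\<^sub>C complex" where I: "finite I" and q: "\<And>x :: 'g. adj (q x) = q x" "(\<Sum>x\<in>I. q x * q x) = 1"
    and supp: "\<And>x y. q x y \<noteq> 0 \<Longrightarrow> - x + y \<in> V"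
    by (rule square_partition_of_unity[OF G V]) blast
  define y where "y t x = \<Phi> t (q x)" for t x
  define E where "E t x a = norm (adj (y t x) * a * y t x - \<Phi> t (q x * q x) * a)" for t x a
  have E_tendsto: "((\<lambda>t. E t x a) \<longlongrightarrow> 0) at_top" for x a
  proof (rule tendsto_sandwich[of "\<lambda>_. 0"])
    \<comment> \<open>The three summands account for the defects of \<Phi> in adjoints, in commuting
      with a, and in multiplicativity.\<close>
    define b where "b t = norm (\<Phi> t (adj (q x)) - adj (\<Phi> t (q x))) * norm a * (2 * norm (q x))
        + 2 * norm (q x) * norm (\<Phi> t (q x) * a - a * \<Phi> t (q x))
        + norm (\<Phi> t (q x * q x) - \<Phi> t (q x) * \<Phi> t (q x)) * norm a" for t
    have "(b \<longlongrightarrow> 0 * norm a * (2 * norm (q x)) + 2 * norm (q x) * 0 + 0 * norm a) at_top"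
      unfolding b_def using \<Phi>(1,4)
      by (intro tendsto_intros) (auto simp: asymptotic_morphism_def asymp_central_def)
    then show "(b \<longlongrightarrow> 0) at_top" by simp
    show "\<forall>\<^sub>F t in at_top. E t x a \<le> b t"
      using eventually_ge_at_top[of t0]
    proof eventually_elim
      case (elim t)
      have "adj (y t x) * a * y t x - \<Phi> t (q x * q x) * a
          = - ((\<Phi> t (adj (q x)) - adj (y t x)) * a * y t x)
            + - (y t x * (y t x * a - a * y t x)) + - ((\<Phi> t (q x * q x) - y t x * y t x) * a)"
        by (simp add: y_def q(1) algebra_simps)
      then have "E t x a \<le> norm ((\<Phi> t (adj (q x)) - adj (y t x)) * a * y t x)
          + norm (y t x * (y t x * a - a * y t x)) + norm ((\<Phi> t (q x * q x) - y t x * y t x) * a)"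
        unfolding E_def by (metis (no_types, lifting) norm_minus_cancel norm_triangle_le norm_triangle_ineq order_refl add_mono)
      also have "\<dots> \<le> b t"
        unfolding b_def y_def
        by (intro add_mono order_trans[OF norm_mult_ineq] mult_mono norm_mult_ineq norm\<Phi> elim) auto
      finally show ?case .
    qed
  qed (auto simp: E_def)
  define M where "M = Max (insert 0 (norm ` K))"
  have M: "norm a \<le> M" if "a \<in> K" for a
    unfolding M_def using that K by (intro Max_ge) auto
  have "M \<ge> 0"
    unfolding M_def using K by (intro Max_ge) auto
  \<comment> \<open>The bound 1/2 keeps \<open>s t\<close>, which is within \<epsilon> of 1, away
    from 0. The other one absorbs the total error \<epsilon> (4 norm a + 1) norm f of
    \<open>approx\<close>.\<close>
  define \<epsilon> where "\<epsilon> = min (1/2) (\<eta> / (4 * M + 1))"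
  have \<epsilon>: "\<epsilon> > 0" "\<epsilon> \<le> 1/2" "\<epsilon> * (4 * M + 1) \<le> \<eta>"
  proof -
    have pos: "4 * M + 1 > 0" using \<open>M \<ge> 0\<close> by simp
    have "\<epsilon> \<le> \<eta> / (4 * M + 1)" by (simp add: \<epsilon>_def)
    then show "\<epsilon> * (4 * M + 1) \<le> \<eta>" using pos by (simp only: pos_le_divide_eq)
    show "\<epsilon> > 0" using pos \<open>\<eta> > 0\<close> by (simp add: \<epsilon>_def)
    show "\<epsilon> \<le> 1/2" unfolding \<epsilon>_def by (rule min.cobounded1)
  qed
  \<comment> \<open>The element 1 joins K because the case a = 1 compares \<open>S t\<close> with
    \<Phi> t 1 = 1. The errors over I add up to at most \<epsilon>.\<close>
  have "\<forall>\<^sub>F t in at_top. \<forall>x\<in>I. \<forall>a\<in>insert 1 K. E t x a < \<epsilon> / (real (card I) + 1)"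
    unfolding eventually_ball_finite_distrib[OF I] eventually_ball_finite_distrib[OF finite.insertI[OF K]]
    using \<epsilon>(1) by (intro ballI order_tendstoD(2)[OF E_tendsto]) auto
  then obtain t1 where t1: "\<And>t x a. t \<ge> t1 \<Longrightarrow> x \<in> I \<Longrightarrow> a \<in> insert 1 K \<Longrightarrow> E t x a < \<epsilon> / (real (card I) + 1)"
    unfolding eventually_at_top_linorder by blast
  define T where "T = max t0 t1"
  have T: "t \<ge> t0" "t \<ge> t1" if "t \<ge> T" for t
    using that by (auto simp: T_def)

  have sum_E: "norm ((\<Sum>x\<in>I. c x *\<^sub>C (adj (y t x) * a * y t x)) - \<Phi> t (\<Sum>x\<in>I. c x *\<^sub>C (q x * q x)) * a) \<le> \<epsilon> * B"
    if t: "t \<ge> T" and a: "a \<in> insert 1 K" and B: "\<And>x. norm (c x) \<le> B" for t a c B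
  proof -
    have "B \<ge> 0" using order_trans[OF norm_ge_zero B[of 0]] .
    have "\<Phi> t (\<Sum>x\<in>I. c x *\<^sub>C (q x * q x)) = (\<Sum>x\<in>I. c x *\<^sub>C \<Phi> t (q x * q x))"
      using lin\<Phi>[OF T(1)[OF t]] by (simp add: clinear_map_sum) (simp add: clinear_map_def)
    then have "norm ((\<Sum>x\<in>I. c x *\<^sub>C (adj (y t x) * a * y t x)) - \<Phi> t (\<Sum>x\<in>I. c x *\<^sub>C (q x * q x)) * a)
        = norm (\<Sum>x\<in>I. c x *\<^sub>C (adj (y t x) * a * y t x - \<Phi> t (q x * q x) * a))"
      by (simp add: linear_diff[OF bounded_linear.linear[OF bounded_linear_scaleC_right]] sum_subtractf
          sum_distrib_right mult_scaleC_left)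
    also have "\<dots> \<le> (\<Sum>x\<in>I. B * (\<epsilon> / (real (card I) + 1)))"
    proof (rule sum_norm_le)
      fix x assume "x \<in> I"
      show "norm (c x *\<^sub>C (adj (y t x) * a * y t x - \<Phi> t (q x * q x) * a)) \<le> B * (\<epsilon> / (real (card I) + 1))"
        unfolding norm_scaleC using t1[OF T(2)[OF t] \<open>x \<in> I\<close> a] \<open>B \<ge> 0\<close>
        by (intro mult_mono B) (auto simp: E_def)
    qed
    also have "\<dots> = \<epsilon> * B * (real (card I) / (real (card I) + 1))"
      by simp
    also have "\<dots> \<le> \<epsilon> * B * 1"
      using \<epsilon>(1) \<open>B \<ge> 0\<close> by (intro mult_left_mono) auto
    finally show ?thesis by simp
  qed

  define L where "L t F = (\<Sum>x\<in>I. adj (y t x) * F x * y t x)" for t and F :: "'g \<Rightarrow>\<^sub>C 'a"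
  have cpL: "completely_positive (L t)" for t
    unfolding L_def by (intro completely_positive_sum I
        completely_positive_comp[OF completely_positive_conjugate completely_positive_evaluation])
  define S where "S t = (\<Sum>x\<in>I. adj (y t x) * y t x)" for t
  have adj_S: "adj (S t) = S t" for t
    by (simp add: S_def)
  define s where "s t = norm (S t)" for t
  have S1: "norm (S t - 1) \<le> \<epsilon>" if t: "t \<ge> T" for t
    using sum_E[OF t, of 1 "\<lambda>_. 1" 1] one\<Phi>[OF T(1)[OF t]] by (simp add: S_def q(2))
  have s1: "\<bar>s t - 1\<bar> \<le> \<epsilon>" if t: "t \<ge> T" for t
    using norm_triangle_ineq3[of "S t" 1] S1[OF t] by (simp add: s_def)
  have s_pos: "s t > 0" if t: "t \<ge> T" for t
    using s1[OF t] \<epsilon>(2) by linarith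
  \<comment> \<open>\<open>sqrt_series\<close> at an element of norm at most 1 is a root of 1 minus
    that element, hence the division of S by its norm. As 1 / 0 = 0, the bound \<open>norm_S\<close>
    holds for every t.\<close>
  define w where "w t = sqrt_series ((1 / s t) *\<^sub>R S t)" for t
  have norm_S: "norm ((1 / s t) *\<^sub>R S t) \<le> 1" for t
    by (simp add: s_def)
  have adj_w: "adj (w t) = w t" for t
    unfolding w_def by (rule adj_sqrt_series[OF norm_S]) (simp add: adj_S)
  have ww: "w t * w t = 1 - (1 / s t) *\<^sub>R S t" for t
    unfolding w_def by (rule sqrt_series_mult_self[OF norm_S])
  have norm_w: "norm (w t) * norm (w t) \<le> 2 * \<epsilon>" if t: "t \<ge> T" for t
  proof -
    have "norm (w t) * norm (w t) = norm (1 - (1 / s t) *\<^sub>R S t)"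
      using norm_square_selfadjoint[OF adj_w[of t]] by (simp add: ww power2_eq_square)
    also have "1 - (1 / s t) *\<^sub>R S t = (1 - S t) + ((s t - 1) / s t) *\<^sub>R S t"
      using s_pos[OF t] by (simp add: diff_divide_distrib scaleR_diff_left)
    also have "norm \<dots> \<le> norm (1 - S t) + norm (((s t - 1) / s t) *\<^sub>R S t)"
      by (rule norm_triangle_ineq)
    also have "norm (((s t - 1) / s t) *\<^sub>R S t) = \<bar>s t - 1\<bar>"
      using s_pos[OF t] by (simp add: s_def)
    finally show ?thesis
      using S1[OF t] s1[OF t] by (simp add: norm_minus_commute)
  qed
  define U where "U t F = (1 / s t) *\<^sub>R L t F + adj (w t) * F 0 * w t" for t and F :: "'g \<Rightarrow>\<^sub>C 'a"
  have cpU: "completely_positive (U t)" if t: "t \<ge> T" for t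
  proof -
    \<comment> \<open>Indexing by the booleans makes a two-term sum an instance of
      \<open>completely_positive_sum\<close>.\<close>
    have "completely_positive (\<lambda>F. \<Sum>b\<in>UNIV. if b then (1 / s t) *\<^sub>R L t F else adj (w t) * F 0 * w t)"
    proof (rule completely_positive_sum)
      fix b
      show "completely_positive (\<lambda>F. if b then (1 / s t) *\<^sub>R L t F else adj (w t) * F 0 * w t)"
        using completely_positive_scaleR[OF cpL[of t], of "1 / s t"] s_pos[OF t]
          completely_positive_comp[OF completely_positive_conjugate completely_positive_evaluation, of "w t"]
        by (cases b) simp_all
    qed simp
    then show ?thesis
      by (simp add: U_def[abs_def] UNIV_bool add.commute)
  qed
  have L1: "L t 1 = S t" for t
    by (simp add: L_def S_def)
  have U1: "U t 1 = 1" for t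
    by (simp add: U_def L1 adj_w ww)
  have linL: "clinear_map (L t)" for t
    using cpL by (simp add: completely_positive_def)
  have sa_eval: "adj (F x) = F x" if "adj F = F" for F :: "'g \<Rightarrow>\<^sub>C 'a" and x
    using arg_cong[OF that, of "\<lambda>F. apply_bcontfun F x"] by simp
  have norm_L: "norm (L t F) \<le> 2 * s t * norm F" for t F
  proof (rule norm_le_twice_of_selfadjoint[OF linL])
    fix F :: "'g \<Rightarrow>\<^sub>C 'a" and r
    assume F: "adj F = F" "norm F \<le> r"
    show "norm (L t F) \<le> s t * r"
      unfolding L_def s_def S_def mult.commute[of _ r] using sa_eval[OF F(1)] F(2)
      by (intro norm_sum_conjugate_selfadjoint order_trans[OF norm_bounded F(2)])
        (auto intro: order_trans[OF norm_ge_zero F(2)])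
  qed
  have norm_U: "norm (U t F) \<le> 2 * norm F" if t: "t \<ge> T" for t F
  proof -
    have linU: "clinear_map (U t)"
      using cpU[OF t] by (simp add: completely_positive_def)
    \<comment> \<open>By the explicit formula for U, positivity of all values of F suffices, so that
      positivity is only ever considered in A.\<close>
    have pos: "positive_elt (U t F)" if "\<And>x. positive_elt (F x)" for F :: "'g \<Rightarrow>\<^sub>C 'a"
      unfolding U_def L_def using s_pos[OF t]
      by (intro positive_add positive_scaleR positive_sum positive_conjugate that) simp
    have "norm (U t F) \<le> 1 * r" if F: "adj F = F" "norm F \<le> r" for F :: "'g \<Rightarrow>\<^sub>C 'a" and r
    proof -
      have "positive_elt (U t (r *\<^sub>R 1 + F))" "positive_elt (U t (r *\<^sub>R 1 - F))"
        using positive_norm_bound[OF sa_eval[OF F(1)] order_trans[OF norm_bounded F(2)]]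
        by (auto intro: pos)
      then show ?thesis
        using order_trans[OF norm_ge_zero F(2)]
        by (simp add: clinear_map_diff[OF linU] clinear_map_scaleR[OF linU] U1 norm_le_of_positive
            linU[unfolded clinear_map_def])
    qed
    then show ?thesis
      using norm_le_twice_of_selfadjoint[OF linU, of 1] by simp
  qed
  have approx: "norm (U t (f \<otimes> a) - \<Phi> t f * a) \<le> 2 * \<delta> * norm a + \<eta> * norm f"
    if t: "T \<le> t" and a: "a \<in> K" and \<delta>: "\<And>x y. - x + y \<in> V \<Longrightarrow> norm (f x - f y) \<le> \<delta>"
    for t a and f :: "'g \<Rightarrow>\<^sub>C complex" and \<delta>
  proof -
    define p where "p = (\<Sum>x\<in>I. f x *\<^sub>C (q x * q x))"
    have Lf: "L t (f \<otimes> a) = (\<Sum>x\<in>I. f x *\<^sub>C (adj (y t x) * a * y t x))"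
      by (simp add: L_def mult_scaleC_left mult_scaleC_right)
    have 1: "norm ((1 / s t - 1) *\<^sub>R L t (f \<otimes> a)) \<le> 2 * \<epsilon> * norm f * norm a"
    proof -
      have "norm ((1 / s t - 1) *\<^sub>R L t (f \<otimes> a)) \<le> \<bar>1 / s t - 1\<bar> * (2 * s t * (norm f * norm a))"
        using norm_L[of t "f \<otimes> a"] by (simp add: norm_elem_tensor mult_left_mono)
      also have "\<dots> = 2 * (norm f * norm a) * \<bar>s t - 1\<bar>"
      proof -
        have "\<bar>1 / s t - 1\<bar> * s t = \<bar>(1 / s t - 1) * s t\<bar>"
          using s_pos[OF t] by (simp add: abs_mult)
        also have "(1 / s t - 1) * s t = 1 - s t"
          using s_pos[OF t] by (simp add: field_simps)
        finally show ?thesis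
          by (simp add: abs_minus_commute mult_ac)
      qed
      also have "\<dots> \<le> 2 * (norm f * norm a) * \<epsilon>"
        using s1[OF t] by (intro mult_left_mono) auto
      finally show ?thesis by (simp add: mult_ac)
    qed
    have 2: "norm (L t (f \<otimes> a) - \<Phi> t p * a) \<le> \<epsilon> * norm f"
      unfolding Lf p_def by (rule sum_E[OF t]) (use a norm_bounded in auto)
    have "norm (p - f) \<le> \<delta>"
      unfolding p_def by (rule norm_sum_square_partition[OF q]) (rule \<delta>[OF supp])
    then have "norm (\<Phi> t (p - f) * a) \<le> 2 * \<delta> * norm a"
      using norm\<Phi>[OF T(1)[OF t], of "p - f"]
      by (intro order_trans[OF norm_mult_ineq] mult_right_mono) auto
    then have 3: "norm ((\<Phi> t p - \<Phi> t f) * a) \<le> 2 * \<delta> * norm a"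
      by (simp add: clinear_map_diff[OF lin\<Phi>[OF T(1)[OF t]]])
    have 4: "norm (w t * (f \<otimes> a) 0 * w t) \<le> 2 * \<epsilon> * norm f * norm a"
    proof -
      have "norm (w t * (f \<otimes> a) 0 * w t) \<le> norm (w t) * (norm f * norm a) * norm (w t)"
        using norm_bounded[of "f \<otimes> a" 0]
        by (intro order_trans[OF norm_mult_ineq] mult_right_mono mult_left_mono)
          (auto simp: norm_elem_tensor)
      also have "\<dots> = norm (w t) * norm (w t) * (norm f * norm a)"
        by (simp add: mult_ac)
      also have "\<dots> \<le> 2 * \<epsilon> * (norm f * norm a)"
        by (intro mult_right_mono norm_w t) simp
      finally show ?thesis by (simp add: mult_ac)
    qed
    \<comment> \<open>The four errors: the rescaling by s, the sandwich against
      \<open>\<Phi> t p\<close>, the replacement of p by f, and the correction w.\<close>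
    have "U t (f \<otimes> a) - \<Phi> t f * a = (1 / s t - 1) *\<^sub>R L t (f \<otimes> a) + (L t (f \<otimes> a) - \<Phi> t p * a)
        + (\<Phi> t p - \<Phi> t f) * a + w t * (f \<otimes> a) 0 * w t"
      by (simp add: U_def adj_w left_diff_distrib scaleR_diff_left)
    also have "norm \<dots> \<le> 2 * \<epsilon> * norm f * norm a + \<epsilon> * norm f + 2 * \<delta> * norm a + 2 * \<epsilon> * norm f * norm a"
      by (intro norm_triangle_le add_mono 1 2 3 4)
    also have "\<dots> = 2 * \<delta> * norm a + \<epsilon> * (4 * norm a + 1) * norm f"
      by (simp add: algebra_simps)
    also have "\<epsilon> * (4 * norm a + 1) * norm f \<le> \<epsilon> * (4 * M + 1) * norm f"
      using \<epsilon>(1) M[OF a] by (intro mult_right_mono mult_left_mono) auto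
    also have "\<dots> \<le> \<eta> * norm f"
      by (intro mult_right_mono \<epsilon>) simp
    finally show ?thesis by simp
  qed
  have "T \<ge> 0"
    using t0 by (simp add: T_def)
  have cont_y: "continuous_on {T..} (\<lambda>t. y t x)" for x
    using \<Phi>(1) \<open>T \<ge> 0\<close> unfolding y_def asymptotic_morphism_def
    by (auto intro: continuous_on_subset[where s = "{0..}"])
  have cont_S: "continuous_on {T..} S"
    unfolding S_def by (intro continuous_intros bounded_linear.continuous_on[OF bounded_linear_adj] cont_y)
  have cont_s: "continuous_on {T..} s"
    unfolding s_def by (intro continuous_intros cont_S)
  have s_nz: "\<forall>t\<in>{T..}. s t \<noteq> 0"
    using s_pos by force
  have cont_w: "continuous_on {T..} w"
    unfolding w_def
    by (rule continuous_on_compose2[OF continuous_on_sqrt_series])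
      (auto intro!: continuous_intros cont_S cont_s simp: s_nz norm_S[simplified])
  have "continuous_on {T..} (\<lambda>t. U t F)" for F
    unfolding U_def L_def
    by (intro continuous_intros bounded_linear.continuous_on[OF bounded_linear_adj] cont_y cont_s cont_w s_nz)
  with \<open>T \<ge> 0\<close> show ?thesis
    using that cpU U1 norm_U approx by blast
qed

section \<open>Gluing the local extensions along t\<close>

lemma locally_finite_weights:
  fixes T :: "nat \<Rightarrow> real"
  obtains w :: "nat \<Rightarrow> real \<Rightarrow> real"
  where "\<And>n. continuous_on UNIV (w n)" "\<And>n t. 0 \<le> w n t" "\<And>n t. w n t \<noteq> 0 \<Longrightarrow> T n \<le> t \<and> real n \<le> t"
    "\<And>m. \<forall>\<^sub>F t in at_top. \<forall>n<m. w n t = 0"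
    "\<forall>\<^sub>F t in at_top. \<forall>N. t \<le> real N \<longrightarrow> (\<Sum>n<N. w n t) = 1"
proof -
  \<comment> \<open>The times \<tau> n lie beyond T n and n and are at least 1 apart. The ramps h n,
    rising from 0 to 1 on [\<tau> n, \<tau> n + 1], therefore decrease in n, and their differences
    telescope to h 0 - h N, which is 1 for \<tau> 0 + 1 \<le> t \<le> N.\<close>
  define \<tau> where "\<tau> = rec_nat (max (T 0) 0) (\<lambda>n s. max (T (Suc n)) (s + 1))"
  have \<tau>_Suc: "\<tau> n + 1 \<le> \<tau> (Suc n)" for n
    by (simp add: \<tau>_def)
  have \<tau>_T: "T n \<le> \<tau> n" for n
    by (cases n) (simp_all add: \<tau>_def)
  have \<tau>_n: "real n \<le> \<tau> n" for n
  proof (induction n)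
    case (Suc n)
    then show ?case using \<tau>_Suc[of n] by simp
  qed (simp add: \<tau>_def)
  have \<tau>_mono: "m \<le> n \<Longrightarrow> \<tau> m \<le> \<tau> n" for m n
    by (rule lift_Suc_mono_le[of \<tau>]) (use \<tau>_Suc in \<open>smt (verit)\<close>)
  define h where "h n t = max 0 (min 1 (t - \<tau> n))" for n t
  define w where "w n t = h n t - h (Suc n) t" for n t
  have h_le: "h (Suc n) t \<le> h n t" for n t
    using \<tau>_Suc[of n] by (simp add: h_def)
  have w_zero: "w n t = 0" if "t \<le> \<tau> n \<or> \<tau> (Suc n) + 1 \<le> t" for n t
    using that \<tau>_Suc[of n] by (auto simp: w_def h_def)
  show ?thesis
  proof
    show "continuous_on UNIV (w n)" for n
      unfolding w_def h_def by (intro continuous_intros)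
    show "0 \<le> w n t" for n t
      using h_le by (simp add: w_def)
    show "T n \<le> t \<and> real n \<le> t" if "w n t \<noteq> 0" for n t
      using w_zero[of t n] that \<tau>_T[of n] \<tau>_n[of n] by linarith
    show "\<forall>\<^sub>F t in at_top. \<forall>n<m. w n t = 0" for m
      using eventually_ge_at_top[of "\<tau> m + 1"]
    proof eventually_elim
      case (elim t)
      show ?case
      proof (intro allI impI w_zero disjI2)
        fix n assume "n < m"
        then show "\<tau> (Suc n) + 1 \<le> t"
          using \<tau>_mono[of "Suc n" m] elim by simp
      qed
    qed
    show "\<forall>\<^sub>F t in at_top. \<forall>N. t \<le> real N \<longrightarrow> (\<Sum>n<N. w n t) = 1"
      using eventually_ge_at_top[of "\<tau> 0 + 1"]
    proof eventually_elim
      case (elim t)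
      show ?case
      proof (intro allI impI)
        fix N assume "t \<le> real N"
        have "(\<Sum>n<N. w n t) = h 0 t - h N t"
          unfolding w_def by (rule sum_lessThan_telescope')
        then show "(\<Sum>n<N. w n t) = 1"
          using elim \<open>t \<le> real N\<close> \<tau>_n[of N] by (simp add: h_def)
      qed
    qed
  qed
qed

text \<open>Stage n treats the first n + 1 members of a dense sequence in A, with the n-th
  neighbourhood of 0 and tolerance 1 / (n + 1), from a time T n on. The weights admit stage n only
  after T n and remove it later, so given f and a are eventually treated by fine stages
  alone.\<close>

lemma unital_completely_positive_extension:
  fixes \<Phi> :: "real \<Rightarrow> ('g::{topological_group_add, t2_space, second_countable_topology} \<Rightarrow>\<^sub>C complex) \<Rightarrow>
    'a::{cstar_algebra, real_normed_algebra_1}"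
  assumes G: "compact (UNIV :: 'g set)" and sep: "separable_space (euclidean :: 'a topology)"
    and \<Phi>: "asymptotic_morphism UNIV \<Phi>" "asymp_unital \<Phi>" "asymp_completely_positive \<Phi>" "asymp_central \<Phi>"
  obtains \<Upsilon> t0 where "0 \<le> t0" "\<And>F. continuous_on {0..} (\<lambda>t. \<Upsilon> t F)"
    "\<And>t. t0 \<le> t \<Longrightarrow> completely_positive (\<Upsilon> t)" "\<And>t. t0 \<le> t \<Longrightarrow> \<Upsilon> t 1 = 1"
    "\<And>t F. t0 \<le> t \<Longrightarrow> norm (\<Upsilon> t F) \<le> 2 * norm F"
    "\<And>f a. ((\<lambda>t. \<Upsilon> t (f \<otimes> a) - \<Phi> t f * a) \<longlongrightarrow> 0) at_top"
proof -
  obtain C :: "'a set" where C: "countable C" "closure C = UNIV"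
    using sep by (auto simp: separable_space_def)
  define d where "d = from_nat_into C"
  have d: "\<exists>k. norm (a - d k) < e" if e: "e > 0" for a e
  proof -
    have "a \<in> closure C" by (simp add: C(2))
    then obtain c where "c \<in> C" "dist c a < e"
      using e unfolding closure_approachable by blast
    moreover from from_nat_into_surj[OF C(1) \<open>c \<in> C\<close>] obtain k where "d k = c"
      unfolding d_def ..
    ultimately have "norm (a - d k) < e"
      by (simp add: dist_norm norm_minus_commute)
    then show ?thesis ..
  qed
  obtain V :: "nat \<Rightarrow> 'g set" where V: "\<And>n. open (V n)" "\<And>n. 0 \<in> V n"
    and V_basis: "\<And>S. open S \<Longrightarrow> 0 \<in> S \<Longrightarrow> \<forall>\<^sub>F n in sequentially. V n \<subseteq> S"
    using countable_basis_at_decseq[of "0 :: 'g"] by blast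
  have "\<exists>U T. 0 \<le> T \<and> (\<forall>F. continuous_on {T..} (\<lambda>t. U t F)) \<and>
      (\<forall>t\<ge>T. completely_positive (U t) \<and> U t 1 = 1 \<and> (\<forall>F. norm (U t F) \<le> 2 * norm F) \<and>
        (\<forall>k\<le>n. \<forall>f \<delta>. (\<forall>x y. - x + y \<in> V n \<longrightarrow> norm (apply_bcontfun f x - apply_bcontfun f y) \<le> \<delta>) \<longrightarrow>
          norm (U t (f \<otimes> d k) - \<Phi> t f * d k) \<le> 2 * \<delta> * norm (d k) + inverse (real (Suc n)) * norm f))" for n
  proof -
    have "finite (d ` {..n})" "inverse (real (Suc n)) > 0" by simp_all
    then obtain U T where UT: "0 \<le> T" "\<And>F. continuous_on {T..} (\<lambda>t. U t F)"
      "\<And>t. T \<le> t \<Longrightarrow> completely_positive (U t)" "\<And>t. T \<le> t \<Longrightarrow> U t 1 = 1"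
      "\<And>t F. T \<le> t \<Longrightarrow> norm (U t F) \<le> 2 * norm F"
      "\<And>t a f \<delta>. T \<le> t \<Longrightarrow> a \<in> d ` {..n} \<Longrightarrow>
        (\<And>x y. - x + y \<in> V n \<Longrightarrow> norm (apply_bcontfun f x - apply_bcontfun f y) \<le> \<delta>) \<Longrightarrow>
        norm (U t (f \<otimes> a) - \<Phi> t f * a) \<le> 2 * \<delta> * norm a + inverse (real (Suc n)) * norm f"
      by (rule local_unital_completely_positive_extension[OF G \<Phi> V(1)[of n] V(2)[of n]]) blast
    show ?thesis
      by (intro exI[of _ U] exI[of _ T] conjI allI impI UT) auto
  qed
  then obtain U and T :: "nat \<Rightarrow> real" where T: "\<And>n. 0 \<le> T n" and U: "\<And>n F. continuous_on {T n..} (\<lambda>t. U n t F)"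
    "\<And>n t. T n \<le> t \<Longrightarrow> completely_positive (U n t)" "\<And>n t. T n \<le> t \<Longrightarrow> U n t 1 = 1"
    "\<And>n t F. T n \<le> t \<Longrightarrow> norm (U n t F) \<le> 2 * norm F"
    and U_approx: "\<And>n t k f \<delta>. T n \<le> t \<Longrightarrow> k \<le> n \<Longrightarrow>
      (\<And>x y. - x + y \<in> V n \<Longrightarrow> norm (apply_bcontfun f x - apply_bcontfun f y) \<le> \<delta>) \<Longrightarrow>
      norm (U n t (f \<otimes> d k) - \<Phi> t f * d k) \<le> 2 * \<delta> * norm (d k) + inverse (real (Suc n)) * norm f"
    by metis
  obtain w :: "nat \<Rightarrow> real \<Rightarrow> real"
    where w: "\<And>n. continuous_on UNIV (w n)" "\<And>n t. 0 \<le> w n t"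
      and w_supp: "\<And>n t. w n t \<noteq> 0 \<Longrightarrow> T n \<le> t \<and> real n \<le> t"
      and w_late: "\<And>m. \<forall>\<^sub>F t in at_top. \<forall>n<m. w n t = 0"
      and w_sum: "\<forall>\<^sub>F t in at_top. \<forall>N. t \<le> real N \<longrightarrow> (\<Sum>n<N. w n t) = 1"
    by (rule locally_finite_weights[of T]) (rule that; assumption)
  obtain t0 where t0: "t0 \<ge> 0" and cp\<Phi>: "\<And>t. t \<ge> t0 \<Longrightarrow> completely_positive (\<Phi> t)"
    and one\<Phi>: "\<And>t. t \<ge> t0 \<Longrightarrow> \<Phi> t 1 = 1"
    using asymptotically_unital_completely_positive[OF \<Phi>(2,3)] by blast
  obtain t2 where t2: "\<And>t N. t \<ge> t2 \<Longrightarrow> t \<le> real N \<Longrightarrow> (\<Sum>n<N. w n t) = 1"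
    using w_sum unfolding eventually_at_top_linorder by blast
  define t1 where "t1 = max t0 t2"
  define W where "W t = {n. w n t \<noteq> 0}" for t
  have W_lt: "W t \<subseteq> {..<N}" if "t < real N" for t N
    using w_supp that by (force simp: W_def)
  have fin_W: "finite (W t)" for t
  proof -
    obtain N where "t < real N" using reals_Archimedean2 by blast
    from finite_subset[OF W_lt[OF this]] show ?thesis by simp
  qed
  have sum_W: "(\<Sum>n\<in>W t. w n t) = 1" if "t2 \<le> t" for t
  proof -
    obtain N where "t < real N" using reals_Archimedean2 by blast
    then have "(\<Sum>n\<in>W t. w n t) = (\<Sum>n<N. w n t)"
      by (intro sum.mono_neutral_left W_lt) (auto simp: W_def)
    then show ?thesis
      using t2[OF that, of N] \<open>t < real N\<close> by simp
  qed
  have max_T: "max t (T n) = t" if "n \<in> W t" for n t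
    using w_supp[of n t] that by (simp add: W_def)
  \<comment> \<open>Stage n is controlled only from T n on. The cut-off \<open>max t (T n)\<close>
    extends continuity and complete positivity to all t and changes nothing where the weight is
    nonzero.\<close>
  define \<Upsilon> where "\<Upsilon> t F = (\<Sum>n\<in>W t. w n t *\<^sub>R U n (max t (T n)) F)" for t F
  have bound: "norm (\<Upsilon> t F) \<le> 2 * norm F" if "t1 \<le> t" for t F
  proof -
    have "norm (\<Upsilon> t F) \<le> (\<Sum>n\<in>W t. w n t * (2 * norm F))"
      unfolding \<Upsilon>_def
    proof (rule sum_norm_le)
      fix n
      show "norm (w n t *\<^sub>R U n (max t (T n)) F) \<le> w n t * (2 * norm F)"
        using U(4)[of n "max t (T n)" F] w(2)[of n t] by (simp add: mult_left_mono)
    qed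
    then show ?thesis
      using sum_W[of t] that by (simp add: t1_def flip: sum_distrib_right)
  qed
  show ?thesis
  proof
    show "0 \<le> t1" using t0 by (simp add: t1_def)
  next
    fix F
    have "isCont (\<lambda>t. \<Upsilon> t F) t" for t
    proof -
      obtain N where N: "t < real N" using reals_Archimedean2 by blast
      have "continuous_on {..<real N} (\<lambda>s. U n (max s (T n)) F)" for n
        by (rule continuous_on_compose2[OF U(1)[of n F]]) (auto intro!: continuous_intros)
      then have "continuous_on {..<real N} (\<lambda>s. \<Sum>n<N. w n s *\<^sub>R U n (max s (T n)) F)"
        by (intro continuous_intros continuous_on_subset[OF w(1)]) auto
      also have "?this \<longleftrightarrow> continuous_on {..<real N} (\<lambda>t. \<Upsilon> t F)"
      proof (rule continuous_on_cong[OF refl])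
        fix s assume "s \<in> {..<real N}"
        then show "(\<Sum>n<N. w n s *\<^sub>R U n (max s (T n)) F) = \<Upsilon> s F"
          unfolding \<Upsilon>_def by (intro sum.mono_neutral_right W_lt) (auto simp: W_def)
      qed
      finally show ?thesis
        using N continuous_on_eq_continuous_at[of "{..<real N}" "\<lambda>t. \<Upsilon> t F"] by auto
    qed
    then show "continuous_on {0..} (\<lambda>t. \<Upsilon> t F)"
      by (simp add: continuous_at_imp_continuous_on)
  next
    fix t assume "t1 \<le> t"
    show "completely_positive (\<Upsilon> t)"
      unfolding \<Upsilon>_def by (intro completely_positive_sum completely_positive_scaleR fin_W U w) simp
    show "\<Upsilon> t 1 = 1"
      using sum_W[of t] \<open>t1 \<le> t\<close> by (simp add: \<Upsilon>_def U(3) t1_def flip: scaleR_sum_left)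
    show "norm (\<Upsilon> t F) \<le> 2 * norm F" for F
      by (rule bound[OF \<open>t1 \<le> t\<close>])
  next
    fix f :: "'g \<Rightarrow>\<^sub>C complex" and a :: 'a
    show "((\<lambda>t. \<Upsilon> t (f \<otimes> a) - \<Phi> t f * a) \<longlongrightarrow> 0) at_top"
    proof (rule tendstoI)
      fix e :: real assume "e > 0"
      define r where "r = norm f + 1"
      have r: "r > 0" "norm f \<le> r" by (simp_all add: r_def add_nonneg_pos)
      \<comment> \<open>Error budget: e/4 + e/8 for f \<otimes> d k, and e/8 each for replacing a by
        d k in \<Upsilon> and in \<Phi>. The 16 anticipates the factor 2 in their norm
        bounds.\<close>
      obtain k where k: "norm (a - d k) < e / (16 * r)"
        using d[of "e / (16 * r)" a] \<open>e > 0\<close> r by auto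
      have k': "norm f * norm (a - d k) \<le> e / 16"
      proof -
        have "norm f * norm (a - d k) \<le> r * (e / (16 * r))"
          using k r by (intro mult_mono) auto
        also have "\<dots> = e / 16"
          using r by simp
        finally show ?thesis .
      qed
      define l where "l = norm (d k) + 1"
      have l: "l > 0" "norm (d k) \<le> l" by (simp_all add: l_def add_nonneg_pos)
      define \<delta> where "\<delta> = e / (8 * l)"
      have "\<delta> > 0"
        using \<open>e > 0\<close> l by (simp add: \<delta>_def)
      have \<delta>: "2 * \<delta> * norm (d k) \<le> e / 4"
      proof -
        have "2 * \<delta> * norm (d k) \<le> 2 * \<delta> * l"
          using \<open>\<delta> > 0\<close> l by simp
        also have "\<dots> = e / 4"
          using l by (simp add: \<delta>_def)
        finally show ?thesis .
      qed
      obtain P where P: "open P" "0 \<in> P" "\<And>x y. - x + y \<in> P \<Longrightarrow> norm (f x - f y) \<le> \<delta>"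
        using uniform_neighbourhood[OF G \<open>\<delta> > 0\<close>] by blast
      obtain m1 where m1: "\<And>n. n \<ge> m1 \<Longrightarrow> V n \<subseteq> P"
        using V_basis[OF P(1,2)] by (auto simp: eventually_sequentially)
      obtain m2 where m2: "inverse (real (Suc m2)) < e / (8 * r)"
        using reals_Archimedean[of "e / (8 * r)"] \<open>e > 0\<close> r by auto
      have m2': "inverse (real (Suc n)) * norm f \<le> e / 8" if "m2 \<le> n" for n
      proof -
        have "inverse (real (Suc n)) \<le> inverse (real (Suc m2))"
          using that by (simp add: le_imp_inverse_le)
        then have "inverse (real (Suc n)) \<le> e / (8 * r)"
          using m2 by linarith
        then have "inverse (real (Suc n)) * norm f \<le> (e / (8 * r)) * r"
          using \<open>e > 0\<close> r by (intro mult_mono) auto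
        also have "\<dots> = e / 8"
          using r by simp
        finally show ?thesis .
      qed
      define m where "m = max k (max m1 m2)"
      show "\<forall>\<^sub>F t in at_top. dist (\<Upsilon> t (f \<otimes> a) - \<Phi> t f * a) 0 < e"
        using w_late[of m] eventually_ge_at_top[of t1]
      proof eventually_elim
        case (elim t)
        then have t: "t0 \<le> t" "t2 \<le> t" by (auto simp: t1_def)
        have "\<Upsilon> t (f \<otimes> d k) - \<Phi> t f * d k = (\<Sum>n\<in>W t. w n t *\<^sub>R (U n (max t (T n)) (f \<otimes> d k) - \<Phi> t f * d k))"
          by (simp add: \<Upsilon>_def scaleR_diff_right sum_subtractf scaleR_sum_left[symmetric] sum_W t)
        also have "norm \<dots> \<le> (\<Sum>n\<in>W t. w n t * (e / 4 + e / 8))"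
        proof (rule sum_norm_le)
          fix n assume n: "n \<in> W t"
          then have "m \<le> n"
            using elim(1) by (force simp: W_def not_le[symmetric])
          have "norm (U n t (f \<otimes> d k) - \<Phi> t f * d k) \<le> 2 * \<delta> * norm (d k) + inverse (real (Suc n)) * norm f"
          proof (rule U_approx)
            show "T n \<le> t" using w_supp[of n t] n by (simp add: W_def)
            show "k \<le> n" using \<open>m \<le> n\<close> by (simp add: m_def)
            show "norm (f x - f y) \<le> \<delta>" if "- x + y \<in> V n" for x y
              using P(3) m1[of n] \<open>m \<le> n\<close> that by (auto simp: m_def)
          qed
          also have "\<dots> \<le> e / 4 + e / 8"
            using \<open>m \<le> n\<close> by (intro add_mono \<delta> m2') (simp add: m_def)
          finally show "norm (w n t *\<^sub>R (U n (max t (T n)) (f \<otimes> d k) - \<Phi> t f * d k)) \<le> w n t * (e / 4 + e / 8)"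
            unfolding norm_scaleR max_T[OF n] abs_of_nonneg[OF w(2)] by (intro mult_left_mono w(2))
        qed
        also have "\<dots> = e / 4 + e / 8"
          unfolding sum_distrib_right[symmetric] sum_W[OF t(2)] by simp
        finally have 1: "norm (\<Upsilon> t (f \<otimes> d k) - \<Phi> t f * d k) \<le> e / 4 + e / 8" .
        have 2: "norm (\<Upsilon> t (f \<otimes> (a - d k))) \<le> e / 8"
          using bound[OF elim(2), of "f \<otimes> (a - d k)"] k' by (simp add: norm_elem_tensor)
        have "norm (\<Phi> t f * (a - d k)) \<le> (2 * norm f) * norm (a - d k)"
          by (intro order_trans[OF norm_mult_ineq] mult_right_mono
              norm_unital_completely_positive_le cp\<Phi> one\<Phi> t) simp
        then have 3: "norm (\<Phi> t f * (a - d k)) \<le> e / 8"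
          using k' by simp
        have "f \<otimes> a = f \<otimes> d k + f \<otimes> (a - d k)"
          by (simp flip: elem_tensor_add_right)
        moreover have "\<Upsilon> t (x + y) = \<Upsilon> t x + \<Upsilon> t y" for x y
        proof -
          have "U n (max t (T n)) (x + y) = U n (max t (T n)) x + U n (max t (T n)) y" for n
            using U(2)[of n "max t (T n)"] by (simp add: completely_positive_def clinear_map_def)
          then show ?thesis
            by (simp add: \<Upsilon>_def scaleR_add_right sum.distrib)
        qed
        ultimately have "\<Upsilon> t (f \<otimes> a) - \<Phi> t f * a
            = (\<Upsilon> t (f \<otimes> d k) - \<Phi> t f * d k) + \<Upsilon> t (f \<otimes> (a - d k)) - \<Phi> t f * (a - d k)"
          by (simp add: algebra_simps)
        also have "norm \<dots> \<le> (e / 4 + e / 8) + e / 8 + e / 8"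
          by (intro order_trans[OF norm_triangle_ineq4] add_mono order_trans[OF norm_triangle_ineq] 1 2 3)
        also have "\<dots> < e"
          using \<open>e > 0\<close> by simp
        finally show ?case by simp
      qed
    qed
  qed
qed

section \<open>Asymptotic morphisms\<close>

definition asymp_eq :: "(real \<Rightarrow> 'a::real_normed_vector) \<Rightarrow> (real \<Rightarrow> 'a) \<Rightarrow> bool"  (infix "\<simeq>" 50)
  where "X \<simeq> Y \<longleftrightarrow> Zfun (\<lambda>t. X t - Y t) at_top"

lemma asymp_eq_iff_norm: "X \<simeq> Y \<longleftrightarrow> ((\<lambda>t. norm (X t - Y t)) \<longlongrightarrow> 0) at_top"
  unfolding asymp_eq_def tendsto_norm_zero_iff by (simp add: tendsto_Zfun_iff)

lemma asymp_eq_iff: "X \<simeq> Y \<longleftrightarrow> ((\<lambda>t. X t - Y t) \<longlongrightarrow> 0) at_top"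
  by (simp add: asymp_eq_def tendsto_Zfun_iff)

lemma asymp_eq_const_iff: "X \<simeq> (\<lambda>_. a) \<longleftrightarrow> (X \<longlongrightarrow> a) at_top"
  by (simp add: asymp_eq_def tendsto_Zfun_iff)

lemma asymp_eq_refl: "X \<simeq> X"
  by (simp add: asymp_eq_def Zfun_zero)

lemma asymp_eq_sym: "X \<simeq> Y \<Longrightarrow> Y \<simeq> X"
  unfolding asymp_eq_def using Zfun_minus by fastforce

lemma asymp_eq_trans [trans]: "X \<simeq> Y \<Longrightarrow> Y \<simeq> Z \<Longrightarrow> X \<simeq> Z"
  unfolding asymp_eq_def using Zfun_add by fastforce

lemma asymp_eq_eventually: "\<forall>\<^sub>F t in at_top. X t = Y t \<Longrightarrow> X \<simeq> Y"
  unfolding asymp_eq_iff by (rule tendsto_eventually) (auto elim: eventually_mono)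

lemma asymp_eq_add: "X \<simeq> X' \<Longrightarrow> Y \<simeq> Y' \<Longrightarrow> (\<lambda>t. X t + Y t) \<simeq> (\<lambda>t. X' t + Y' t)"
  unfolding asymp_eq_def by (drule (1) Zfun_add) (simp add: algebra_simps)

lemma asymp_eq_bounded_linear: "bounded_linear T \<Longrightarrow> X \<simeq> Y \<Longrightarrow> (\<lambda>t. T (X t)) \<simeq> (\<lambda>t. T (Y t))"
  unfolding asymp_eq_def using bounded_linear.Zfun[of T "\<lambda>t. X t - Y t"]
  by (simp add: linear_diff[OF bounded_linear.linear])

text \<open>The splitting XY - X'Y' = (X - X') Y + X' (Y - Y') explains why boundedness is asked of
  X' and of Y.\<close>

lemma asymp_eq_mult:
  fixes X Y :: "real \<Rightarrow> 'a::real_normed_algebra"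
  assumes "X \<simeq> X'" "Y \<simeq> Y'" "Bfun X' at_top" "Bfun Y at_top"
  shows "(\<lambda>t. X t * Y t) \<simeq> (\<lambda>t. X' t * Y' t)"
proof -
  have "Zfun (\<lambda>t. (X t - X' t) * Y t + X' t * (Y t - Y' t)) at_top"
    using assms unfolding asymp_eq_def
    by (intro Zfun_add bounded_bilinear.Zfun_prod_Bfun[OF bounded_bilinear_mult]
        bounded_bilinear.Bfun_prod_Zfun[OF bounded_bilinear_mult])
  then show ?thesis
    by (simp add: asymp_eq_def algebra_simps)
qed

lemma asymp_eq_mult_left: "X \<simeq> Y \<Longrightarrow> (\<lambda>t. c * X t) \<simeq> (\<lambda>t. c * Y t)" for c :: "'a::real_normed_algebra"
  by (rule asymp_eq_bounded_linear[OF bounded_linear_mult_right])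

lemma asymp_eq_mult_right: "X \<simeq> Y \<Longrightarrow> (\<lambda>t. X t * c) \<simeq> (\<lambda>t. Y t * c)" for c :: "'a::real_normed_algebra"
  by (rule asymp_eq_bounded_linear[OF bounded_linear_mult_left])

lemma Bfun_asymp_eq: "X \<simeq> Y \<Longrightarrow> Bfun Y at_top \<Longrightarrow> Bfun X at_top"
proof -
  assume "X \<simeq> Y" "Bfun Y at_top"
  then obtain K where "\<forall>\<^sub>F t in at_top. norm (Y t) \<le> K" by (auto simp: Bfun_def)
  moreover have "\<forall>\<^sub>F t in at_top. norm (X t - Y t) < 1"
    using \<open>X \<simeq> Y\<close> by (auto simp: asymp_eq_def Zfun_def)
  ultimately have "\<forall>\<^sub>F t in at_top. norm (X t) \<le> K + 1"
  proof eventually_elim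
    case (elim t)
    then show ?case using norm_triangle_sub[of "X t" "Y t"] by linarith
  qed
  then show ?thesis by (rule BfunI)
qed

lemma asymptotic_morphism_asymp_eq:
  "asymptotic_morphism B \<Phi> \<longleftrightarrow> (\<forall>t\<ge>0. \<forall>c. \<Phi> t c \<in> B) \<and> (\<forall>c. continuous_on {0..} (\<lambda>t. \<Phi> t c)) \<and>
    (\<forall>z c d. (\<lambda>t. \<Phi> t (z *\<^sub>C c + d)) \<simeq> (\<lambda>t. z *\<^sub>C \<Phi> t c + \<Phi> t d)) \<and>
    (\<forall>c d. (\<lambda>t. \<Phi> t (c * d)) \<simeq> (\<lambda>t. \<Phi> t c * \<Phi> t d)) \<and>
    (\<forall>c. (\<lambda>t. \<Phi> t (adj c)) \<simeq> (\<lambda>t. adj (\<Phi> t c)))"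
  by (simp add: asymptotic_morphism_def asymp_eq_iff_norm diff_diff_eq)

text \<open>Trades the extended-real supremum for estimates uniform in g. The bound by e is not
  strict, since a supremum of quantities below e may equal e.\<close>

lemma asymp_equivariant_iff:
  "asymp_equivariant \<gamma> \<beta> \<Phi> \<longleftrightarrow>
    (\<forall>c. \<forall>e>0. \<forall>\<^sub>F t in at_top. \<forall>g. norm (\<Phi> t (\<gamma> g c) - \<beta> g (\<Phi> t c)) \<le> e)"
  unfolding asymp_equivariant_def
proof (intro all_cong1 iffI allI impI)
  fix c and e :: real
  assume "((\<lambda>t. SUP g. ennreal (norm (\<Phi> t (\<gamma> g c) - \<beta> g (\<Phi> t c)))) \<longlongrightarrow> 0) at_top" "0 < e"
  then have "\<forall>\<^sub>F t in at_top. (SUP g. ennreal (norm (\<Phi> t (\<gamma> g c) - \<beta> g (\<Phi> t c)))) < ennreal e"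
    by (intro order_tendstoD(2)) auto
  then show "\<forall>\<^sub>F t in at_top. \<forall>g. norm (\<Phi> t (\<gamma> g c) - \<beta> g (\<Phi> t c)) \<le> e"
  proof eventually_elim
    case (elim t)
    show ?case
    proof
      fix g
      have "ennreal (norm (\<Phi> t (\<gamma> g c) - \<beta> g (\<Phi> t c))) \<le> ennreal e"
        using elim SUP_upper[of g UNIV "\<lambda>g. ennreal (norm (\<Phi> t (\<gamma> g c) - \<beta> g (\<Phi> t c)))"] by auto
      then show "norm (\<Phi> t (\<gamma> g c) - \<beta> g (\<Phi> t c)) \<le> e"
        using \<open>0 < e\<close> by (simp add: ennreal_le_iff)
    qed
  qed
next
  fix c
  assume small: "\<forall>e>0. \<forall>\<^sub>F t in at_top. \<forall>g. norm (\<Phi> t (\<gamma> g c) - \<beta> g (\<Phi> t c)) \<le> e"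
  show "((\<lambda>t. SUP g. ennreal (norm (\<Phi> t (\<gamma> g c) - \<beta> g (\<Phi> t c)))) \<longlongrightarrow> 0) at_top"
  proof (rule order_tendstoI)
    fix a :: ennreal assume "0 < a"
    \<comment> \<open>The supremum will only be known to be at most b, so b must be below a; it is
      also finite, even if a is not.\<close>
    then obtain b where b: "0 < b" "b < a" using dense by blast
    define e where "e = enn2real b"
    have "b < top" using b(2) by (rule less_le_trans) simp
    then have e: "ennreal e = b" "0 < e"
      using b(1) by (simp_all add: e_def enn2real_positive_iff)
    from small e(2) have "\<forall>\<^sub>F t in at_top. \<forall>g. norm (\<Phi> t (\<gamma> g c) - \<beta> g (\<Phi> t c)) \<le> e"
      by blast
    then show "\<forall>\<^sub>F t in at_top. (SUP g. ennreal (norm (\<Phi> t (\<gamma> g c) - \<beta> g (\<Phi> t c)))) < a"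
    proof eventually_elim
      case (elim t)
      then have "(SUP g. ennreal (norm (\<Phi> t (\<gamma> g c) - \<beta> g (\<Phi> t c)))) \<le> ennreal e"
        by (intro SUP_least) (simp add: ennreal_leI)
      then show ?case using b(2) e(1) by simp
    qed
  qed simp
qed

text \<open>Subadditivity handles a finite sum of elementary tensors, and the bound, uniform in t,
  the remainder. N is abstract because it stands in turn for the defects in multiplicativity,
  adjoints and equivariance.\<close>

lemma tendsto_zero_of_elementary_tensors:
  fixes N :: "real \<Rightarrow> ('g::topological_space \<Rightarrow>\<^sub>C 'a::pre_cstar_algebra) \<Rightarrow> real"
  assumes G: "compact (UNIV :: 'g set)"
    and nonneg: "\<And>t F. 0 \<le> N t F"
    and add: "\<And>t F H. T \<le> t \<Longrightarrow> N t (F + H) \<le> N t F + N t H"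
    and bound: "\<And>t F. T \<le> t \<Longrightarrow> N t F \<le> C * norm F"
    and elem: "\<And>f a. ((\<lambda>t. N t (f \<otimes> a)) \<longlongrightarrow> 0) at_top"
  shows "((\<lambda>t. N t F) \<longlongrightarrow> 0) at_top"
proof (rule tendstoI)
  fix e :: real assume "e > 0"
  \<comment> \<open>C may be 0 or negative, and e is to be divided by the bound.\<close>
  define D where "D = \<bar>C\<bar> + 1"
  have D: "D > 0" "C \<le> D" by (auto simp: D_def)
  obtain I :: "'g set" and f a where I: "finite I" "norm (F - (\<Sum>i\<in>I. f i \<otimes> a i)) < e / (2 * D)"
    using elem_tensor_dense[OF G, of "e / (2 * D)" F] \<open>e > 0\<close> D by auto
  have "((\<lambda>t. \<Sum>i\<in>I. N t (f i \<otimes> a i)) \<longlongrightarrow> (\<Sum>i\<in>I. 0)) at_top"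
    by (intro tendsto_sum elem)
  then have "\<forall>\<^sub>F t in at_top. (\<Sum>i\<in>I. N t (f i \<otimes> a i)) < e / 2"
    using \<open>e > 0\<close> by (intro order_tendstoD(2)) auto
  then show "\<forall>\<^sub>F t in at_top. dist (N t F) 0 < e"
    using eventually_ge_at_top[of T]
  proof eventually_elim
    case (elim t)
    have sum: "N t (\<Sum>i\<in>J. f i \<otimes> a i) \<le> (\<Sum>i\<in>J. N t (f i \<otimes> a i))" if "finite J" for J
      using that
    proof (induction J)
      case empty
      show ?case using bound[OF elim(2), of 0] by simp
    next
      case (insert j J)
      then show ?case
        using add[OF elim(2), of "f j \<otimes> a j" "\<Sum>i\<in>J. f i \<otimes> a i"] by simp
    qed
    define H where "H = (\<Sum>i\<in>I. f i \<otimes> a i)"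
    have "N t F \<le> N t H + N t (F - H)"
      using add[OF elim(2), of H "F - H"] by simp
    also have "N t (F - H) \<le> D * norm (F - H)"
      using bound[OF elim(2), of "F - H"] mult_right_mono[OF D(2) norm_ge_zero[of "F - H"]] by linarith
    also have "\<dots> < e / 2"
      using I(2) D(1) by (simp add: H_def field_simps)
    also have "N t H < e / 2"
      using sum[OF I(1)] elim(1) by (simp add: H_def)
    finally show ?case
      using nonneg[of t F] by simp
  qed
qed

text \<open>\<open>Bcontfun\<close> is meaningful only on bounded continuous functions: continuity
  comes from the boundedness of \<alpha> g, boundedness from compactness.\<close>

lemma apply_Lt_tensor:
  fixes \<alpha> :: "'g::topological_group_add \<Rightarrow> 'a::{cstar_algebra, real_normed_algebra_1} \<Rightarrow> 'a"
  assumes "compact (UNIV :: 'g set)" "continuous_action \<alpha>"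
  shows "Lt_tensor \<alpha> g F h = \<alpha> g (F (- g + h))"
proof -
  have "continuous_on UNIV (\<lambda>h. F (- g + h))"
    by (rule continuous_on_compose2[of UNIV F]) (auto intro!: continuous_intros)
  then have "continuous_on UNIV (\<lambda>h. \<alpha> g (F (- g + h)))"
    by (rule bounded_linear.continuous_on[OF bounded_linear_action[OF assms(2)]])
  then show ?thesis
    by (simp add: Lt_tensor_def apply_Bcontfun[OF assms(1)])
qed

lemma norm_Lt_le: "norm (Lt g f) \<le> norm (f :: 'g::topological_group_add \<Rightarrow>\<^sub>C 'b::real_normed_vector)"
  by (rule norm_bound) (simp add: norm_bounded)

text \<open>On elementary tensors \<Upsilon> agrees asymptotically with
  \<open>\<Phi> t f * a\<close>, so each relation is verified there and then extended by density.
  Boundedness of \<Upsilon> is exported for the products that occur in the construction of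
  \<Psi>.\<close>

lemma Rokhlin_imp_asymptotic_morphism:
  fixes \<alpha> :: "'g::{topological_group_add, t2_space, second_countable_topology} \<Rightarrow>
    'a::{cstar_algebra, real_normed_algebra_1} \<Rightarrow> 'a"
  assumes G: "compact (UNIV :: 'g set)" and sep: "separable_space (euclidean :: 'a topology)"
    and action: "continuous_action \<alpha>" and Rokhlin: "continuous_Rokhlin_property \<alpha>"
  obtains \<Upsilon> :: "real \<Rightarrow> ('g \<Rightarrow>\<^sub>C 'a) \<Rightarrow> 'a"
  where "asymptotic_morphism UNIV \<Upsilon>" "asymp_unital \<Upsilon>" "asymp_completely_positive \<Upsilon>"
    "asymp_equivariant (Lt_tensor \<alpha>) \<alpha> \<Upsilon>" "\<And>a. ((\<lambda>t. \<Upsilon> t (1 \<otimes> a)) \<longlongrightarrow> a) at_top"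
    "\<And>F. Bfun (\<lambda>t. \<Upsilon> t F) at_top"
proof -
  obtain \<Phi> :: "real \<Rightarrow> ('g \<Rightarrow>\<^sub>C complex) \<Rightarrow> 'a"
    where \<Phi>: "asymptotic_morphism UNIV \<Phi>" "asymp_unital \<Phi>" "asymp_completely_positive \<Phi>" "asymp_central \<Phi>"
      and equi: "asymp_equivariant Lt \<alpha> \<Phi>"
    using Rokhlin unfolding continuous_Rokhlin_property_def by blast
  obtain \<Upsilon> and t0 where "0 \<le> t0" and cont: "\<And>F. continuous_on {0..} (\<lambda>t. \<Upsilon> t F)"
    and cp: "\<And>t. t0 \<le> t \<Longrightarrow> completely_positive (\<Upsilon> t)" and one: "\<And>t. t0 \<le> t \<Longrightarrow> \<Upsilon> t 1 = 1"
    and bound: "\<And>t F. t0 \<le> t \<Longrightarrow> norm (\<Upsilon> t F) \<le> 2 * norm F"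
    and elem: "\<And>f a. ((\<lambda>t. \<Upsilon> t (f \<otimes> a) - \<Phi> t f * a) \<longlongrightarrow> 0) at_top"
    by (rule unital_completely_positive_extension[OF G sep \<Phi>]) (rule that; assumption)
  obtain t1 where t1: "\<And>t. t \<ge> t1 \<Longrightarrow> completely_positive (\<Phi> t)" "\<And>t. t \<ge> t1 \<Longrightarrow> \<Phi> t 1 = 1"
    by (rule asymptotically_unital_completely_positive[OF \<Phi>(2,3)]) (rule that; assumption)
  have norm\<Phi>: "norm (\<Phi> t f) \<le> 2 * norm f" if "t \<ge> t1" for t f
    by (rule norm_unital_completely_positive_le[OF t1[OF that]])
  have lin: "clinear_map (\<Upsilon> t)" if "t \<ge> t0" for t
    using cp[OF that] by (simp add: completely_positive_def)
  have lin\<Phi>: "clinear_map (\<Phi> t)" if "t \<ge> t1" for t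
    using t1(1)[OF that] by (simp add: completely_positive_def)
  have \<Upsilon>_\<Phi>: "(\<lambda>t. \<Upsilon> t (f \<otimes> a)) \<simeq> (\<lambda>t. \<Phi> t f * a)" for f a
    unfolding asymp_eq_iff by (rule elem)
  have Bfun_\<Upsilon>: "Bfun (\<lambda>t. \<Upsilon> t F) at_top" for F
    by (rule BfunI, rule eventually_mono[OF eventually_ge_at_top[of t0]]) (rule bound)
  have Bfun_\<Phi>: "Bfun (\<lambda>t. \<Phi> t f) at_top" for f
    by (rule BfunI, rule eventually_mono[OF eventually_ge_at_top[of t1]]) (rule norm\<Phi>)
  have Bfun_mult: "Bfun (\<lambda>t. \<Phi> t f * a) at_top" for f a
    by (rule Bfun_asymp_eq[OF asymp_eq_sym[OF \<Upsilon>_\<Phi>] Bfun_\<Upsilon>])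
  have central: "(\<lambda>t. \<Phi> t f * a) \<simeq> (\<lambda>t. a * \<Phi> t f)" for f a
    using \<Phi>(4) by (simp add: asymp_central_def asymp_eq_iff_norm)
  have mult\<Phi>: "(\<lambda>t. \<Phi> t (f * g)) \<simeq> (\<lambda>t. \<Phi> t f * \<Phi> t g)" and adj\<Phi>: "(\<lambda>t. \<Phi> t (adj f)) \<simeq> (\<lambda>t. adj (\<Phi> t f))"
    for f g
    using \<Phi>(1) by (simp_all add: asymptotic_morphism_asymp_eq)

  have mult_elem: "(\<lambda>t. \<Upsilon> t ((f \<otimes> a) * (g \<otimes> b))) \<simeq> (\<lambda>t. \<Upsilon> t (f \<otimes> a) * \<Upsilon> t (g \<otimes> b))" for f g a b
  proof -
    have "(\<lambda>t. \<Upsilon> t ((f \<otimes> a) * (g \<otimes> b))) \<simeq> (\<lambda>t. \<Phi> t (f * g) * (a * b))"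
      unfolding elem_tensor_mult by (rule \<Upsilon>_\<Phi>)
    also have "\<dots> \<simeq> (\<lambda>t. \<Phi> t f * \<Phi> t g * (a * b))"
      by (rule asymp_eq_mult_right[OF mult\<Phi>])
    also have "\<dots> = (\<lambda>t. \<Phi> t f * (\<Phi> t g * a * b))"
      by (simp add: mult.assoc)
    \<comment> \<open>Asymptotic centrality moves a past \<Phi> t g.\<close>
    also have "\<dots> \<simeq> (\<lambda>t. \<Phi> t f * (a * \<Phi> t g * b))"
    proof (rule asymp_eq_mult[OF asymp_eq_refl asymp_eq_mult_right[OF central] Bfun_\<Phi>])
      show "Bfun (\<lambda>t. \<Phi> t g * a * b) at_top"
        using Bfun_mult[of g "a * b"] by (simp add: mult.assoc)
    qed
    also have "\<dots> = (\<lambda>t. (\<Phi> t f * a) * (\<Phi> t g * b))"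
      by (simp add: mult.assoc)
    also have "\<dots> \<simeq> (\<lambda>t. \<Upsilon> t (f \<otimes> a) * \<Upsilon> t (g \<otimes> b))"
      by (rule asymp_eq_mult[OF asymp_eq_sym[OF \<Upsilon>_\<Phi>] asymp_eq_sym[OF \<Upsilon>_\<Phi>] Bfun_\<Upsilon> Bfun_mult])
    finally show ?thesis .
  qed
  have mult_bound: "norm (\<Upsilon> t (F * H) - \<Upsilon> t F * \<Upsilon> t H) \<le> 6 * norm F * norm H" if t: "t \<ge> t0" for t F H
  proof -
    have "norm (\<Upsilon> t (F * H)) \<le> 2 * (norm F * norm H)"
      using bound[OF t, of "F * H"] norm_mult_ineq[of F H] by linarith
    moreover have "norm (\<Upsilon> t F * \<Upsilon> t H) \<le> (2 * norm F) * (2 * norm H)"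
      by (intro order_trans[OF norm_mult_ineq] mult_mono bound t) auto
    ultimately show ?thesis
      using norm_triangle_ineq4[of "\<Upsilon> t (F * H)" "\<Upsilon> t F * \<Upsilon> t H"] by (simp add: mult_ac)
  qed
  have \<Upsilon>_add: "\<Upsilon> t (F + H) = \<Upsilon> t F + \<Upsilon> t H" if "t \<ge> t0" for t F H
    using lin[OF that] by (simp add: clinear_map_def)
  \<comment> \<open>The defect is additive in each factor separately, so density is applied to F
    with the other factor elementary, and afterwards to that factor.\<close>
  have mult_half: "(\<lambda>t. \<Upsilon> t (F * (g \<otimes> b))) \<simeq> (\<lambda>t. \<Upsilon> t F * \<Upsilon> t (g \<otimes> b))" for F g b
    unfolding asymp_eq_iff_norm
  proof (rule tendsto_zero_of_elementary_tensors[OF G, where F = F and T = t0 and C = "6 * norm (g \<otimes> b)"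
        and N = "\<lambda>t F. norm (\<Upsilon> t (F * (g \<otimes> b)) - \<Upsilon> t F * \<Upsilon> t (g \<otimes> b))"])
    fix t and F H :: "'g \<Rightarrow>\<^sub>C 'a" assume t: "t0 \<le> t"
    have "\<Upsilon> t ((F + H) * (g \<otimes> b)) - \<Upsilon> t (F + H) * \<Upsilon> t (g \<otimes> b)
        = (\<Upsilon> t (F * (g \<otimes> b)) - \<Upsilon> t F * \<Upsilon> t (g \<otimes> b)) + (\<Upsilon> t (H * (g \<otimes> b)) - \<Upsilon> t H * \<Upsilon> t (g \<otimes> b))"
      by (simp add: \<Upsilon>_add[OF t] distrib_right)
    then show "norm (\<Upsilon> t ((F + H) * (g \<otimes> b)) - \<Upsilon> t (F + H) * \<Upsilon> t (g \<otimes> b))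
        \<le> norm (\<Upsilon> t (F * (g \<otimes> b)) - \<Upsilon> t F * \<Upsilon> t (g \<otimes> b))
          + norm (\<Upsilon> t (H * (g \<otimes> b)) - \<Upsilon> t H * \<Upsilon> t (g \<otimes> b))"
      by (simp only: norm_triangle_ineq)
    show "norm (\<Upsilon> t (F * (g \<otimes> b)) - \<Upsilon> t F * \<Upsilon> t (g \<otimes> b)) \<le> 6 * norm (g \<otimes> b) * norm F"
      using mult_bound[OF t, of F "g \<otimes> b"] by (simp add: mult_ac)
  qed (use mult_elem in \<open>simp_all add: asymp_eq_iff_norm\<close>)
  have mult: "(\<lambda>t. \<Upsilon> t (F * H)) \<simeq> (\<lambda>t. \<Upsilon> t F * \<Upsilon> t H)" for F H
    unfolding asymp_eq_iff_norm
  proof (rule tendsto_zero_of_elementary_tensors[OF G, where F = H and T = t0 and C = "6 * norm F"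
        and N = "\<lambda>t H. norm (\<Upsilon> t (F * H) - \<Upsilon> t F * \<Upsilon> t H)"])
    fix t and H K :: "'g \<Rightarrow>\<^sub>C 'a" assume t: "t0 \<le> t"
    have "\<Upsilon> t (F * (H + K)) - \<Upsilon> t F * \<Upsilon> t (H + K)
        = (\<Upsilon> t (F * H) - \<Upsilon> t F * \<Upsilon> t H) + (\<Upsilon> t (F * K) - \<Upsilon> t F * \<Upsilon> t K)"
      by (simp add: \<Upsilon>_add[OF t] distrib_left)
    then show "norm (\<Upsilon> t (F * (H + K)) - \<Upsilon> t F * \<Upsilon> t (H + K))
        \<le> norm (\<Upsilon> t (F * H) - \<Upsilon> t F * \<Upsilon> t H) + norm (\<Upsilon> t (F * K) - \<Upsilon> t F * \<Upsilon> t K)"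
      by (simp only: norm_triangle_ineq)
    show "norm (\<Upsilon> t (F * H) - \<Upsilon> t F * \<Upsilon> t H) \<le> 6 * norm F * norm H"
      by (rule mult_bound[OF t])
  qed (use mult_half in \<open>simp_all add: asymp_eq_iff_norm\<close>)

  have adj_elem: "(\<lambda>t. \<Upsilon> t (adj (f \<otimes> a))) \<simeq> (\<lambda>t. adj (\<Upsilon> t (f \<otimes> a)))" for f a
  proof -
    have "(\<lambda>t. \<Upsilon> t (adj (f \<otimes> a))) \<simeq> (\<lambda>t. \<Phi> t (adj f) * adj a)"
      unfolding elem_tensor_adj by (rule \<Upsilon>_\<Phi>)
    also have "\<dots> \<simeq> (\<lambda>t. adj a * \<Phi> t (adj f))"
      by (rule central)
    also have "\<dots> \<simeq> (\<lambda>t. adj a * adj (\<Phi> t f))"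
      by (rule asymp_eq_mult_left[OF adj\<Phi>])
    also have "\<dots> = (\<lambda>t. adj (\<Phi> t f * a))"
      by simp
    also have "\<dots> \<simeq> (\<lambda>t. adj (\<Upsilon> t (f \<otimes> a)))"
      by (rule asymp_eq_bounded_linear[OF bounded_linear_adj asymp_eq_sym[OF \<Upsilon>_\<Phi>]])
    finally show ?thesis .
  qed
  have adj: "(\<lambda>t. \<Upsilon> t (adj F)) \<simeq> (\<lambda>t. adj (\<Upsilon> t F))" for F
    unfolding asymp_eq_iff_norm
  proof (rule tendsto_zero_of_elementary_tensors[OF G, where F = F and T = t0 and C = 4
        and N = "\<lambda>t F. norm (\<Upsilon> t (adj F) - adj (\<Upsilon> t F))"])
    fix t and F H :: "'g \<Rightarrow>\<^sub>C 'a" assume t: "t0 \<le> t"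
    have "\<Upsilon> t (adj (F + H)) - adj (\<Upsilon> t (F + H))
        = (\<Upsilon> t (adj F) - adj (\<Upsilon> t F)) + (\<Upsilon> t (adj H) - adj (\<Upsilon> t H))"
      by (simp add: \<Upsilon>_add[OF t])
    then show "norm (\<Upsilon> t (adj (F + H)) - adj (\<Upsilon> t (F + H)))
        \<le> norm (\<Upsilon> t (adj F) - adj (\<Upsilon> t F)) + norm (\<Upsilon> t (adj H) - adj (\<Upsilon> t H))"
      by (simp only: norm_triangle_ineq)
    show "norm (\<Upsilon> t (adj F) - adj (\<Upsilon> t F)) \<le> 4 * norm F"
      using norm_triangle_ineq4[of "\<Upsilon> t (adj F)" "adj (\<Upsilon> t F)"] bound[OF t, of F] bound[OF t, of "adj F"]
      by (simp add: norm_adj)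
  qed (use adj_elem in \<open>simp_all add: asymp_eq_iff_norm\<close>)

  note lt = apply_Lt_tensor[OF G action]
  note \<alpha>_lin = clinear_map_action[OF action]
  \<comment> \<open>D t f a tends to 0 for each f and a, but equivariance needs this uniformly along
    their orbit. The orbit net together with a bound for D, additive in f and in a, provides
    it.\<close>
  define D where "D t f a = \<Upsilon> t (f \<otimes> a) - \<Phi> t f * a" for t f a
  have D_bound: "norm (D t f a) \<le> 4 * norm f * norm a" if "t \<ge> t0" "t \<ge> t1" for t f a
  proof -
    have "norm (\<Phi> t f * a) \<le> (2 * norm f) * norm a"
      by (intro order_trans[OF norm_mult_ineq] mult_right_mono norm\<Phi> that) simp
    then show ?thesis
      using norm_triangle_ineq4[of "\<Upsilon> t (f \<otimes> a)" "\<Phi> t f * a"] bound[OF that(1), of "f \<otimes> a"]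
      by (simp add: D_def norm_elem_tensor)
  qed
  have D_orbit: "\<forall>\<^sub>F t in at_top. \<forall>g. norm (D t (Lt g f) (\<alpha> g a)) \<le> e" if "e > 0" for f a e
  proof -
    \<comment> \<open>Makes the two terms for passing from g to a net point add up to at most e /
      2.\<close>
    define r where "r = 8 * (norm f + norm a + 1)"
    have r: "r > 0" by (simp add: r_def add_nonneg_pos)
    obtain I where I: "finite I"
      "\<And>g. \<exists>i\<in>I. norm (Lt g f - Lt i f) \<le> e / r \<and> norm (\<alpha> g a - \<alpha> i a) \<le> e / r"
      using orbit_net[OF G action, of "e / r" f a] \<open>e > 0\<close> r by (metis divide_pos_pos)
    have "\<forall>\<^sub>F t in at_top. norm (D t (Lt i f) (\<alpha> i a)) < e / 2" for i
      using tendsto_norm_zero[OF elem[of "Lt i f" "\<alpha> i a"]] \<open>e > 0\<close>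
      unfolding D_def by (intro order_tendstoD(2)) auto
    then have "\<forall>\<^sub>F t in at_top. \<forall>i\<in>I. norm (D t (Lt i f) (\<alpha> i a)) < e / 2"
      by (simp add: eventually_ball_finite_distrib[OF I(1)])
    then show ?thesis
      using eventually_ge_at_top[of t0] eventually_ge_at_top[of t1]
    proof eventually_elim
      case (elim t)
      show ?case
      proof
        fix g
        obtain i where i: "i \<in> I" "norm (Lt g f - Lt i f) \<le> e / r" "norm (\<alpha> g a - \<alpha> i a) \<le> e / r"
          using I(2)[of g] by blast
        have "Lt g f \<otimes> \<alpha> g a = (Lt g f - Lt i f) \<otimes> \<alpha> g a + Lt i f \<otimes> (\<alpha> g a - \<alpha> i a) + Lt i f \<otimes> \<alpha> i a"
          using elem_tensor_add_left[of "Lt g f - Lt i f" "Lt i f" "\<alpha> g a"]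
            elem_tensor_add_right[of "Lt i f" "\<alpha> g a - \<alpha> i a" "\<alpha> i a"] by (simp add: add.assoc)
        then have "D t (Lt g f) (\<alpha> g a)
            = D t (Lt g f - Lt i f) (\<alpha> g a) + D t (Lt i f) (\<alpha> g a - \<alpha> i a) + D t (Lt i f) (\<alpha> i a)"
          by (simp add: D_def \<Upsilon>_add[OF elim(2)] clinear_map_diff[OF lin\<Phi>[OF elim(3)]] algebra_simps)
        also have "norm \<dots> \<le> 4 * (e / r) * norm a + 4 * norm f * (e / r) + e / 2"
        proof (intro norm_triangle_le add_mono)
          show "norm (D t (Lt g f - Lt i f) (\<alpha> g a)) \<le> 4 * (e / r) * norm a"
            using D_bound[OF elim(2,3), of "Lt g f - Lt i f" "\<alpha> g a"]
              mult_right_mono[OF i(2) norm_ge_zero[of a]] by (simp add: norm_action[OF action])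
          show "norm (D t (Lt i f) (\<alpha> g a - \<alpha> i a)) \<le> 4 * norm f * (e / r)"
            using D_bound[OF elim(2,3), of "Lt i f" "\<alpha> g a - \<alpha> i a"]
              mult_mono[OF norm_Lt_le[of i f] i(3)] by simp
          show "norm (D t (Lt i f) (\<alpha> i a)) \<le> e / 2"
            using elim(1) i(1) by force
        qed
        also have "4 * (e / r) * norm a + 4 * norm f * (e / r) \<le> e / 2"
        proof -
          have "4 * (e / r) * norm a + 4 * norm f * (e / r) = (e / r) * (4 * (norm f + norm a))"
            by (simp add: algebra_simps)
          also have "\<dots> \<le> (e / r) * (r / 2)"
            using \<open>e > 0\<close> r by (intro mult_left_mono) (auto simp: r_def)
          also have "\<dots> = e / 2"
            using r by simp
          finally show ?thesis .
        qed
        finally show "norm (D t (Lt g f) (\<alpha> g a)) \<le> e" by simp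
      qed
    qed
  qed
  have equi_elem: "\<forall>\<^sub>F t in at_top. \<forall>g. norm (\<Upsilon> t (Lt_tensor \<alpha> g (f \<otimes> a)) - \<alpha> g (\<Upsilon> t (f \<otimes> a))) \<le> e"
    if "e > 0" for f a e
  proof -
    define r where "r = e / (3 * (norm a + 1))"
    have r: "r > 0" "r * norm a \<le> e / 3"
    proof -
      have l: "norm a + 1 > 0" by (simp add: add_nonneg_pos)
      then show "r > 0" unfolding r_def using \<open>e > 0\<close> by (intro divide_pos_pos) auto
      then have "r * norm a \<le> r * (norm a + 1)" by simp
      also have "\<dots> = e / 3"
        unfolding r_def using l by (metis mult.commute nonzero_mult_divide_mult_cancel_right less_irrefl
            times_divide_eq_left)
      finally show "r * norm a \<le> e / 3" .
    qed
    have "\<forall>\<^sub>F t in at_top. norm (D t f a) < e / 3"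
      using tendsto_norm_zero[OF elem[of f a]] \<open>e > 0\<close>
      unfolding D_def by (intro order_tendstoD(2)) auto
    moreover have "\<forall>\<^sub>F t in at_top. \<forall>g. norm (\<Phi> t (Lt g f) - \<alpha> g (\<Phi> t f)) \<le> r"
      using equi r(1) by (simp add: asymp_equivariant_iff)
    moreover have "\<forall>\<^sub>F t in at_top. \<forall>g. norm (D t (Lt g f) (\<alpha> g a)) \<le> e / 3"
      using \<open>e > 0\<close> by (intro D_orbit) simp
    ultimately show ?thesis
    proof eventually_elim
      case (elim t)
      show ?case
      proof
        fix g
        have "\<Upsilon> t (Lt_tensor \<alpha> g (f \<otimes> a)) - \<alpha> g (\<Upsilon> t (f \<otimes> a))
            = D t (Lt g f) (\<alpha> g a) + (\<Phi> t (Lt g f) - \<alpha> g (\<Phi> t f)) * \<alpha> g a + - \<alpha> g (D t f a)"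
          by (simp add: D_def Lt_tensor_elem_tensor[OF action] clinear_map_diff[OF \<alpha>_lin]
              action_mult[OF action] algebra_simps)
        also have "norm \<dots> \<le> e / 3 + r * norm a + e / 3"
        proof (intro norm_triangle_le add_mono)
          show "norm ((\<Phi> t (Lt g f) - \<alpha> g (\<Phi> t f)) * \<alpha> g a) \<le> r * norm a"
            using elim(2) norm_mult_ineq[of "\<Phi> t (Lt g f) - \<alpha> g (\<Phi> t f)" "\<alpha> g a"]
              mult_right_mono[OF elim(2)[rule_format, of g] norm_ge_zero[of a]]
            by (simp add: norm_action[OF action])
        qed (use elim in \<open>auto simp: norm_action[OF action] less_imp_le\<close>)
        finally show "norm (\<Upsilon> t (Lt_tensor \<alpha> g (f \<otimes> a)) - \<alpha> g (\<Upsilon> t (f \<otimes> a))) \<le> e"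
          using r(2) by linarith
      qed
    qed
  qed
  define N where "N t F = (SUP g. norm (\<Upsilon> t (Lt_tensor \<alpha> g F) - \<alpha> g (\<Upsilon> t F)))" for t F
  have N_le: "norm (\<Upsilon> t (Lt_tensor \<alpha> g F) - \<alpha> g (\<Upsilon> t F)) \<le> 4 * norm F" if t: "t \<ge> t0" for t g F
  proof -
    have "norm (Lt_tensor \<alpha> g F) \<le> norm F"
      by (rule norm_bound) (simp add: lt norm_action[OF action] norm_bounded)
    then show ?thesis
      using bound[OF t, of "Lt_tensor \<alpha> g F"] bound[OF t, of F]
        norm_triangle_ineq4[of "\<Upsilon> t (Lt_tensor \<alpha> g F)" "\<alpha> g (\<Upsilon> t F)"]
      by (simp add: norm_action[OF action])
  qed
  have N_upper: "norm (\<Upsilon> t (Lt_tensor \<alpha> g F) - \<alpha> g (\<Upsilon> t F)) \<le> N t F" if t: "t \<ge> t0" for t g F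
    unfolding N_def using N_le[OF t] by (intro cSUP_upper bdd_aboveI2) auto
  \<comment> \<open>The real supremum N is controlled for t \<ge> t0, where its range is bounded
    above. The value 0 before t0 and the maximum give a functional that is nonnegative at all times,
    as the density lemma demands.\<close>
  have N_tendsto: "((\<lambda>t. max 0 (if t \<ge> t0 then N t F else 0)) \<longlongrightarrow> 0) at_top" for F
  proof (rule tendsto_zero_of_elementary_tensors[OF G, where F = F and T = t0 and C = 4
        and N = "\<lambda>t F. max 0 (if t \<ge> t0 then N t F else 0)"])
    fix t and F H :: "'g \<Rightarrow>\<^sub>C 'a" assume t: "t0 \<le> t"
    have nonneg: "0 \<le> N t F" for F
      using N_upper[OF t, of undefined F] norm_ge_zero order_trans by blast
    have "N t (F + H) \<le> N t F + N t H"
      unfolding N_def[of t "F + H"]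
    proof (rule cSUP_least)
      fix g
      have "Lt_tensor \<alpha> g (F + H) = Lt_tensor \<alpha> g F + Lt_tensor \<alpha> g H"
        using \<alpha>_lin by (intro bcontfun_eqI) (simp add: lt clinear_map_def)
      then have "\<Upsilon> t (Lt_tensor \<alpha> g (F + H)) - \<alpha> g (\<Upsilon> t (F + H))
          = (\<Upsilon> t (Lt_tensor \<alpha> g F) - \<alpha> g (\<Upsilon> t F)) + (\<Upsilon> t (Lt_tensor \<alpha> g H) - \<alpha> g (\<Upsilon> t H))"
        using \<alpha>_lin[of g] by (simp add: \<Upsilon>_add[OF t] clinear_map_def)
      also have "norm \<dots> \<le> N t F + N t H"
        by (intro norm_triangle_le add_mono N_upper t)
      finally show "norm (\<Upsilon> t (Lt_tensor \<alpha> g (F + H)) - \<alpha> g (\<Upsilon> t (F + H))) \<le> N t F + N t H" .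
    qed simp
    then show "max 0 (if t \<ge> t0 then N t (F + H) else 0)
        \<le> max 0 (if t \<ge> t0 then N t F else 0) + max 0 (if t \<ge> t0 then N t H else 0)"
      using t nonneg by simp
    have "N t F \<le> 4 * norm F"
      unfolding N_def by (rule cSUP_least) (simp_all add: N_le[OF t])
    then show "max 0 (if t \<ge> t0 then N t F else 0) \<le> 4 * norm F"
      using t by simp
  next
    fix f :: "'g \<Rightarrow>\<^sub>C complex" and a :: 'a
    show "((\<lambda>t. max 0 (if t \<ge> t0 then N t (f \<otimes> a) else 0)) \<longlongrightarrow> 0) at_top"
    proof (rule tendstoI)
      fix e :: real assume "e > 0"
      then have "\<forall>\<^sub>F t in at_top. \<forall>g. norm (\<Upsilon> t (Lt_tensor \<alpha> g (f \<otimes> a)) - \<alpha> g (\<Upsilon> t (f \<otimes> a))) \<le> e / 2"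
        by (intro equi_elem) simp
      then show "\<forall>\<^sub>F t in at_top. dist (max 0 (if t \<ge> t0 then N t (f \<otimes> a) else 0)) 0 < e"
      proof eventually_elim
        case (elim t)
        have "N t (f \<otimes> a) \<le> e / 2"
          unfolding N_def using elim by (intro cSUP_least) auto
        then show ?case using \<open>e > 0\<close> by auto
      qed
    qed
  qed simp
  have equivariant: "asymp_equivariant (Lt_tensor \<alpha>) \<alpha> \<Upsilon>"
    unfolding asymp_equivariant_iff
  proof (intro allI impI)
    fix F and e :: real assume "0 < e"
    then have "\<forall>\<^sub>F t in at_top. max 0 (if t \<ge> t0 then N t F else 0) < e"
      by (intro order_tendstoD(2)[OF N_tendsto])
    then show "\<forall>\<^sub>F t in at_top. \<forall>g. norm (\<Upsilon> t (Lt_tensor \<alpha> g F) - \<alpha> g (\<Upsilon> t F)) \<le> e"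
      using eventually_ge_at_top[of t0]
    proof eventually_elim
      case (elim t)
      show ?case
      proof
        fix g
        show "norm (\<Upsilon> t (Lt_tensor \<alpha> g F) - \<alpha> g (\<Upsilon> t F)) \<le> e"
          using N_upper[OF elim(2), of g F] elim by simp
      qed
    qed
  qed

  have linear: "(\<lambda>t. \<Upsilon> t (z *\<^sub>C F + H)) \<simeq> (\<lambda>t. z *\<^sub>C \<Upsilon> t F + \<Upsilon> t H)" for z F H
    by (rule asymp_eq_eventually, rule eventually_mono[OF eventually_ge_at_top[of t0]])
      (simp add: lin[unfolded clinear_map_def])
  have "asymptotic_morphism UNIV \<Upsilon>"
    using cont linear mult adj by (simp add: asymptotic_morphism_asymp_eq)
  moreover have "asymp_unital \<Upsilon>" "asymp_completely_positive \<Upsilon>"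
    using one cp \<open>0 \<le> t0\<close> by (auto simp: asymp_unital_def asymp_completely_positive_def)
  moreover have "((\<lambda>t. \<Upsilon> t (1 \<otimes> a)) \<longlongrightarrow> a) at_top" for a
  proof -
    have "(\<lambda>t. \<Upsilon> t (1 \<otimes> a)) \<simeq> (\<lambda>t. \<Phi> t 1 * a)"
      by (rule \<Upsilon>_\<Phi>)
    also have "\<dots> \<simeq> (\<lambda>_. a)"
      by (rule asymp_eq_eventually, rule eventually_mono[OF eventually_ge_at_top[of t1]]) (simp add: t1(2))
    finally show ?thesis
      by (simp add: asymp_eq_const_iff)
  qed
  ultimately show ?thesis
    using that equivariant Bfun_\<Upsilon> by blast
qed

lemma asymptotic_morphism_imp_Rokhlin:
  fixes \<alpha> :: "'g::topological_group_add \<Rightarrow> 'a::{cstar_algebra, real_normed_algebra_1} \<Rightarrow> 'a"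
    and \<Upsilon> :: "real \<Rightarrow> ('g \<Rightarrow>\<^sub>C 'a) \<Rightarrow> 'a"
  assumes action: "continuous_action \<alpha>"
    and \<Upsilon>: "asymptotic_morphism UNIV \<Upsilon>" "asymp_unital \<Upsilon>" "asymp_completely_positive \<Upsilon>"
      "asymp_equivariant (Lt_tensor \<alpha>) \<alpha> \<Upsilon>" and id: "\<And>a. ((\<lambda>t. \<Upsilon> t (1 \<otimes> a)) \<longlongrightarrow> a) at_top"
  shows "continuous_Rokhlin_property \<alpha>"
proof -
  define \<Phi> where "\<Phi> t f = \<Upsilon> t (f \<otimes> 1)" for t f
  obtain t0 where "t0 \<ge> 0" and cp: "\<And>t. t \<ge> t0 \<Longrightarrow> completely_positive (\<Upsilon> t)"
    and one: "\<And>t. t \<ge> t0 \<Longrightarrow> \<Upsilon> t 1 = 1"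
    by (rule asymptotically_unital_completely_positive[OF \<Upsilon>(2,3)]) (rule that; assumption)
  have "completely_positive (\<lambda>f :: 'g \<Rightarrow>\<^sub>C complex. f \<otimes> (1 :: 'a))"
    by (rule completely_positive_star_hom)
      (simp_all add: clinear_map_def elem_tensor_add_left elem_tensor_scaleC_left elem_tensor_mult elem_tensor_adj)
  then have cp\<Phi>: "completely_positive (\<Phi> t)" if "t \<ge> t0" for t
    unfolding \<Phi>_def[abs_def] by (rule completely_positive_comp[OF cp[OF that]])
  have one\<Phi>: "\<Phi> t 1 = 1" if "t \<ge> t0" for t
    by (simp add: \<Phi>_def elem_tensor_one one[OF that])
  have mult: "(\<lambda>t. \<Upsilon> t (F * H)) \<simeq> (\<lambda>t. \<Upsilon> t F * \<Upsilon> t H)" for F H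
    using \<Upsilon>(1) by (simp add: asymptotic_morphism_asymp_eq)
  \<comment> \<open>On the copy of C(G) formed by the f \<otimes> 1 the bound for unital completely
    positive maps applies; the products in the proof of centrality rely on it.\<close>
  have Bfun_\<Phi>: "Bfun (\<lambda>t. \<Upsilon> t (f \<otimes> 1)) at_top" for f
    unfolding \<Phi>_def[symmetric]
    by (rule BfunI, rule eventually_mono[OF eventually_ge_at_top[of t0]])
      (rule norm_unital_completely_positive_le[OF cp\<Phi> one\<Phi>])
  have id': "(\<lambda>t. \<Upsilon> t (1 \<otimes> b)) \<simeq> (\<lambda>_. b)" for b
    using id by (simp add: asymp_eq_const_iff)
  have "asymptotic_morphism UNIV \<Phi>"
    unfolding asymptotic_morphism_asymp_eq
  proof (intro conjI allI impI UNIV_I)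
    show "continuous_on {0..} (\<lambda>t. \<Phi> t f)" for f
      using \<Upsilon>(1) by (simp add: \<Phi>_def asymptotic_morphism_def)
    show "(\<lambda>t. \<Phi> t (z *\<^sub>C f + g)) \<simeq> (\<lambda>t. z *\<^sub>C \<Phi> t f + \<Phi> t g)" for z f g
      using \<Upsilon>(1) by (simp add: \<Phi>_def asymptotic_morphism_asymp_eq elem_tensor_add_left elem_tensor_scaleC_left)
    show "(\<lambda>t. \<Phi> t (f * g)) \<simeq> (\<lambda>t. \<Phi> t f * \<Phi> t g)" for f g
      using mult[of "f \<otimes> 1" "g \<otimes> 1"] by (simp add: \<Phi>_def elem_tensor_mult)
    show "(\<lambda>t. \<Phi> t (adj f)) \<simeq> (\<lambda>t. adj (\<Phi> t f))" for f
    proof -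
      have "adj f \<otimes> (1 :: 'a) = adj (f \<otimes> 1)"
        by (simp add: elem_tensor_adj)
      then show ?thesis
        using \<Upsilon>(1) by (simp only: \<Phi>_def asymptotic_morphism_asymp_eq)
    qed
  qed
  moreover have "asymp_unital \<Phi>" "asymp_completely_positive \<Phi>"
    using cp\<Phi> one\<Phi> \<open>t0 \<ge> 0\<close> by (auto simp: asymp_unital_def asymp_completely_positive_def)
  moreover have "asymp_equivariant Lt \<alpha> \<Phi>"
    unfolding asymp_equivariant_iff
  proof (intro allI impI)
    fix f and e :: real assume "e > 0"
    then have "\<forall>\<^sub>F t in at_top. \<forall>g. norm (\<Upsilon> t (Lt_tensor \<alpha> g (f \<otimes> 1)) - \<alpha> g (\<Upsilon> t (f \<otimes> 1))) \<le> e"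
      using \<Upsilon>(4) by (simp only: asymp_equivariant_iff)
    then show "\<forall>\<^sub>F t in at_top. \<forall>g. norm (\<Phi> t (Lt g f) - \<alpha> g (\<Phi> t f)) \<le> e"
      by (simp add: \<Phi>_def Lt_tensor_elem_tensor[OF action] action_one[OF action])
  qed
  moreover have "asymp_central \<Phi>"
    unfolding asymp_central_def asymp_eq_iff_norm[symmetric]
  proof (intro allI)
    fix f b
    have "(\<lambda>t. \<Phi> t f * b) \<simeq> (\<lambda>t. \<Upsilon> t (f \<otimes> 1) * \<Upsilon> t (1 \<otimes> b))"
      unfolding \<Phi>_def by (rule asymp_eq_mult[OF asymp_eq_refl asymp_eq_sym[OF id'] Bfun_\<Phi> Bfun_const])
    also have "\<dots> \<simeq> (\<lambda>t. \<Upsilon> t ((f \<otimes> 1) * (1 \<otimes> b)))"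
      by (rule asymp_eq_sym[OF mult])
    \<comment> \<open>The commutation in C(G) \<otimes> A is exact; \<Upsilon> carries it over to
      the limit.\<close>
    also have "(f \<otimes> 1) * (1 \<otimes> b) = (1 \<otimes> b) * (f \<otimes> 1)"
      by (simp add: elem_tensor_mult)
    also have "(\<lambda>t. \<Upsilon> t \<dots>) \<simeq> (\<lambda>t. \<Upsilon> t (1 \<otimes> b) * \<Upsilon> t (f \<otimes> 1))"
      by (rule mult)
    also have "\<dots> \<simeq> (\<lambda>t. b * \<Phi> t f)"
      unfolding \<Phi>_def by (rule asymp_eq_mult[OF id' asymp_eq_refl Bfun_const Bfun_\<Phi>])
    finally show "(\<lambda>t. \<Phi> t f * b) \<simeq> (\<lambda>t. b * \<Phi> t f)" .
  qed
  ultimately show ?thesis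
    unfolding continuous_Rokhlin_property_def by blast
qed

text \<open>The image of \<open>a \<mapsto> (g \<mapsto> \<alpha>\<^sub>g(a))\<close> consists of fixed points of \<open>Lt \<otimes> \<alpha>\<close>, so an equivariant
  \<open>\<Upsilon>\<close> maps it asymptotically into \<open>A\<^sup>\<alpha>\<close>.\<close>

lemma asymptotic_retraction_onto_fixed_points:
  fixes \<alpha> :: "'g::topological_group_add \<Rightarrow> 'a::{cstar_algebra, real_normed_algebra_1} \<Rightarrow> 'a"
    and \<Upsilon> :: "real \<Rightarrow> ('g \<Rightarrow>\<^sub>C 'a) \<Rightarrow> 'a"
  assumes G: "compact (UNIV :: 'g set)" and action: "continuous_action \<alpha>"
    and \<Upsilon>: "asymptotic_morphism UNIV \<Upsilon>" "asymp_equivariant (Lt_tensor \<alpha>) \<alpha> \<Upsilon>"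
    and id: "\<And>a. ((\<lambda>t. \<Upsilon> t (1 \<otimes> a)) \<longlongrightarrow> a) at_top" and bounded: "\<And>F. Bfun (\<lambda>t. \<Upsilon> t F) at_top"
  obtains \<Psi> :: "real \<Rightarrow> 'a \<Rightarrow> 'a"
  where "asymptotic_morphism (fixed_points \<alpha>) \<Psi>" "\<And>t a. \<Psi> t a \<in> fixed_points \<alpha>"
    "\<And>a. a \<in> fixed_points \<alpha> \<Longrightarrow> ((\<lambda>t. \<Psi> t a) \<longlongrightarrow> a) at_top"
proof -
  note lin = clinear_map_action[OF action]
  define \<iota> where "\<iota> a = Bcontfun (\<lambda>g. \<alpha> g a)" for a
  have \<iota>: "\<iota> a g = \<alpha> g a" for a g
    by (simp add: \<iota>_def apply_Bcontfun[OF G continuous_on_action[OF action]])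
  have \<iota>_linear: "\<iota> (z *\<^sub>C a + b) = z *\<^sub>C \<iota> a + \<iota> b" and \<iota>_mult: "\<iota> (a * b) = \<iota> a * \<iota> b"
    and \<iota>_adj: "\<iota> (adj a) = adj (\<iota> a)" for z a b
    using lin by (auto intro!: bcontfun_eqI simp: \<iota> clinear_map_def action_mult[OF action] action_adj[OF action])
  have \<iota>_invariant: "Lt_tensor \<alpha> g (\<iota> a) = \<iota> a" for g a
    by (rule bcontfun_eqI) (simp add: apply_Lt_tensor[OF G action] \<iota> flip: action_plus[OF action] add.assoc)
  \<comment> \<open>At a fixed point the function \<iota> a is constant, which is how the hypothesis
    on 1 \<otimes> a enters.\<close>
  have \<iota>_fixed: "\<iota> a = 1 \<otimes> a" if "a \<in> fixed_points \<alpha>" for a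
    using that by (intro bcontfun_eqI) (simp add: \<iota> fixed_points_def)
  have "0 \<in> fixed_points \<alpha>"
    by (simp add: fixed_points_def clinear_map_zero[OF lin])
  then have nonempty: "fixed_points \<alpha> \<noteq> {}" by blast
  have ex: "\<exists>y. continuous_on {0..} y \<and> (\<forall>t. y t \<in> fixed_points \<alpha>) \<and>
      (\<forall>t\<ge>0. norm (y t - \<Upsilon> t (\<iota> a)) \<le> infdist (\<Upsilon> t (\<iota> a)) (fixed_points \<alpha>) + 1 / (1 + t))" for a
  proof -
    have "continuous_on {0..} (\<lambda>t. \<Upsilon> t (\<iota> a))"
      using \<Upsilon>(1) by (simp add: asymptotic_morphism_def)
    then obtain y where "continuous_on {0..} y" "\<And>t. y t \<in> fixed_points \<alpha>"
      "\<And>t. 0 \<le> t \<Longrightarrow> norm (y t - \<Upsilon> t (\<iota> a)) \<le> infdist (\<Upsilon> t (\<iota> a)) (fixed_points \<alpha>) + 1 / (1 + t)"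
      by (rule continuous_near_best_approximation[OF _ convex_fixed_points[OF action] nonempty])
        (rule that; assumption)
    then show ?thesis by blast
  qed
  \<comment> \<open>The selections for different a are independent, so \<Psi> inherits the algebraic
    relations only in the limit, through its closeness to
    \<open>\<Upsilon> t (\<iota> a)\<close>.\<close>
  from choice[OF allI[OF ex]] obtain y where y: "\<forall>a. continuous_on {0..} (y a) \<and> (\<forall>t. y a t \<in> fixed_points \<alpha>) \<and>
      (\<forall>t\<ge>0. norm (y a t - \<Upsilon> t (\<iota> a)) \<le> infdist (\<Upsilon> t (\<iota> a)) (fixed_points \<alpha>) + 1 / (1 + t))"
    ..
  have cont: "continuous_on {0..} (y a)" and fixed: "y a t \<in> fixed_points \<alpha>"
    and near: "0 \<le> t \<Longrightarrow>
      norm (y a t - \<Upsilon> t (\<iota> a)) \<le> infdist (\<Upsilon> t (\<iota> a)) (fixed_points \<alpha>) + 1 / (1 + t)" for a t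
    using spec[OF y, of a] by simp_all
  define \<Psi> where "\<Psi> t a = y a t" for t a
  have \<Psi>_\<Upsilon>: "(\<lambda>t. \<Psi> t a) \<simeq> (\<lambda>t. \<Upsilon> t (\<iota> a))" for a
    unfolding asymp_eq_iff_norm
  proof (rule tendstoI)
    fix e :: real assume "e > 0"
    have "\<forall>\<^sub>F t in at_top. \<forall>g. norm (\<Upsilon> t (Lt_tensor \<alpha> g (\<iota> a)) - \<alpha> g (\<Upsilon> t (\<iota> a))) \<le> e / 2"
      using \<Upsilon>(2) half_gt_zero[OF \<open>e > 0\<close>] by (simp only: asymp_equivariant_iff)
    then show "\<forall>\<^sub>F t in at_top. dist (norm (\<Psi> t a - \<Upsilon> t (\<iota> a))) 0 < e"
      using eventually_gt_at_top[of "2 / e"]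
    proof eventually_elim
      case (elim t)
      \<comment> \<open>Almost invariance puts a fixed point within e / 2, and for t > 2 / e the
        margin 1 / (1 + t) of the selection is below e / 2.\<close>
      have "norm (\<alpha> g (\<Upsilon> t (\<iota> a)) - \<Upsilon> t (\<iota> a)) \<le> e / 2" for g
        using elim(1)[rule_format, of g] by (simp add: \<iota>_invariant norm_minus_commute)
      from fixed_point_near[OF action G this] obtain p
        where p: "p \<in> fixed_points \<alpha>" "norm (p - \<Upsilon> t (\<iota> a)) \<le> e / 2"
        by blast
      have "infdist (\<Upsilon> t (\<iota> a)) (fixed_points \<alpha>) \<le> e / 2"
        using infdist_le[OF p(1), of "\<Upsilon> t (\<iota> a)"] p(2) by (simp add: dist_norm norm_minus_commute)
      moreover have "0 < 2 / e" using \<open>e > 0\<close> by simp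
      then have "t > 0" using elim(2) by linarith
      moreover have "1 / (1 + t) < e / 2"
        using elim(2) \<open>e > 0\<close> \<open>t > 0\<close> by (simp add: field_simps)
      ultimately show ?case
        using near[of t a] by (simp add: \<Psi>_def)
    qed
  qed
  have Bfun_\<Psi>: "Bfun (\<lambda>t. \<Psi> t a) at_top" for a
    by (rule Bfun_asymp_eq[OF \<Psi>_\<Upsilon> bounded])
  have "asymptotic_morphism (fixed_points \<alpha>) \<Psi>"
    unfolding asymptotic_morphism_asymp_eq
  proof (intro conjI allI impI)
    show "\<Psi> t a \<in> fixed_points \<alpha>" for t a
      by (simp add: \<Psi>_def fixed)
    show "continuous_on {0..} (\<lambda>t. \<Psi> t a)" for a
      using cont[of a] by (simp add: \<Psi>_def)
    fix z a b
    have "(\<lambda>t. \<Psi> t (z *\<^sub>C a + b)) \<simeq> (\<lambda>t. \<Upsilon> t (z *\<^sub>C \<iota> a + \<iota> b))"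
      using \<Psi>_\<Upsilon>[of "z *\<^sub>C a + b"] by (simp only: \<iota>_linear)
    also have "\<dots> \<simeq> (\<lambda>t. z *\<^sub>C \<Upsilon> t (\<iota> a) + \<Upsilon> t (\<iota> b))"
      using \<Upsilon>(1) by (simp only: asymptotic_morphism_asymp_eq)
    also have "\<dots> \<simeq> (\<lambda>t. z *\<^sub>C \<Psi> t a + \<Psi> t b)"
      by (intro asymp_eq_add asymp_eq_bounded_linear[OF bounded_linear_scaleC_right] asymp_eq_sym[OF \<Psi>_\<Upsilon>])
    finally show "(\<lambda>t. \<Psi> t (z *\<^sub>C a + b)) \<simeq> (\<lambda>t. z *\<^sub>C \<Psi> t a + \<Psi> t b)" .
    have "(\<lambda>t. \<Psi> t (a * b)) \<simeq> (\<lambda>t. \<Upsilon> t (\<iota> a * \<iota> b))"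
      using \<Psi>_\<Upsilon>[of "a * b"] by (simp only: \<iota>_mult)
    also have "\<dots> \<simeq> (\<lambda>t. \<Upsilon> t (\<iota> a) * \<Upsilon> t (\<iota> b))"
      using \<Upsilon>(1) by (simp only: asymptotic_morphism_asymp_eq)
    also have "\<dots> \<simeq> (\<lambda>t. \<Psi> t a * \<Psi> t b)"
      by (rule asymp_eq_mult[OF asymp_eq_sym[OF \<Psi>_\<Upsilon>] asymp_eq_sym[OF \<Psi>_\<Upsilon>] Bfun_\<Psi> bounded])
    finally show "(\<lambda>t. \<Psi> t (a * b)) \<simeq> (\<lambda>t. \<Psi> t a * \<Psi> t b)" .
    have "(\<lambda>t. \<Psi> t (adj a)) \<simeq> (\<lambda>t. \<Upsilon> t (adj (\<iota> a)))"
      using \<Psi>_\<Upsilon>[of "adj a"] by (simp only: \<iota>_adj)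
    also have "\<dots> \<simeq> (\<lambda>t. adj (\<Upsilon> t (\<iota> a)))"
      using \<Upsilon>(1) by (simp only: asymptotic_morphism_asymp_eq)
    also have "\<dots> \<simeq> (\<lambda>t. adj (\<Psi> t a))"
      by (rule asymp_eq_bounded_linear[OF bounded_linear_adj asymp_eq_sym[OF \<Psi>_\<Upsilon>]])
    finally show "(\<lambda>t. \<Psi> t (adj a)) \<simeq> (\<lambda>t. adj (\<Psi> t a))" .
  qed
  moreover have "((\<lambda>t. \<Psi> t a) \<longlongrightarrow> a) at_top" if "a \<in> fixed_points \<alpha>" for a
  proof -
    have "(\<lambda>t. \<Psi> t a) \<simeq> (\<lambda>t. \<Upsilon> t (1 \<otimes> a))"
      using \<Psi>_\<Upsilon>[of a] by (simp only: \<iota>_fixed[OF that])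
    also have "\<dots> \<simeq> (\<lambda>_. a)"
      using id by (simp add: asymp_eq_const_iff)
    finally show ?thesis
      by (simp add: asymp_eq_const_iff)
  qed
  ultimately show ?thesis
    using that fixed by (simp add: \<Psi>_def)
qed

theorem theorem1p7:
  fixes \<alpha> :: "'g::{topological_group_add, t2_space, second_countable_topology} \<Rightarrow>
    'a::{cstar_algebra, real_normed_algebra_1} \<Rightarrow> 'a"
  assumes "compact (UNIV :: 'g set)"
    and "separable_space (euclidean :: 'a topology)"
    and "continuous_action \<alpha>"
  shows "(continuous_Rokhlin_property \<alpha> \<longleftrightarrow>
      (\<exists>\<Upsilon> :: real \<Rightarrow> ('g \<Rightarrow>\<^sub>C 'a) \<Rightarrow> 'a.
        asymptotic_morphism UNIV \<Upsilon> \<and> asymp_unital \<Upsilon> \<and> asymp_completely_positive \<Upsilon> \<and>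
        asymp_equivariant (Lt_tensor \<alpha>) \<alpha> \<Upsilon> \<and>
        (\<forall>a. ((\<lambda>t. \<Upsilon> t (1 \<otimes> a)) \<longlongrightarrow> a) at_top))) \<and>
    (continuous_Rokhlin_property \<alpha> \<longrightarrow>
      (\<exists>\<Psi> :: real \<Rightarrow> 'a \<Rightarrow> 'a.
        asymptotic_morphism (fixed_points \<alpha>) \<Psi> \<and>
        asymp_equivariant (trivial_action :: 'g \<Rightarrow> 'a \<Rightarrow> 'a) \<alpha> \<Psi> \<and>
        (\<forall>a\<in>fixed_points \<alpha>. ((\<lambda>t. \<Psi> t a) \<longlongrightarrow> a) at_top)))"
proof (intro conjI iffI impI)
  assume "continuous_Rokhlin_property \<alpha>"
  then obtain \<Upsilon> :: "real \<Rightarrow> ('g \<Rightarrow>\<^sub>C 'a) \<Rightarrow> 'a"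
    where \<Upsilon>: "asymptotic_morphism UNIV \<Upsilon>" "asymp_unital \<Upsilon>" "asymp_completely_positive \<Upsilon>"
      "asymp_equivariant (Lt_tensor \<alpha>) \<alpha> \<Upsilon>" "\<And>a. ((\<lambda>t. \<Upsilon> t (1 \<otimes> a)) \<longlongrightarrow> a) at_top"
      "\<And>F. Bfun (\<lambda>t. \<Upsilon> t F) at_top"
    by (rule Rokhlin_imp_asymptotic_morphism[OF assms]) (rule that; assumption)
  then show "\<exists>\<Upsilon> :: real \<Rightarrow> ('g \<Rightarrow>\<^sub>C 'a) \<Rightarrow> 'a.
      asymptotic_morphism UNIV \<Upsilon> \<and> asymp_unital \<Upsilon> \<and> asymp_completely_positive \<Upsilon> \<and>
      asymp_equivariant (Lt_tensor \<alpha>) \<alpha> \<Upsilon> \<and> (\<forall>a. ((\<lambda>t. \<Upsilon> t (1 \<otimes> a)) \<longlongrightarrow> a) at_top)"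
    by blast
  obtain \<Psi> :: "real \<Rightarrow> 'a \<Rightarrow> 'a"
    where \<Psi>: "asymptotic_morphism (fixed_points \<alpha>) \<Psi>" "\<And>t a. \<Psi> t a \<in> fixed_points \<alpha>"
      "\<And>a. a \<in> fixed_points \<alpha> \<Longrightarrow> ((\<lambda>t. \<Psi> t a) \<longlongrightarrow> a) at_top"
    by (rule asymptotic_retraction_onto_fixed_points[OF assms(1,3) \<Upsilon>(1,4,5,6)]) (rule that; assumption)
  moreover have "asymp_equivariant (trivial_action :: 'g \<Rightarrow> 'a \<Rightarrow> 'a) \<alpha> \<Psi>"
    using \<Psi>(2) by (simp add: asymp_equivariant_iff trivial_action_def fixed_points_def)
  ultimately show "\<exists>\<Psi> :: real \<Rightarrow> 'a \<Rightarrow> 'a. asymptotic_morphism (fixed_points \<alpha>) \<Psi> \<and>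
      asymp_equivariant (trivial_action :: 'g \<Rightarrow> 'a \<Rightarrow> 'a) \<alpha> \<Psi> \<and>
      (\<forall>a\<in>fixed_points \<alpha>. ((\<lambda>t. \<Psi> t a) \<longlongrightarrow> a) at_top)"
    by blast
qed (use asymptotic_morphism_imp_Rokhlin[OF assms(3)] in blast)

end
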